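(* Let $d\ge2$ be an integer, let $\kappa_d=\frac{2^{d-1}\zeta(d+1)}{\zeta(d)}$, and let $\mu^n_{\mathrm{diam}}$ be the mean of the distribution of the diameter of a (uniformly random) lattice zonotope inscribed in $[0,n]^d$. Then, as $n\to+\infty$, $$\mu^n_{\mathrm{diam}}=\frac{\sqrt[d+1]{\kappa_d}}{\zeta(d+1)}\;n^{\frac d{d+1}}\,(1+o(1)).$$
   Context: A lattice zonotope in $\mathbb{R}^d$ is a polytope that, up to translation, has the form $\{\sum_{i=1}^k\alpha_i v_i : \alpha_1,\dots,\alpha_k\in[0,1]\}$ for some $k\in\mathbb{N}$ and $v_1,\dots,v_k\in\mathbb{Z}^d$; lattice zonotopes are considered up to translation. A lattice zonotope is inscribed in $[0,n]^d$ if, up to translation, its smallest enclosing axis-parallel box is $[0,n]^d$, i.e. for every $i$ its projection on the $i$-th coordinate axis has length exactly $n$. There are finitely many such zonotopes for each $n$. The diameter of a zonotope means the graph diameter of its vertex-edge graph (the maximum over pairs of vertices of the least number of edges in a path joining them). $\zeta$ is the Riemann zeta function. *)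

theory Defs
  imports "HOL-Probability.Probability"
begin

(* The Dirichlet series of the Riemann zeta function; a junk value for s \<le> 1, where it diverges. *)
definition zeta :: "real \<Rightarrow> real" where
  "zeta s = (\<Sum>n. 1 / real (Suc n) powr s)"

definition kappa :: "nat \<Rightarrow> real" where
  "kappa d = 2 ^ (d - 1) * zeta (real d + 1) / zeta (real d)"

definition lattice_zonotope :: "(real ^ 'd) set \<Rightarrow> bool" where
  "lattice_zonotope P \<longleftrightarrow>
     (\<exists>k (v :: nat \<Rightarrow> real ^ 'd) t.
        (\<forall>i<k. \<forall>j. v i $ j \<in> \<int>) \<and>
        P = (+) t ` {\<Sum>i<k. \<alpha> i *\<^sub>R v i | \<alpha> :: nat \<Rightarrow> real. \<forall>i<k. \<alpha> i \<in> {0..1}})"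

definition enclosing_box :: "(real ^ 'd) set \<Rightarrow> (real ^ 'd) set" where
  "enclosing_box P = (\<lambda>B. \<exists>a b. B = cbox a b) hull P"

definition inscribed_in_cube :: "nat \<Rightarrow> (real ^ 'd) set \<Rightarrow> bool" where
  "inscribed_in_cube n P \<longleftrightarrow> (\<exists>t. enclosing_box ((+) t ` P) = cbox 0 (vec (real n)))"

definition translation_equiv :: "((real ^ 'd) set \<times> (real ^ 'd) set) set" where
  "translation_equiv = {(P, Q). \<exists>t. Q = (+) t ` P}"

definition inscribed_zonotopes :: "nat \<Rightarrow> (real ^ 'd) set set set" where
  "inscribed_zonotopes n = {P. lattice_zonotope P \<and> inscribed_in_cube n P} // translation_equiv"

definition polytope_vertices :: "(real ^ 'd) set \<Rightarrow> (real ^ 'd) set" where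
  "polytope_vertices P = {v. v extreme_point_of P}"

definition polytope_adjacency :: "(real ^ 'd) set \<Rightarrow> ((real ^ 'd) \<times> (real ^ 'd)) set" where
  "polytope_adjacency P = {(u, v). closed_segment u v edge_of P}"

definition graph_dist :: "('v \<times> 'v) set \<Rightarrow> 'v \<Rightarrow> 'v \<Rightarrow> nat" where
  "graph_dist E u v = (LEAST k. (u, v) \<in> E ^^ k)"

definition graph_diameter :: "'v set \<Rightarrow> ('v \<times> 'v) set \<Rightarrow> nat" where
  "graph_diameter V E = Max {graph_dist E u v | u v. u \<in> V \<and> v \<in> V}"

definition polytope_diameter :: "(real ^ 'd) set \<Rightarrow> nat" where
  "polytope_diameter P = graph_diameter (polytope_vertices P) (polytope_adjacency P)"

(* All members of a translation class have the same diameter, see class_diameter_eq below. *)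
definition class_diameter :: "(real ^ 'd) set set \<Rightarrow> nat" where
  "class_diameter C = the_elem (polytope_diameter ` C)"

(* The argument of type 'd itself carries the dimension CARD('d). *)
definition mean_diameter :: "'d::finite itself \<Rightarrow> nat \<Rightarrow> real" where
  "mean_diameter _ n =
     measure_pmf.expectation (pmf_of_set (inscribed_zonotopes n :: (real ^ 'd) set set set))
       (\<lambda>C. real (class_diameter C))"

lemma equiv_translation_equiv: "equiv UNIV (translation_equiv :: ((real ^ 'd) set \<times> (real ^ 'd) set) set)"
proof (rule equivI)
  show "refl (translation_equiv :: ((real ^ 'd) set \<times> (real ^ 'd) set) set)"
  proof (rule reflI)
    fix P :: "(real ^ 'd) set"
    have "P = (+) 0 ` P" by simp
    then show "(P, P) \<in> translation_equiv" unfolding translation_equiv_def by blast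
  qed
  show "sym (translation_equiv :: ((real ^ 'd) set \<times> (real ^ 'd) set) set)"
  proof (rule symI)
    fix P Q :: "(real ^ 'd) set"
    assume "(P, Q) \<in> translation_equiv"
    then obtain t where "Q = (+) t ` P" unfolding translation_equiv_def by blast
    then have "P = (+) (- t) ` Q" by (simp add: image_image)
    then show "(Q, P) \<in> translation_equiv" unfolding translation_equiv_def by blast
  qed
  show "trans (translation_equiv :: ((real ^ 'd) set \<times> (real ^ 'd) set) set)"
  proof (rule transI)
    fix P Q R :: "(real ^ 'd) set"
    assume "(P, Q) \<in> translation_equiv" "(Q, R) \<in> translation_equiv"
    then obtain s t where "Q = (+) s ` P" "R = (+) t ` Q" unfolding translation_equiv_def by blast
    then have "R = (+) (t + s) ` P" by (simp add: image_image add.assoc)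
    then show "(P, R) \<in> translation_equiv" unfolding translation_equiv_def by blast
  qed
qed simp

lemma graph_diameter_bij:
  assumes "bij f" and E: "\<And>u v. (f u, f v) \<in> E' \<longleftrightarrow> (u, v) \<in> E"
  shows "graph_diameter (f ` V) E' = graph_diameter V E"
proof -
  have rel: "(f u, f v) \<in> E' ^^ k \<longleftrightarrow> (u, v) \<in> E ^^ k" for u v k
  proof (induction k arbitrary: v)
    case 0
    then show ?case using assms(1) by (simp add: bij_def inj_eq)
  next
    case (Suc k)
    have "(f u, f v) \<in> E' ^^ Suc k \<longleftrightarrow> (\<exists>w. (f u, f w) \<in> E' ^^ k \<and> (f w, f v) \<in> E')"
      using bij_is_surj[OF assms(1)] by (auto simp: relcomp_unfold) (metis surjD)
    also have "\<dots> \<longleftrightarrow> (u, v) \<in> E ^^ Suc k" by (auto simp: Suc.IH E relcomp_unfold)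
    finally show ?case .
  qed
  have "graph_dist E' (f u) (f v) = graph_dist E u v" for u v
    unfolding graph_dist_def by (simp add: rel)
  then have "{graph_dist E' u v | u v. u \<in> f ` V \<and> v \<in> f ` V}
      = {graph_dist E u v | u v. u \<in> V \<and> v \<in> V}"
    by (auto simp: image_iff) metis+
  then show ?thesis unfolding graph_diameter_def by simp
qed

lemma polytope_diameter_translation: "polytope_diameter ((+) t ` P) = polytope_diameter P"
proof -
  have V: "polytope_vertices ((+) t ` P) = (+) t ` polytope_vertices P"
    unfolding polytope_vertices_def
    by (simp add: extreme_points_of_translation)
  have A: "(t + u, t + v) \<in> polytope_adjacency ((+) t ` P) \<longleftrightarrow> (u, v) \<in> polytope_adjacency P"
    for u v
    unfolding polytope_adjacency_def edge_of_def
    by (simp add: closed_segment_translation aff_dim_translation_eq)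
  show ?thesis
    unfolding polytope_diameter_def V
    by (rule graph_diameter_bij[OF _ A]) (rule bij_betw_byWitness[where f' = "(+) (- t)"], auto)
qed

lemma class_diameter_eq:
  assumes "C \<in> inscribed_zonotopes n" "P \<in> C"
  shows "class_diameter C = polytope_diameter P"
proof -
  have C: "C \<in> UNIV // translation_equiv"
    using assms(1) unfolding inscribed_zonotopes_def by (auto simp: quotient_def)
  have "polytope_diameter Q = polytope_diameter P" if "Q \<in> C" for Q
  proof -
    have "(P, Q) \<in> translation_equiv"
      using quotient_eq_iff[OF equiv_translation_equiv C C assms(2) that] by simp
    then show ?thesis
      unfolding translation_equiv_def using polytope_diameter_translation by blast
  qed
  then have "polytope_diameter ` C = {polytope_diameter P}" using assms(2) by blast
  then show ?thesis unfolding class_diameter_def by simp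
qed

end

theory Submission
  imports Defs "HOL-Real_Asymp.Real_Asymp"
begin

text \<open>
  Up to translation, a lattice zonotope is a sum of segments \<open>[0, \<omega>(p) p]\<close> with \<open>p\<close> running through the primitive
  integer vectors modulo sign and \<open>\<omega>\<close> a finitely supported multiplicity function. The function \<open>\<omega>\<close> is determined
  by the zonotope, because the width of the zonotope in direction \<open>u\<close> is \<open>\<Sum>p. \<omega>(p) \<bar>u \<bullet> p\<bar>\<close> and these absolute values are
  linearly independent functions of \<open>u\<close>. Being inscribed in the cube of side \<open>n\<close> means \<open>\<Sum>p. \<omega>(p) \<bar>p\<^sub>i\<bar> = n\<close> for every
  coordinate \<open>i\<close>. The diameter is the size of the support of \<open>\<omega>\<close>: vertices correspond to the cells that the
  hyperplanes orthogonal to the generators cut out, edges to crossing one hyperplane, and antipodal cells are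
  separated by all of them (\<open>diameter_eq_card\<close>, \<open>inscribed_zonotopes_bij\<close>, \<open>mean_diameter_eq\<close>). What remains is the
  mean size of the support of a uniformly random \<open>\<omega>\<close> in the finite set \<open>cube_configs n\<close>.

  Give \<open>\<omega>\<close> the weight \<open>exp (- b \<Sum>p. \<omega>(p) \<bar>p\<bar>\<^sub>1)\<close>, which is constant on \<open>cube_configs n\<close>. The total weight of all \<open>\<omega>\<close> is
  \<open>\<Prod>p. 1 / (1 - q\<^sub>p)\<close> with \<open>q\<^sub>p = exp (- b \<bar>p\<bar>\<^sub>1)\<close>; marking each element of the support by \<open>y\<close> multiplies the factor
  of \<open>p\<close> by \<open>1 + (y - 1) q\<^sub>p \<le> exp ((y - 1) q\<^sub>p)\<close>. With \<open>y = exp \<theta>\<close> and Jensen's inequality this bounds \<open>\<theta>\<close> times the mean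
  by \<open>b d n + log Z(b) + (exp \<theta> - 1) F(b) - log (card (cube_configs n))\<close>, where \<open>F(b) = \<Sum>p. q\<^sub>p\<close> and \<open>Z(b)\<close> is the total
  weight (\<open>mean_exp_bound\<close>). If \<open>log (card (cube_configs n))\<close> agrees with \<open>b d n + log Z(b)\<close> to first order, then
  \<open>\<theta> > 0\<close> and \<open>\<theta> < 0\<close>, both tending to \<open>0\<close>, squeeze the mean to \<open>F(b)\<close>.

  Every nonzero integer vector is a nonzero multiple of exactly one representative \<open>p\<close>, so the sum of \<open>F(j b)\<close> over
  \<open>j \<ge> 1\<close> is an elementary product. Since \<open>\<zeta>(d) - 1 < 1\<close>, this relation can be inverted asymptotically by a contraction
  argument, which gives \<open>F(b) \<sim> 2\<^sup>d\<^sup>-\<^sup>1 / \<zeta>(d) b\<^sup>-\<^sup>d\<close>; from \<open>log Z(b) = \<Sum>r. F(r b) / r\<close> then follows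
  \<open>log Z(b) \<sim> \<kappa> b\<^sup>-\<^sup>d\<close>. The choice \<open>b = (\<kappa> / n)\<^bsup>1 / (d + 1)\<^esup>\<close> minimises \<open>b d n + \<kappa> b\<^sup>-\<^sup>d\<close>.

  For the lower bound on the cardinality, work at the logarithmic scale. At a slightly larger \<open>b\<close> most of the total weight
  sits on those \<open>\<omega>\<close> whose coordinate sums all lie just below \<open>n\<close>: the two tails of each coordinate are controlled by
  Chernoff bounds, for which the asymptotics of \<open>Z\<close> is proved with a separate scale in each coordinate. Such an
  \<open>\<omega>\<close> is filled up to coordinate sums exactly \<open>n\<close> with unit vectors, at the cost of a factor \<open>(n + 1)\<^sup>d\<close> that is
  negligible on the logarithmic scale.
\<close>

section \<open>Zonotopes and their graph diameter\<close>

text \<open>Functionals in general position: every perturbation argument below takes its direction from here.\<close>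
lemma open_avoids_hyperplanes:
  fixes N :: "'a::euclidean_space set"
  assumes "finite N" "0 \<notin> N" "open U" "U \<noteq> {}"
  shows "\<exists>x\<in>U. \<forall>z\<in>N. x \<bullet> z \<noteq> 0"
  using assms
proof (induction N arbitrary: U rule: finite_induct)
  case empty
  then show ?case by auto
next
  case (insert z N)
  obtain x where x: "x \<in> U" using insert.prems by auto
  have z: "z \<noteq> 0" using insert.prems by auto
  have "open (U \<inter> {x. x \<bullet> z \<noteq> 0})"
  proof (intro open_Int insert.prems)
    have "{x. x \<bullet> z \<noteq> 0} = (\<lambda>x. x \<bullet> z) -` (- {0})" by auto
    then show "open {x. x \<bullet> z \<noteq> 0}"
      by (auto intro!: open_vimage continuous_intros)
  qed
  moreover have "U \<inter> {x. x \<bullet> z \<noteq> 0} \<noteq> {}"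
  proof (cases "x \<bullet> z = 0")
    case False
    then show ?thesis using x by auto
  next
    case True
    obtain e where e: "e > 0" "ball x e \<subseteq> U"
      using \<open>open U\<close> x open_contains_ball by blast
    define y where "y = x + (e / 2 / norm z) *\<^sub>R z"
    have "dist x y < e" using e z by (simp add: y_def dist_norm)
    moreover have "y \<bullet> z \<noteq> 0" using True z e by (simp add: y_def inner_left_distrib)
    ultimately show ?thesis using e by auto
  qed
  ultimately obtain y where "y \<in> U \<inter> {x. x \<bullet> z \<noteq> 0}" "\<forall>w\<in>N. y \<bullet> w \<noteq> 0"
    using insert.IH[of "U \<inter> {x. x \<bullet> z \<noteq> 0}"] insert.prems by auto
  then show ?case by auto
qed

definition zonotope :: "'i set \<Rightarrow> ('i \<Rightarrow> 'a::euclidean_space) \<Rightarrow> 'a set" where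
  "zonotope I g = {\<Sum>i\<in>I. \<alpha> i *\<^sub>R g i | \<alpha> :: 'i \<Rightarrow> real. \<forall>i\<in>I. \<alpha> i \<in> {0..1}}"

lemma zonotopeI: "\<forall>i\<in>I. \<alpha> i \<in> {0..1} \<Longrightarrow> (\<Sum>i\<in>I. \<alpha> i *\<^sub>R g i) \<in> zonotope I g"
  unfolding zonotope_def by blast

lemma zonotopeE:
  assumes "z \<in> zonotope I g"
  obtains \<alpha> where "\<forall>i\<in>I. \<alpha> i \<in> {0..1}" "z = (\<Sum>i\<in>I. \<alpha> i *\<^sub>R g i)"
  using assms unfolding zonotope_def by blast

lemma zonotope_insert:
  assumes "finite I" "i \<notin> I"
  shows "zonotope (insert i I) g = {x + \<alpha> *\<^sub>R g i | x \<alpha>. x \<in> zonotope I g \<and> \<alpha> \<in> {0..1}}"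
proof (intro set_eqI iffI)
  fix z assume "z \<in> zonotope (insert i I) g"
  then obtain \<alpha> where \<alpha>: "\<forall>j\<in>insert i I. \<alpha> j \<in> {0..1}" "z = (\<Sum>j\<in>insert i I. \<alpha> j *\<^sub>R g j)"
    by (rule zonotopeE)
  then have "z = (\<Sum>j\<in>I. \<alpha> j *\<^sub>R g j) + \<alpha> i *\<^sub>R g i" using assms by (simp add: add.commute)
  then show "z \<in> {x + \<alpha> *\<^sub>R g i | x \<alpha>. x \<in> zonotope I g \<and> \<alpha> \<in> {0..1}}"
    using \<alpha> zonotopeI[of I \<alpha> g] by blast
next
  fix z assume "z \<in> {x + \<alpha> *\<^sub>R g i | x \<alpha>. x \<in> zonotope I g \<and> \<alpha> \<in> {0..1}}"
  then obtain x a where xa: "z = x + a *\<^sub>R g i" "x \<in> zonotope I g" "a \<in> {0..1}" by blast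
  then obtain \<alpha> where \<alpha>: "\<forall>j\<in>I. \<alpha> j \<in> {0..1}" "x = (\<Sum>j\<in>I. \<alpha> j *\<^sub>R g j)"
    using zonotopeE by metis
  have "(\<Sum>j\<in>I. (\<alpha>(i := a)) j *\<^sub>R g j) = x"
    unfolding \<alpha>(2) using assms by (intro sum.cong) auto
  then have "z = (\<Sum>j\<in>insert i I. (\<alpha>(i := a)) j *\<^sub>R g j)"
    using assms xa by (simp add: add.commute)
  then show "z \<in> zonotope (insert i I) g"
    using \<alpha>(1) xa(3) zonotopeI[of "insert i I" "\<alpha>(i := a)" g] by auto
qed

lemma zonotope_empty [simp]: "zonotope {} g = {0}"
  by (auto simp: zonotope_def)

lemma convex_hull_sums:
  fixes A B :: "'a::real_vector set"
  shows "convex hull {x + y | x y. x \<in> A \<and> y \<in> B} = {x + y | x y. x \<in> convex hull A \<and> y \<in> convex hull B}"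
proof -
  have eq: "{x + y | x y. x \<in> S \<and> y \<in> T} = {c. \<exists>a\<in>S. \<exists>b\<in>T. c = a + b}" for S T :: "'a set"
    by blast
  show ?thesis unfolding eq using convex_hull_set_plus[of A B] unfolding set_plus_def .
qed

text \<open>Being polyhedra, zonotopes have only exposed faces, so every face is the set of maximisers of a linear functional.\<close>
lemma polytope_zonotope:
  assumes "finite I"
  shows "polytope (zonotope I g)"
  using assms
proof (induction I rule: finite_induct)
  case empty
  then show ?case by (simp add: polytope_sing)
next
  case (insert i I)
  then obtain V where V: "finite V" "zonotope I g = convex hull V"
    unfolding polytope_def by blast
  have "zonotope (insert i I) g = {x + y | x y. x \<in> convex hull V \<and> y \<in> convex hull {0, g i}}"
    unfolding zonotope_insert[OF insert.hyps] V(2)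
    by (auto simp flip: segment_convex_hull simp: in_segment) 
  also have "\<dots> = convex hull {x + y | x y. x \<in> V \<and> y \<in> {0, g i}}"
    by (rule convex_hull_sums[symmetric])
  finally have "zonotope (insert i I) g = convex hull {x + y | x y. x \<in> V \<and> y \<in> {0, g i}}" .
  moreover have "{x + y | x y. x \<in> V \<and> y \<in> {0, g i}} = (\<lambda>(x, y). x + y) ` (V \<times> {0, g i})"
    by auto
  ultimately show ?case using V(1) unfolding polytope_def by (intro exI conjI) auto
qed

locale independent_generators =
  fixes I :: "'i set" and g :: "'i \<Rightarrow> real ^ 'd"
  assumes finite_I: "finite I"
    and nonzero: "i \<in> I \<Longrightarrow> g i \<noteq> 0"
    and nonparallel: "i \<in> I \<Longrightarrow> j \<in> I \<Longrightarrow> i \<noteq> j \<Longrightarrow> \<not> collinear {0, g i, g j}"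
begin

abbreviation Z where "Z \<equiv> zonotope I g"

abbreviation edges where "edges \<equiv> polytope_adjacency Z"

text \<open>A generic functional attains its maximum over the zonotope at the single point that uses exactly the generators
  on which it is positive. The sets of these generators, here called cells, are the cells of the arrangement of the
  hyperplanes orthogonal to the generators; \<open>corner\<close> sends them to the vertices.\<close>
definition generic :: "real ^ 'd \<Rightarrow> bool" where
  "generic u \<longleftrightarrow> (\<forall>i\<in>I. u \<bullet> g i \<noteq> 0)"

definition pos :: "real ^ 'd \<Rightarrow> 'i set" where
  "pos u = {i\<in>I. u \<bullet> g i > 0}"

definition cells :: "'i set set" where
  "cells = pos ` Collect generic"

definition corner :: "'i set \<Rightarrow> real ^ 'd" where
  "corner A = (\<Sum>i\<in>A. g i)"

definition height :: "real ^ 'd \<Rightarrow> real" where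
  "height u = (\<Sum>i\<in>I. max 0 (u \<bullet> g i))"

text \<open>The coefficients can be chosen one at a time, so a functional is maximal exactly when each coefficient is extreme
  in the direction of the sign of its generator and arbitrary where the functional vanishes.\<close>
lemma height_le:
  assumes "\<forall>i\<in>I. \<alpha> i \<in> {0..1::real}"
  shows "u \<bullet> (\<Sum>i\<in>I. \<alpha> i *\<^sub>R g i) \<le> height u"
    and "u \<bullet> (\<Sum>i\<in>I. \<alpha> i *\<^sub>R g i) = height u \<longleftrightarrow>
          (\<forall>i\<in>I. (u \<bullet> g i > 0 \<longrightarrow> \<alpha> i = 1) \<and> (u \<bullet> g i < 0 \<longrightarrow> \<alpha> i = 0))"
proof -
  define e where "e i = max 0 (u \<bullet> g i) - \<alpha> i * (u \<bullet> g i)" for i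
  have eq: "height u - u \<bullet> (\<Sum>i\<in>I. \<alpha> i *\<^sub>R g i) = sum e I"
    by (simp add: height_def e_def inner_sum_right sum_subtractf)
  have e: "e i \<ge> 0 \<and> (e i = 0 \<longleftrightarrow> (u \<bullet> g i > 0 \<longrightarrow> \<alpha> i = 1) \<and> (u \<bullet> g i < 0 \<longrightarrow> \<alpha> i = 0))"
    if "i \<in> I" for i
  proof -
    have a: "0 \<le> \<alpha> i" "\<alpha> i \<le> 1" using assms that by auto
    consider "u \<bullet> g i > 0" | "u \<bullet> g i = 0" | "u \<bullet> g i < 0" by linarith
    then show ?thesis
    proof cases
      case 1
      then have "e i = (1 - \<alpha> i) * (u \<bullet> g i)" by (simp add: e_def algebra_simps)
      then show ?thesis using 1 a by auto
    next
      case 3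
      then have "e i = \<alpha> i * (- (u \<bullet> g i))" by (simp add: e_def)
      then show ?thesis using 3 a by (auto simp: mult_nonneg_nonpos)
    qed (simp add: e_def)
  qed
  have "sum e I \<ge> 0" using e by (intro sum_nonneg) auto
  then show "u \<bullet> (\<Sum>i\<in>I. \<alpha> i *\<^sub>R g i) \<le> height u" using eq by simp
  have "sum e I = 0 \<longleftrightarrow> (\<forall>i\<in>I. e i = 0)"
    using e finite_I by (intro sum_nonneg_eq_0_iff) auto
  then show "u \<bullet> (\<Sum>i\<in>I. \<alpha> i *\<^sub>R g i) = height u \<longleftrightarrow>
          (\<forall>i\<in>I. (u \<bullet> g i > 0 \<longrightarrow> \<alpha> i = 1) \<and> (u \<bullet> g i < 0 \<longrightarrow> \<alpha> i = 0))"
    using eq e by auto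
qed

lemma corner_eq: "A \<subseteq> I \<Longrightarrow> corner A = (\<Sum>i\<in>I. (if i \<in> A then 1 else 0) *\<^sub>R g i)"
  unfolding corner_def using finite_I
  by (simp add: if_distrib[of "\<lambda>x. x *\<^sub>R _"] sum.If_cases Int_absorb1 cong: if_cong)

lemma corner_in: "A \<subseteq> I \<Longrightarrow> corner A \<in> Z"
  using zonotopeI[of I "\<lambda>i. if i \<in> A then 1 else 0" g] by (simp add: corner_eq)

lemma pos_subset: "pos u \<subseteq> I" by (auto simp: pos_def)

lemma finite_pos: "finite (pos u)" by (rule finite_subset[OF pos_subset finite_I])

lemma cells_subset: "A \<in> cells \<Longrightarrow> A \<subseteq> I" by (auto simp: cells_def pos_def)

lemma height_corner: "u \<bullet> corner (pos u) = height u"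
  using height_le(2)[of "\<lambda>i. if i \<in> pos u then 1 else 0" u] corner_eq[OF pos_subset[of u]]
  by (auto simp: pos_def)

lemma supporting_value:
  assumes "Z \<subseteq> {x. u \<bullet> x \<le> b}" "Z \<inter> {x. u \<bullet> x = b} \<noteq> {}"
  shows "b = height u"
proof (rule antisym)
  show "b \<le> height u"
    using assms(2) height_le(1) by (auto elim!: zonotopeE)
  show "height u \<le> b"
    using assms(1) corner_in[OF pos_subset[of u]] height_corner[of u] by auto
qed

lemma height_face: "(Z \<inter> {x. u \<bullet> x = height u}) face_of Z"
proof (rule face_of_Int_supporting_hyperplane_le)
  show "convex Z" using polytope_imp_convex polytope_zonotope finite_I by blast
qed (auto elim!: zonotopeE intro!: height_le)

lemma face_imp_height_face:
  assumes "F face_of Z" "F \<noteq> {}"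
  shows "\<exists>u. F = Z \<inter> {x. u \<bullet> x = height u}"
proof -
  have "F exposed_face_of Z"
    using assms(1)
    by (simp add: exposed_face_of_polyhedron[OF polytope_imp_polyhedron[OF polytope_zonotope[OF finite_I]]])
  then obtain u b where "Z \<subseteq> {x. u \<bullet> x \<le> b}" "F = Z \<inter> {x. u \<bullet> x = b}"
    unfolding exposed_face_of_def by blast
  moreover from this have "b = height u" using assms(2) by (intro supporting_value) auto
  ultimately show ?thesis by auto
qed

lemma height_face_unique:
  assumes "generic u"
  shows "Z \<inter> {x. u \<bullet> x = height u} = {corner (pos u)}"
proof (intro equalityI subsetI)
  fix x assume x: "x \<in> Z \<inter> {x. u \<bullet> x = height u}"
  then obtain \<alpha> where \<alpha>: "\<forall>i\<in>I. \<alpha> i \<in> {0..1}" "x = (\<Sum>i\<in>I. \<alpha> i *\<^sub>R g i)"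
    using zonotopeE by blast
  have "\<forall>i\<in>I. (u \<bullet> g i > 0 \<longrightarrow> \<alpha> i = 1) \<and> (u \<bullet> g i < 0 \<longrightarrow> \<alpha> i = 0)"
    using x height_le(2)[OF \<alpha>(1), of u] \<alpha>(2) by simp
  then have "\<alpha> i = (if i \<in> pos u then 1 else 0)" if "i \<in> I" for i
    using that assms unfolding pos_def generic_def by (auto simp: not_less less_le)
  then show "x \<in> {corner (pos u)}" unfolding corner_eq[OF pos_subset] \<alpha>(2) by simp
next
  fix x assume "x \<in> {corner (pos u)}"
  then show "x \<in> Z \<inter> {x. u \<bullet> x = height u}"
    using corner_in[OF pos_subset[of u]] height_corner[of u] by simp
qed

text \<open>A vertex has only one representation as a sum of generators, since a functional that exposes it forces
  every coefficient.\<close>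
lemma corner_inj:
  assumes "A \<in> cells" "B \<subseteq> I" "corner A = corner B"
  shows "A = B"
proof -
  obtain u where u: "generic u" "A = pos u" using assms(1) unfolding cells_def by auto
  have "u \<bullet> corner B = height u" using assms u height_corner by metis
  then have "\<forall>i\<in>I. (u \<bullet> g i > 0 \<longrightarrow> i \<in> B) \<and> (u \<bullet> g i < 0 \<longrightarrow> i \<notin> B)"
    using height_le(2)[of "\<lambda>i. if i \<in> B then 1 else 0" u] corner_eq[OF assms(2)]
    by (auto split: if_splits)
  then show ?thesis using u assms(2) unfolding pos_def generic_def by (force simp: not_less less_le)
qed

lemma vertices_eq: "polytope_vertices Z = corner ` cells"
proof (intro equalityI subsetI)
  fix x assume "x \<in> polytope_vertices Z"
  then have "{x} face_of Z" by (simp add: polytope_vertices_def face_of_singleton)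
  then obtain u where u: "{x} = Z \<inter> {x. u \<bullet> x = height u}"
    using face_imp_height_face by blast
  have x: "x = corner (pos u)" using u corner_in[OF pos_subset[of u]] height_corner[of u] by auto
  have "generic u"
    unfolding generic_def
  proof (intro ballI notI)
    fix i assume i: "i \<in> I" "u \<bullet> g i = 0"
    then have "i \<notin> pos u" by (auto simp: pos_def)
    then have s: "corner (insert i (pos u)) = g i + corner (pos u)"
      using finite_I finite_subset[OF pos_subset] by (simp add: corner_def)
    have "corner (insert i (pos u)) \<in> Z" using i pos_subset by (intro corner_in) auto
    moreover have "u \<bullet> corner (insert i (pos u)) = height u"
      using i height_corner[of u] by (simp add: s inner_right_distrib)
    ultimately have "corner (insert i (pos u)) = x" using u by auto
    then show False using s x nonzero[OF i(1)] by simp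
  qed
  then show "x \<in> corner ` cells" using x by (auto simp: cells_def)
next
  fix x assume "x \<in> corner ` cells"
  then obtain u where u: "generic u" "x = corner (pos u)" by (auto simp: cells_def)
  have "{x} face_of Z"
    using height_face[of u] height_face_unique[OF u(1)] u(2) by simp
  then show "x \<in> polytope_vertices Z"
    by (simp add: polytope_vertices_def face_of_singleton)
qed

lemma generic_exists:
  assumes "open U" "U \<noteq> {}"
  shows "\<exists>u\<in>U. generic u"
proof -
  have "0 \<notin> g ` I" using nonzero by auto
  then obtain u where "u \<in> U" "\<forall>z\<in>g ` I. u \<bullet> z \<noteq> 0"
    using open_avoids_hyperplanes[of "g ` I" U] assms finite_I by blast
  then show ?thesis unfolding generic_def by blast
qed

text \<open>Tilting a functional that vanishes on the generator \<open>k\<close> alone to either side of its hyperplane gives the two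
  cells that meet along this wall.\<close>
lemma wall_cells:
  assumes "k \<in> I" "v \<bullet> g k = 0" "\<And>i. i \<in> I \<Longrightarrow> i \<noteq> k \<Longrightarrow> v \<bullet> g i \<noteq> 0"
  shows "pos v \<in> cells" "insert k (pos v) \<in> cells"
proof -
  define V where "V = (\<Inter>i\<in>I-{k}. {x. x \<bullet> g i * (v \<bullet> g i) > 0})"
  have "open V" unfolding V_def
    by (intro open_INT) (auto intro!: finite_I open_Collect_less continuous_intros)
  moreover have "v \<in> V" using assms(3) not_real_square_gt_zero unfolding V_def by blast
  ultimately obtain e where e: "e > 0" "ball v e \<subseteq> V" using open_contains_ball by blast
  define d where "d = e / 2 / norm (g k)"
  have gk: "g k \<noteq> 0" using assms(1) nonzero by blast
  have d: "d > 0" using e gk by (simp add: d_def)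
  have in_V: "v + s *\<^sub>R g k \<in> V" if "\<bar>s\<bar> = d" for s
  proof -
    have "dist v (v + s *\<^sub>R g k) < e" using that e gk by (simp add: dist_norm d_def)
    then show ?thesis using e by auto
  qed
  have sgn: "(v + s *\<^sub>R g k) \<bullet> g i * (v \<bullet> g i) > 0" if "\<bar>s\<bar> = d" "i \<in> I" "i \<noteq> k" for s i
    using in_V[OF that(1)] that by (auto simp: V_def)
  have k: "(v + s *\<^sub>R g k) \<bullet> g k = s * (g k \<bullet> g k)" for s
    using assms(2) by (simp add: inner_left_distrib)
  have gg: "g k \<bullet> g k > 0" using gk by simp
  have gen: "generic (v + s *\<^sub>R g k)" if "\<bar>s\<bar> = d" for s
    unfolding generic_def
  proof
    fix i assume "i \<in> I"
    then show "(v + s *\<^sub>R g k) \<bullet> g i \<noteq> 0"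
      using sgn[OF that, of i] k[of s] gg d that by (cases "i = k") auto
  qed
  have pv: "pos (v + s *\<^sub>R g k) - {k} = pos v" if "\<bar>s\<bar> = d" for s
  proof -
    have "(v + s *\<^sub>R g k) \<bullet> g i > 0 \<longleftrightarrow> v \<bullet> g i > 0" if "i \<in> I" "i \<noteq> k" for i
      using sgn[OF \<open>\<bar>s\<bar> = d\<close> that] by (auto simp: zero_less_mult_iff)
    then have "i \<in> pos (v + s *\<^sub>R g k) - {k} \<longleftrightarrow> i \<in> pos v" for i
      using assms(2) by (cases "i = k") (auto simp: pos_def)
    then show ?thesis by blast
  qed
  have "k \<in> pos (v + d *\<^sub>R g k)" using k[of d] gg d assms(1) by (simp add: pos_def)
  then have "insert k (pos v) = pos (v + d *\<^sub>R g k)" using pv[of d] d by auto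
  then show "insert k (pos v) \<in> cells" using gen[of d] d by (simp add: cells_def)
  have "k \<notin> pos (v + (-d) *\<^sub>R g k)" using k[of "-d"] gg d assms(1)
    by (simp add: pos_def mult_less_0_iff not_less)
  then have "pos v = pos (v + (-d) *\<^sub>R g k)" using pv[of "-d"] d by auto
  then show "pos v \<in> cells" using gen[of "-d"] d unfolding cells_def by auto
qed

lemma wall_face:
  assumes "k \<in> I" "v \<bullet> g k = 0" "\<And>i. i \<in> I \<Longrightarrow> i \<noteq> k \<Longrightarrow> v \<bullet> g i \<noteq> 0"
  shows "Z \<inter> {x. v \<bullet> x = height v}
    = closed_segment (corner (pos v)) (corner (insert k (pos v)))"
proof -
  have k: "k \<notin> pos v" using assms(2) by (simp add: pos_def)
  have ins: "corner (insert k (pos v)) = corner (pos v) + g k"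
    using k finite_pos by (simp add: corner_def add.commute)
  show ?thesis
  proof (intro equalityI subsetI)
    fix x assume x: "x \<in> Z \<inter> {x. v \<bullet> x = height v}"
    then obtain \<alpha> where \<alpha>: "\<forall>i\<in>I. \<alpha> i \<in> {0..1}" "x = (\<Sum>i\<in>I. \<alpha> i *\<^sub>R g i)"
      using zonotopeE by blast
    have "\<forall>i\<in>I. (v \<bullet> g i > 0 \<longrightarrow> \<alpha> i = 1) \<and> (v \<bullet> g i < 0 \<longrightarrow> \<alpha> i = 0)"
      using x height_le(2)[OF \<alpha>(1), of v] \<alpha>(2) by simp
    then have "\<alpha> i = (if i \<in> pos v then 1 else 0)" if "i \<in> I - {k}" for i
      using that assms unfolding pos_def by (auto simp: not_less less_le)
    then have "(\<Sum>i\<in>I-{k}. \<alpha> i *\<^sub>R g i) = (\<Sum>i\<in>I-{k}. (if i \<in> pos v then 1 else 0) *\<^sub>R g i)"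
      by (intro sum.cong) auto
    moreover have "corner (pos v) = (\<Sum>i\<in>I-{k}. (if i \<in> pos v then 1 else 0) *\<^sub>R g i)"
      unfolding corner_eq[OF pos_subset] using assms(1) finite_I k by (simp add: sum.remove[of I k])
    ultimately have "x = corner (pos v) + \<alpha> k *\<^sub>R g k"
      unfolding \<alpha>(2) using assms(1) finite_I by (simp add: sum.remove[of I k])
    then show "x \<in> closed_segment (corner (pos v)) (corner (insert k (pos v)))"
      unfolding in_segment ins using \<alpha>(1) assms(1)
      by (intro exI[of _ "\<alpha> k"]) (auto simp: algebra_simps)
  next
    have c: "convex (Z \<inter> {x. v \<bullet> x = height v})"
      using face_of_imp_convex height_face by blast
    have "corner (insert k (pos v)) \<in> Z" "corner (pos v) \<in> Z"
      using assms(1) pos_subset by (auto intro!: corner_in)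
    moreover have "v \<bullet> corner (insert k (pos v)) = height v"
      using height_corner[of v] assms(2) by (simp add: ins inner_right_distrib)
    ultimately show "x \<in> Z \<inter> {x. v \<bullet> x = height v}"
      if "x \<in> closed_segment (corner (pos v)) (corner (insert k (pos v)))" for x
      using closed_segment_subset[OF _ _ c] height_corner[of v] that by blast
  qed
qed

text \<open>If the functional that exposes an edge vanished on two generators, the face would contain two nonparallel segments.\<close>
lemma adjacent_imp_wall:
  assumes "(x, y) \<in> edges"
  shows "\<exists>A k. k \<in> I \<and> k \<notin> A \<and> A \<in> cells \<and> insert k A \<in> cells \<and> {x, y} = {corner A, corner (insert k A)}"
proof -
  let ?F = "closed_segment x y"
  have F: "?F face_of Z" "aff_dim ?F = 1"
    using assms by (auto simp: polytope_adjacency_def edge_of_def)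
  then obtain v where v: "?F = Z \<inter> {x. v \<bullet> x = height v}"
    using face_imp_height_face by fastforce
  have pF: "corner (pos v \<union> K) \<in> ?F" if "K \<subseteq> {i\<in>I. v \<bullet> g i = 0}" for K
  proof -
    have "pos v \<inter> K = {}" "finite K" using that finite_I by (auto simp: pos_def intro: finite_subset)
    then have "corner (pos v \<union> K) = corner (pos v) + (\<Sum>i\<in>K. g i)"
      using finite_pos by (simp add: corner_def sum.union_disjoint)
    moreover have "v \<bullet> (\<Sum>i\<in>K. g i) = 0"
      using that by (auto simp: inner_sum_right intro!: sum.neutral)
    moreover have "corner (pos v \<union> K) \<in> Z"
      using that pos_subset by (intro corner_in) auto
    ultimately show ?thesis unfolding v using height_corner[of v] by (simp add: inner_right_distrib)
  qed
  have "\<not> generic v"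
  proof
    assume "generic v"
    then have "?F = {corner (pos v)}" using height_face_unique v by simp
    then show False using F(2) by simp
  qed
  then obtain k where k: "k \<in> I" "v \<bullet> g k = 0" by (auto simp: generic_def)
  have others: "v \<bullet> g i \<noteq> 0" if i: "i \<in> I" "i \<noteq> k" for i
  proof
    assume i0: "v \<bullet> g i = 0"
    have fin: "finite (pos v)" using finite_pos .
    have "corner (pos v \<union> {}) \<in> ?F" "corner (pos v \<union> {i}) \<in> ?F" "corner (pos v \<union> {k}) \<in> ?F"
      using i i0 k by (intro pF; auto)+
    moreover have "corner (pos v \<union> {i}) = corner (pos v) + g i" "corner (pos v \<union> {k}) = corner (pos v) + g k"
      using i0 k fin by (auto simp: corner_def pos_def add.commute)
    ultimately have "{corner (pos v), corner (pos v) + g i, corner (pos v) + g k} \<subseteq> ?F" by simp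
    then have "collinear {corner (pos v), corner (pos v) + g i, corner (pos v) + g k}"
      using collinear_closed_segment collinear_subset by blast
    then obtain d where d: "\<forall>x\<in>{corner (pos v), corner (pos v) + g i, corner (pos v) + g k}.
        \<forall>y\<in>{corner (pos v), corner (pos v) + g i, corner (pos v) + g k}. \<exists>c. x - y = c *\<^sub>R d"
      unfolding collinear_def by blast
    have "\<exists>c. x - y = c *\<^sub>R d" if "x \<in> {0, g i, g k}" "y \<in> {0, g i, g k}" for x y
      using d[rule_format, of "corner (pos v) + x" "corner (pos v) + y"] that by auto
    then have "collinear {0, g i, g k}" unfolding collinear_def by blast
    then show False using nonparallel i k by blast
  qed
  have "?F = closed_segment (corner (pos v)) (corner (insert k (pos v)))"
    using wall_face[OF k others] v by simp
  then have "{x, y} = {corner (pos v), corner (insert k (pos v))}" by simp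
  moreover have "k \<notin> pos v" using k by (simp add: pos_def)
  ultimately show ?thesis using wall_cells[OF k others] k by blast
qed

lemma wall_imp_adjacent:
  assumes "k \<in> I" "v \<bullet> g k = 0" "\<And>i. i \<in> I \<Longrightarrow> i \<noteq> k \<Longrightarrow> v \<bullet> g i \<noteq> 0"
  shows "(corner (pos v), corner (insert k (pos v))) \<in> edges"
proof -
  have ins: "corner (insert k (pos v)) = corner (pos v) + g k"
    using assms finite_pos by (simp add: corner_def add.commute pos_def)
  then have "corner (pos v) \<noteq> corner (insert k (pos v))" using nonzero[OF assms(1)] by simp
  then have "aff_dim (closed_segment (corner (pos v)) (corner (insert k (pos v)))) = 1"
    by (simp add: segment_convex_hull aff_dim_convex_hull aff_dim_2)
  then show ?thesis
    using wall_face[OF assms] height_face[of v]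
    by (simp add: polytope_adjacency_def edge_of_def)
qed

lemma adjacency_sym:
  "(x, y) \<in> polytope_adjacency P \<Longrightarrow> (y, x) \<in> polytope_adjacency P"
  by (simp add: polytope_adjacency_def closed_segment_commute)

text \<open>Walk along a segment from a functional of the first cell to one of the second. If the hyperplanes are met at
  distinct times, the first crossing leads to a neighbouring cell that is one hyperplane closer to the target.\<close>
lemma step_towards:
  assumes A: "A \<in> cells" and B: "B \<in> cells" and "A \<noteq> B"
  shows "\<exists>C k. C \<in> cells \<and> k \<in> sym_diff A B \<and> sym_diff C B = sym_diff A B - {k}
     \<and> (corner A, corner C) \<in> edges"
proof -
  obtain u where u: "generic u" "A = pos u" using A by (auto simp: cells_def)
  obtain w0 where w0: "generic w0" "B = pos w0" using B by (auto simp: cells_def)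
  define V where "V = (\<Inter>i\<in>I. {x. x \<bullet> g i * (w0 \<bullet> g i) > 0})"
  have "open V" unfolding V_def
    by (intro open_INT) (auto intro!: finite_I open_Collect_less continuous_intros)
  moreover have "w0 \<in> V"
    using w0(1) not_real_square_gt_zero unfolding V_def generic_def by blast
  \<comment> \<open>\<open>N\<close> encodes coincidences: the hyperplanes of \<open>i\<close> and \<open>j\<close> are crossed at the same time iff the
    end point is orthogonal to the corresponding vector of \<open>N\<close>.\<close>
  moreover define N where "N = (\<lambda>(i, j). (u \<bullet> g i) *\<^sub>R g j - (u \<bullet> g j) *\<^sub>R g i) ` {(i, j). i \<in> I \<and> j \<in> I \<and> i \<noteq> j}"
  moreover have "finite N"
    unfolding N_def
    by (rule finite_imageI, rule finite_subset[of _ "I \<times> I"]) (auto simp: finite_I)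
  moreover have "0 \<notin> N"
  proof
    assume "0 \<in> N"
    then obtain i j where ij: "i \<in> I" "j \<in> I" "i \<noteq> j" "(u \<bullet> g i) *\<^sub>R g j = (u \<bullet> g j) *\<^sub>R g i"
      by (auto simp: N_def)
    have "u \<bullet> g i \<noteq> 0" using ij u by (auto simp: generic_def)
    then have "g j = ((u \<bullet> g j) / (u \<bullet> g i)) *\<^sub>R g i"
      using ij(4) by (metis (no_types, lifting) divide_inverse_commute scaleR_scaleR scaleR_one left_inverse)
    then have "collinear {0, g i, g j}" unfolding collinear_lemma by blast
    then show False using nonparallel ij by blast
  qed
  ultimately obtain w where w: "w \<in> V" "\<forall>z\<in>N. w \<bullet> z \<noteq> 0"
    using open_avoids_hyperplanes[of N V] by blast
  have wi: "w \<bullet> g i * (w0 \<bullet> g i) > 0" if "i \<in> I" for i using w(1) that by (auto simp: V_def)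
  have wgen: "generic w" using wi by (force simp: generic_def)
  have "w \<bullet> g i > 0 \<longleftrightarrow> w0 \<bullet> g i > 0" if "i \<in> I" for i
    using wi[OF that] by (auto simp: zero_less_mult_iff)
  then have Bw: "B = pos w" unfolding w0(2) pos_def by blast
  \<comment> \<open>The time at which the segment from \<open>u\<close> to \<open>w\<close> crosses the hyperplane of \<open>i\<close>.\<close>
  define t where "t i = (u \<bullet> g i) / (u \<bullet> g i - w \<bullet> g i)" for i
  define D where "D = sym_diff A B"
  have D: "i \<in> D \<longleftrightarrow> i \<in> I \<and> (u \<bullet> g i > 0 \<and> w \<bullet> g i < 0 \<or> u \<bullet> g i < 0 \<and> w \<bullet> g i > 0)" for i
    using u wgen unfolding D_def Bw by (auto simp: pos_def generic_def not_less less_le)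
  have "finite D" using D finite_I by (auto intro: finite_subset[of _ I])
  moreover have "D \<noteq> {}" using \<open>A \<noteq> B\<close> by (auto simp: D_def)
  ultimately obtain k where k: "k \<in> D" "\<And>i. i \<in> D \<Longrightarrow> t k \<le> t i"
    using arg_min_if_finite[of D t] by (metis not_le)
  have tdist: "t i \<noteq> t j" if "i \<in> D" "j \<in> D" "i \<noteq> j" for i j
  proof
    assume "t i = t j"
    moreover have "u \<bullet> g i - w \<bullet> g i \<noteq> 0" "u \<bullet> g j - w \<bullet> g j \<noteq> 0" using that D by force+
    ultimately have "(u \<bullet> g i) * (w \<bullet> g j) - (u \<bullet> g j) * (w \<bullet> g i) = 0"
      unfolding t_def by (simp add: frac_eq_eq algebra_simps)
    then have "w \<bullet> ((u \<bullet> g i) *\<^sub>R g j - (u \<bullet> g j) *\<^sub>R g i) = 0"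
      by (simp add: inner_diff_right)
    moreover have "(u \<bullet> g i) *\<^sub>R g j - (u \<bullet> g j) *\<^sub>R g i \<in> N" using that D unfolding N_def by auto
    ultimately show False using w(2) by blast
  qed
  have tk: "0 < t k" "t k < 1" using D[of k] k(1) by (auto simp: t_def field_simps)
  define v where "v = (1 - t k) *\<^sub>R u + t k *\<^sub>R w"
  have vi: "v \<bullet> g i = (1 - t k) * (u \<bullet> g i) + t k * (w \<bullet> g i)" for i
    by (simp add: v_def inner_left_distrib)
  have kI: "k \<in> I" using k D by blast
  have vk: "v \<bullet> g k = 0"
  proof -
    have "u \<bullet> g k - w \<bullet> g k \<noteq> 0" using k(1) D by force
    then show ?thesis unfolding vi t_def by (simp add: field_simps)
  qed
  have vs: "(v \<bullet> g i > 0 \<longleftrightarrow> u \<bullet> g i > 0) \<and> v \<bullet> g i \<noteq> 0" if i: "i \<in> I" "i \<noteq> k" for i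
  proof (cases "i \<in> D")
    case True
    then have lt: "t k < t i" using k(2) tdist[OF k(1) True] i by force
    have vi': "v \<bullet> g i = u \<bullet> g i - t k * (u \<bullet> g i - w \<bullet> g i)" unfolding vi by (simp add: algebra_simps)
    have "u \<bullet> g i = t i * (u \<bullet> g i - w \<bullet> g i)" using True D[of i] unfolding t_def by force
    then have vi'': "v \<bullet> g i = (t i - t k) * (u \<bullet> g i - w \<bullet> g i)" using vi' by (simp add: algebra_simps)
    show ?thesis using True D[of i] lt unfolding vi'' by (auto simp: zero_less_mult_iff)
  next
    case False
    then have "u \<bullet> g i > 0 \<and> w \<bullet> g i > 0 \<or> u \<bullet> g i < 0 \<and> w \<bullet> g i < 0"
      using i D[of i] u wgen unfolding generic_def by (meson linorder_neqE_linordered_idom)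
    then show ?thesis
    proof
      assume "u \<bullet> g i > 0 \<and> w \<bullet> g i > 0"
      then show ?thesis unfolding vi using tk by (simp add: add_pos_pos less_imp_neq[symmetric])
    next
      assume a: "u \<bullet> g i < 0 \<and> w \<bullet> g i < 0"
      then have "(1 - t k) * (u \<bullet> g i) < 0" "t k * (w \<bullet> g i) < 0" using tk by (auto simp: mult_pos_neg)
      then show ?thesis unfolding vi using a by linarith
    qed
  qed
  have wall: "\<And>i. i \<in> I \<Longrightarrow> i \<noteq> k \<Longrightarrow> v \<bullet> g i \<noteq> 0" using vs by blast
  have "i \<in> pos v \<longleftrightarrow> i \<in> A - {k}" for i
    using vs[of i] vk u(2) by (cases "i = k") (auto simp: pos_def)
  then have pv: "pos v = A - {k}" by blast
  note adj = wall_imp_adjacent[OF kI vk wall]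
  note cls = wall_cells[OF kI vk wall]
  show ?thesis
  proof (cases "k \<in> A")
    case True
    then have "insert k (pos v) = A" using pv by auto
    then have "(corner A, corner (A - {k})) \<in> edges" "A - {k} \<in> cells"
      using adj adjacency_sym cls pv by auto
    moreover have "sym_diff (A - {k}) B = sym_diff A B - {k}" using k(1) True by (auto simp: D_def)
    ultimately show ?thesis using k(1) by (auto simp: D_def)
  next
    case False
    then have "pos v = A" using pv by auto
    then have "(corner A, corner (insert k A)) \<in> edges" "insert k A \<in> cells"
      using adj cls by auto
    moreover have "sym_diff (insert k A) B = sym_diff A B - {k}" using k(1) False by (auto simp: D_def)
    ultimately show ?thesis using k(1) unfolding D_def by blast
  qed
qed

lemma path_exists:
  assumes "A \<in> cells" "B \<in> cells"
  shows "(corner A, corner B) \<in> edges ^^ card (sym_diff A B)"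
  using assms
proof (induction "card (sym_diff A B)" arbitrary: A)
  case 0
  have "finite (sym_diff A B)" using cells_subset 0 finite_I by (meson finite_Diff finite_Un finite_subset)
  then have "A = B" using 0 by auto
  then show ?case using 0 by auto
next
  case (Suc n)
  have fin: "finite (sym_diff A B)" using cells_subset Suc.prems finite_I by (meson finite_Diff finite_Un finite_subset)
  have "A \<noteq> B" using Suc.hyps(2) by auto
  then obtain C k where C: "C \<in> cells" "k \<in> sym_diff A B" "sym_diff C B = sym_diff A B - {k}"
     "(corner A, corner C) \<in> edges" using step_towards Suc.prems by blast
  have "card (sym_diff C B) = n" using C fin Suc.hyps(2) by (simp add: card_Diff_singleton del: Un_iff)
  then have "(corner C, corner B) \<in> edges ^^ n"
    using Suc.hyps(1)[of C] C Suc.prems by auto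
  then show ?case using C(4) Suc.hyps(2) by (metis relpow_Suc_I2)
qed

lemma path_length:
  assumes "A \<in> cells" "B \<in> cells" "(corner A, corner B) \<in> edges ^^ n"
  shows "card (sym_diff A B) \<le> n"
  using assms
proof (induction n arbitrary: B)
  case 0
  then have "A = B" using corner_inj[of A B] cells_subset by auto
  then show ?case by simp
next
  case (Suc n)
  then obtain y where y: "(corner A, y) \<in> edges ^^ n"
    "(y, corner B) \<in> edges" by auto
  obtain C k where C: "k \<in> I" "k \<notin> C" "C \<in> cells" "insert k C \<in> cells"
    "{y, corner B} = {corner C, corner (insert k C)}"
    using adjacent_imp_wall[OF y(2)] by blast
  have fin: "finite A" "finite B" "finite C"
    using cells_subset Suc.prems C finite_I finite_subset by metis+
  obtain B' where B': "y = corner B'" "B' \<in> cells" "sym_diff B' B = {k}"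
  proof -
    consider "y = corner C" "corner B = corner (insert k C)" | "y = corner (insert k C)" "corner B = corner C"
      using C(5) by (metis doubleton_eq_iff)
    then show ?thesis
    proof cases
      case 1
      then have "B = insert k C" using corner_inj Suc.prems(2) C cells_subset by metis
      then show ?thesis using 1 C by (intro that[of C]) auto
    next
      case 2
      then have "B = C" using corner_inj Suc.prems(2) C cells_subset by metis
      then show ?thesis using 2 C by (intro that[of "insert k C"]) auto
    qed
  qed
  have "card (sym_diff A B') \<le> n" using Suc B' y by blast
  moreover have "sym_diff A B \<subseteq> insert k (sym_diff A B')" using B'(3) by blast
  moreover have "finite (insert k (sym_diff A B'))"
    using fin(1) cells_subset[OF B'(2)] finite_I by (auto intro: finite_subset)
  ultimately have "card (sym_diff A B) \<le> card (insert k (sym_diff A B'))"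
    by (intro card_mono)
  also have "\<dots> \<le> Suc (card (sym_diff A B'))"
    by (cases "finite (sym_diff A B')") (auto simp: card_insert_if)
  finally show ?case using \<open>card (sym_diff A B') \<le> n\<close> by simp
qed

lemma dist_cells:
  assumes "A \<in> cells" "B \<in> cells"
  shows "graph_dist edges (corner A) (corner B) = card (sym_diff A B)"
  unfolding graph_dist_def
  using assms path_exists path_length by (intro Least_equality) auto

text \<open>The distance of two vertices is the number of hyperplanes that separate their cells; opposite functionals are
  separated by all of them.\<close>
lemma diameter_eq_card: "polytope_diameter Z = card I"
proof -
  let ?S = "{graph_dist edges x y | x y.
      x \<in> corner ` cells \<and> y \<in> corner ` cells}"
  have S: "?S = {card (sym_diff A B) | A B. A \<in> cells \<and> B \<in> cells}"
  proof (intro equalityI subsetI)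
    fix m assume "m \<in> ?S"
    then obtain A B where "A \<in> cells" "B \<in> cells"
      "m = graph_dist edges (corner A) (corner B)" by blast
    then show "m \<in> {card (sym_diff A B) | A B. A \<in> cells \<and> B \<in> cells}"
      using dist_cells by blast
  next
    fix m assume "m \<in> {card (sym_diff A B) | A B. A \<in> cells \<and> B \<in> cells}"
    then obtain A B where AB: "A \<in> cells" "B \<in> cells" "m = card (sym_diff A B)" by blast
    show "m \<in> ?S"
      unfolding AB(3) dist_cells[OF AB(1,2), symmetric] using AB(1,2) by blast
  qed
  obtain u where u: "generic u" using generic_exists[of UNIV] by auto
  then have u': "generic (- u)" by (simp add: generic_def)
  have "sym_diff (pos u) (pos (- u)) = I"
    using u by (auto simp: pos_def generic_def not_less less_le)
  moreover have "pos u \<in> cells" "pos (- u) \<in> cells" using u u' by (auto simp: cells_def)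
  ultimately have I: "card I \<in> ?S" unfolding S
    by (intro CollectI exI[of _ "pos u"] exI[of _ "pos (- u)"] conjI) simp_all
  have le: "m \<le> card I" if m: "m \<in> ?S" for m
  proof -
    obtain A B where "A \<in> cells" "B \<in> cells" "m = card (sym_diff A B)" using m unfolding S by blast
    then show ?thesis using cells_subset finite_I by (auto intro!: card_mono)
  qed
  have "finite ?S" using le by (meson finite_nat_set_iff_bounded_le)
  then have "Max ?S = card I" using le I by (intro Max_eqI)
  then show ?thesis by (simp add: polytope_diameter_def graph_diameter_def vertices_eq)
qed

end

section \<open>Widths and enclosing boxes\<close>

lemma inner_zonotope_bounds:
  assumes "finite I" "z \<in> zonotope I g"
  shows "u \<bullet> z \<le> (\<Sum>i\<in>I. max 0 (u \<bullet> g i))" "(\<Sum>i\<in>I. min 0 (u \<bullet> g i)) \<le> u \<bullet> z"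
proof -
  obtain \<alpha> where \<alpha>: "\<forall>i\<in>I. \<alpha> i \<in> {0..1}" "z = (\<Sum>i\<in>I. \<alpha> i *\<^sub>R g i)"
    using zonotopeE assms(2) by blast
  have "min 0 (u \<bullet> g i) \<le> \<alpha> i * (u \<bullet> g i) \<and> \<alpha> i * (u \<bullet> g i) \<le> max 0 (u \<bullet> g i)" if "i \<in> I" for i
  proof -
    have "0 \<le> \<alpha> i" "\<alpha> i \<le> 1" using \<alpha>(1) that by auto
    then show ?thesis
      using mult_left_le_one_le[of "u \<bullet> g i" "\<alpha> i"] mult_left_le_one_le[of "- (u \<bullet> g i)" "\<alpha> i"]
        mult_nonneg_nonneg[of "\<alpha> i" "u \<bullet> g i"] mult_nonneg_nonneg[of "\<alpha> i" "- (u \<bullet> g i)"]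
      by (cases "u \<bullet> g i \<ge> 0") auto
  qed
  then show "u \<bullet> z \<le> (\<Sum>i\<in>I. max 0 (u \<bullet> g i))" "(\<Sum>i\<in>I. min 0 (u \<bullet> g i)) \<le> u \<bullet> z"
    unfolding \<alpha>(2) by (auto simp: inner_sum_right intro!: sum_mono)
qed

lemma inner_zonotope_attained:
  fixes g :: "'i \<Rightarrow> 'a::euclidean_space"
  shows "\<exists>z\<in>zonotope I g. u \<bullet> z = (\<Sum>i\<in>I. max 0 (u \<bullet> g i))"
    "\<exists>z\<in>zonotope I g. u \<bullet> z = (\<Sum>i\<in>I. min 0 (u \<bullet> g i))"
proof -
  have "(\<Sum>i\<in>I. (if u \<bullet> g i > 0 then 1 else 0) *\<^sub>R g i) \<in> zonotope I g"
    by (rule zonotopeI) auto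
  moreover have "u \<bullet> (\<Sum>i\<in>I. (if u \<bullet> g i > 0 then 1 else 0) *\<^sub>R g i) = (\<Sum>i\<in>I. max 0 (u \<bullet> g i))"
    unfolding inner_sum_right by (intro sum.cong) auto
  ultimately show "\<exists>z\<in>zonotope I g. u \<bullet> z = (\<Sum>i\<in>I. max 0 (u \<bullet> g i))" by blast
  have "(\<Sum>i\<in>I. (if u \<bullet> g i < 0 then 1 else 0) *\<^sub>R g i) \<in> zonotope I g"
    by (rule zonotopeI) auto
  moreover have "u \<bullet> (\<Sum>i\<in>I. (if u \<bullet> g i < 0 then 1 else 0) *\<^sub>R g i) = (\<Sum>i\<in>I. min 0 (u \<bullet> g i))"
    unfolding inner_sum_right by (intro sum.cong) auto
  ultimately show "\<exists>z\<in>zonotope I g. u \<bullet> z = (\<Sum>i\<in>I. min 0 (u \<bullet> g i))" by blast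
qed

lemma max_minus_min_0: "max 0 x - min 0 x = \<bar>x::real\<bar>" by (auto simp: max_def min_def)

text \<open>Maximum minus minimum of a functional is invariant under translation, and on a zonotope it is the sum of the
  absolute values on the generators.\<close>
lemma zonotope_width_eq:
  fixes g :: "'i \<Rightarrow> 'a::euclidean_space" and h :: "'j \<Rightarrow> 'a"
  assumes "finite I" "finite J" "zonotope J h = (+) t ` zonotope I g"
  shows "(\<Sum>j\<in>J. \<bar>u \<bullet> h j\<bar>) = (\<Sum>i\<in>I. \<bar>u \<bullet> g i\<bar>)"
proof -
  have max_eq: "(\<Sum>j\<in>J. max 0 (v \<bullet> h j)) = v \<bullet> t + (\<Sum>i\<in>I. max 0 (v \<bullet> g i))" for v
  proof (rule antisym)
    obtain z where "z \<in> zonotope J h" "v \<bullet> z = (\<Sum>j\<in>J. max 0 (v \<bullet> h j))"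
      using inner_zonotope_attained(1) by blast
    then show "(\<Sum>j\<in>J. max 0 (v \<bullet> h j)) \<le> v \<bullet> t + (\<Sum>i\<in>I. max 0 (v \<bullet> g i))"
      using inner_zonotope_bounds(1)[OF assms(1), of _ g v] unfolding assms(3)
      by (force simp: inner_right_distrib)
    obtain z where z: "z \<in> zonotope I g" "v \<bullet> z = (\<Sum>i\<in>I. max 0 (v \<bullet> g i))"
      using inner_zonotope_attained(1) by blast
    then have "t + z \<in> zonotope J h" unfolding assms(3) by blast
    then show "v \<bullet> t + (\<Sum>i\<in>I. max 0 (v \<bullet> g i)) \<le> (\<Sum>j\<in>J. max 0 (v \<bullet> h j))"
      using inner_zonotope_bounds(1)[OF assms(2), of "t + z" h v] z by (simp add: inner_right_distrib)
  qed
  have abs_eq: "\<bar>x\<bar> = max 0 x + max 0 (- x)" for x :: real by simp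
  show ?thesis using max_eq[of u] max_eq[of "- u"] by (simp add: abs_eq sum.distrib)
qed

text \<open>Near a point on the hyperplane of \<open>k\<close> that avoids all other hyperplanes, every other summand is linear, so the
  second difference across this hyperplane isolates the coefficient of \<open>k\<close>.\<close>
lemma abs_inner_independent:
  fixes g :: "'i \<Rightarrow> 'a::euclidean_space" and c :: "'i \<Rightarrow> real"
  assumes "finite I" "\<And>i. i \<in> I \<Longrightarrow> g i \<noteq> 0"
    and np: "\<And>i j. i \<in> I \<Longrightarrow> j \<in> I \<Longrightarrow> i \<noteq> j \<Longrightarrow> \<not> collinear {0, g i, g j}"
    and zero: "\<And>u. (\<Sum>i\<in>I. c i * \<bar>u \<bullet> g i\<bar>) = 0"
    and k: "k \<in> I"
  shows "c k = 0"
proof -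
  define N where "N = (\<lambda>i. g i - (g i \<bullet> g k / (g k \<bullet> g k)) *\<^sub>R g k) ` (I - {k})"
  have "0 \<notin> N"
  proof
    assume "0 \<in> N"
    then obtain i where i: "i \<in> I - {k}" "0 = g i - (g i \<bullet> g k / (g k \<bullet> g k)) *\<^sub>R g k"
      unfolding N_def by blast
    from i(2) have "g i = (g i \<bullet> g k / (g k \<bullet> g k)) *\<^sub>R g k" by simp
    then have "collinear {0, g k, g i}" unfolding collinear_lemma by blast
    then show False using np[of k i] k i(1) by blast
  qed
  then obtain x where x: "\<And>z. z \<in> N \<Longrightarrow> x \<bullet> z \<noteq> 0"
    using open_avoids_hyperplanes[of N UNIV] assms(1) unfolding N_def by blast
  define u where "u = x - (x \<bullet> g k / (g k \<bullet> g k)) *\<^sub>R g k"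
  have gk: "g k \<bullet> g k > 0" using assms(2)[OF k] by simp
  have uk: "u \<bullet> g k = 0" using gk by (simp add: u_def inner_diff_left)
  have ui: "u \<bullet> g i \<noteq> 0" if i: "i \<in> I - {k}" for i
  proof -
    have "u \<bullet> g i = x \<bullet> (g i - (g i \<bullet> g k / (g k \<bullet> g k)) *\<^sub>R g k)"
      by (simp add: u_def inner_diff_left inner_diff_right inner_commute)
    then show ?thesis using x i unfolding N_def by auto
  qed
  \<comment> \<open>A step so short that no other hyperplane is crossed.\<close>
  define t where "t = Min (insert 1 ((\<lambda>i. \<bar>u \<bullet> g i\<bar> / (\<bar>g k \<bullet> g i\<bar> + 1)) ` (I - {k})))"
  have t0: "t > 0"
    unfolding t_def using assms(1) ui by (subst Min_gr_iff) (auto intro!: divide_pos_pos)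
  have tle: "t * \<bar>g k \<bullet> g i\<bar> \<le> \<bar>u \<bullet> g i\<bar>" if "i \<in> I - {k}" for i
  proof -
    have "t \<le> \<bar>u \<bullet> g i\<bar> / (\<bar>g k \<bullet> g i\<bar> + 1)"
      unfolding t_def using assms(1) that by (intro Min_le) auto
    then have "t * (\<bar>g k \<bullet> g i\<bar> + 1) \<le> \<bar>u \<bullet> g i\<bar>" by (simp add: pos_le_divide_eq)
    moreover have "t * \<bar>g k \<bullet> g i\<bar> \<le> t * (\<bar>g k \<bullet> g i\<bar> + 1)" using t0 by simp
    ultimately show ?thesis by linarith
  qed
  define e where "e i = \<bar>(u + t *\<^sub>R g k) \<bullet> g i\<bar> + \<bar>(u - t *\<^sub>R g k) \<bullet> g i\<bar> - 2 * \<bar>u \<bullet> g i\<bar>" for i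
  have e0: "e i = 0" if "i \<in> I - {k}" for i
  proof -
    have "\<bar>t * (g k \<bullet> g i)\<bar> \<le> \<bar>u \<bullet> g i\<bar>" using tle[OF that] t0 by (simp add: abs_mult)
    then have "\<bar>u \<bullet> g i + t * (g k \<bullet> g i)\<bar> + \<bar>u \<bullet> g i - t * (g k \<bullet> g i)\<bar> - 2 * \<bar>u \<bullet> g i\<bar> = 0"
      by linarith
    then show ?thesis unfolding e_def by (simp only: inner_add_left inner_diff_left inner_scaleR_left)
  qed
  have "(\<Sum>i\<in>I. c i * e i) = (\<Sum>i\<in>I. c i * \<bar>(u + t *\<^sub>R g k) \<bullet> g i\<bar>)
      + (\<Sum>i\<in>I. c i * \<bar>(u - t *\<^sub>R g k) \<bullet> g i\<bar>) - 2 * (\<Sum>i\<in>I. c i * \<bar>u \<bullet> g i\<bar>)"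
    unfolding e_def by (simp add: sum.distrib sum_subtractf sum_distrib_left algebra_simps)
  also have "\<dots> = 0" by (simp only: zero)
  finally have "c k * e k = 0" using k assms(1) e0 by (simp add: sum.remove[of I k])
  moreover have "e k = 2 * t * (g k \<bullet> g k)"
    unfolding e_def using uk t0 gk by (simp add: inner_add_left inner_diff_left)
  ultimately show ?thesis using t0 gk by simp
qed

lemma enclosing_box_eq:
  fixes P :: "(real ^ 'd) set"
  assumes "P \<noteq> {}" "\<And>x i. x \<in> P \<Longrightarrow> l $ i \<le> x $ i \<and> x $ i \<le> r $ i"
    and "\<And>i. \<exists>x\<in>P. x $ i = l $ i" "\<And>i. \<exists>x\<in>P. x $ i = r $ i"
  shows "enclosing_box P = cbox l r"
  unfolding enclosing_box_def
proof (rule hull_unique)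
  show "P \<subseteq> cbox l r" using assms(2) by (auto simp: mem_box_cart)
  show "\<exists>a b. cbox l r = cbox a b" by blast
  fix B assume B: "P \<subseteq> B" "\<exists>a b. B = cbox a b"
  then obtain a b where ab: "B = cbox a b" by blast
  have "a $ i \<le> l $ i \<and> r $ i \<le> b $ i" for i
  proof -
    obtain x y where "x \<in> P" "x $ i = l $ i" "y \<in> P" "y $ i = r $ i" using assms(3,4) by blast
    moreover from this have "x \<in> cbox a b" "y \<in> cbox a b" using B(1) unfolding ab by auto
    ultimately show ?thesis by (metis mem_box_cart(2))
  qed
  then show "cbox l r \<subseteq> B"
    unfolding ab by (auto simp: mem_box_cart) (meson order_trans)+
qed

lemma enclosing_box_translated_zonotope:
  fixes g :: "'i \<Rightarrow> real ^ 'd"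
  assumes "finite I"
  shows "enclosing_box ((+) t ` zonotope I g)
    = cbox (t + (\<chi> j. \<Sum>i\<in>I. min 0 (g i $ j))) (t + (\<chi> j. \<Sum>i\<in>I. max 0 (g i $ j)))"
proof (rule enclosing_box_eq)
  have ax: "axis j 1 \<bullet> x = x $ j" for x :: "real ^ 'd" and j by (simp add: inner_axis')
  show "(+) t ` zonotope I g \<noteq> {}" using inner_zonotope_attained(1)[of I g 0] by blast
  fix j
  show "\<exists>x\<in>(+) t ` zonotope I g. x $ j = (t + (\<chi> j. \<Sum>i\<in>I. min 0 (g i $ j))) $ j"
    using inner_zonotope_attained(2)[of I g "axis j 1"] by (auto simp: ax)
  show "\<exists>x\<in>(+) t ` zonotope I g. x $ j = (t + (\<chi> j. \<Sum>i\<in>I. max 0 (g i $ j))) $ j"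
    using inner_zonotope_attained(1)[of I g "axis j 1"] by (auto simp: ax)
  fix x assume "x \<in> (+) t ` zonotope I g"
  then show "(t + (\<chi> j. \<Sum>i\<in>I. min 0 (g i $ j))) $ j \<le> x $ j
      \<and> x $ j \<le> (t + (\<chi> j. \<Sum>i\<in>I. max 0 (g i $ j))) $ j"
    using inner_zonotope_bounds[OF assms, of _ g "axis j 1"] by (auto simp: ax)
qed

lemma inscribed_translated_zonotope_iff:
  fixes g :: "'i \<Rightarrow> real ^ 'd"
  assumes "finite I"
  shows "inscribed_in_cube n ((+) s ` zonotope I g) \<longleftrightarrow> (\<forall>j. (\<Sum>i\<in>I. \<bar>g i $ j\<bar>) = real n)"
proof -
  define l where "l = (\<chi> j. \<Sum>i\<in>I. min 0 (g i $ j))"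
  define r where "r = (\<chi> j. \<Sum>i\<in>I. max 0 (g i $ j))"
  have "(+) t ` (+) s ` zonotope I g = (+) (t + s) ` zonotope I g" for t
    by (auto simp: image_image add.assoc)
  then have "inscribed_in_cube n ((+) s ` zonotope I g)
      \<longleftrightarrow> (\<exists>t. cbox (t + s + l) (t + s + r) = cbox 0 (vec (real n)))"
    unfolding inscribed_in_cube_def l_def r_def
    by (simp add: enclosing_box_translated_zonotope[OF assms])
  also have "cbox (0::real^'d) (vec (real n)) \<noteq> {}" by (auto simp: interval_ne_empty_cart)
  then have "(\<exists>t. cbox (t + s + l) (t + s + r) = cbox 0 (vec (real n)))
      \<longleftrightarrow> (\<exists>t. t + s + l = 0 \<and> t + s + r = vec (real n))"
    unfolding eq_cbox by blast
  also have "\<dots> \<longleftrightarrow> r - l = vec (real n)"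
  proof
    assume "r - l = vec (real n)"
    then show "\<exists>t. t + s + l = 0 \<and> t + s + r = vec (real n)"
      by (intro exI[of _ "- s - l"]) auto
  next
    assume "\<exists>t. t + s + l = 0 \<and> t + s + r = vec (real n)"
    then obtain t where t: "t + s + l = 0" "t + s + r = vec (real n)" by blast
    have "r - l = (t + s + r) - (t + s + l)" by simp
    then show "r - l = vec (real n)" using t by simp
  qed
  also have "\<dots> \<longleftrightarrow> (\<forall>j. (\<Sum>i\<in>I. \<bar>g i $ j\<bar>) = real n)"
    by (simp add: vec_eq_iff l_def r_def max_minus_min_0 flip: sum_subtractf)
  finally show ?thesis .
qed


section \<open>Primitive integer vectors modulo sign\<close>

definition int_vec :: "('d::finite \<Rightarrow> int) \<Rightarrow> real ^ 'd" where
  "int_vec v = (\<chi> i. of_int (v i))"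

text \<open>One representative of each pair of opposite primitive vectors. The choice depends only on the set of the two
  vectors, so opposite vectors get the same representative.\<close>
definition primitives :: "('d \<Rightarrow> int) set" where
  "primitives = (\<lambda>v. SOME w. w = v \<or> w = (\<lambda>i. - v i)) ` {v. Gcd (range v) = 1}"

lemma Gcd_range_uminus: "Gcd (range (\<lambda>i. - v i)) = Gcd (range (v :: 'd \<Rightarrow> int))"
proof -
  have "Gcd (range (\<lambda>i. - v i)) = Gcd ((*) (-1) ` range v)" by (simp add: image_image)
  then show ?thesis by (simp only: Gcd_mult) simp
qed

lemma Gcd_range_mult: "Gcd (range (\<lambda>i. c * v i)) = \<bar>c\<bar> * Gcd (range (v :: 'd \<Rightarrow> int))"
proof -
  have "Gcd (range (\<lambda>i. c * v i)) = Gcd ((*) c ` range v)" by (simp add: image_image)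
  then show ?thesis by (simp only: Gcd_mult) (simp add: abs_mult)
qed

lemma primitives_choice:
  "(SOME w. w = v \<or> w = (\<lambda>i. - v i)) = v \<or> (SOME w. w = v \<or> w = (\<lambda>i. - v i)) = (\<lambda>i. - v i :: int)"
proof -
  let ?P = "\<lambda>w. w = v \<or> w = (\<lambda>i. - v i)"
  have "?P v" by blast
  then have "?P (Eps ?P)" by (rule someI[of "?P"])
  then show ?thesis .
qed

lemma primitives_Gcd: "v \<in> primitives \<Longrightarrow> Gcd (range v) = 1"
proof -
  assume "v \<in> primitives"
  then obtain y where y: "v = (SOME w. w = y \<or> w = (\<lambda>i. - y i))" "Gcd (range y) = 1"
    unfolding primitives_def by blast
  then have "v = y \<or> v = (\<lambda>i. - y i)" using primitives_choice[of y] by simp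
  then show ?thesis using y(2) Gcd_range_uminus[of y] by auto
qed

lemma primitives_cover:
  assumes "Gcd (range v) = 1"
  shows "v \<in> primitives \<or> (\<lambda>i. - v i) \<in> primitives"
proof -
  have "(SOME w. w = v \<or> w = (\<lambda>i. - v i)) \<in> primitives" using assms unfolding primitives_def by blast
  then show ?thesis using primitives_choice[of v] by auto
qed

lemma primitives_unique:
  assumes "v \<in> primitives" "(\<lambda>i. - v i) \<in> primitives"
  shows "v = (\<lambda>i. - v i)"
proof -
  have rep: "(SOME w. w = x \<or> w = (\<lambda>i. - x i)) = x" if x: "x \<in> primitives" for x :: "'a \<Rightarrow> int"
  proof -
    obtain y where y: "x = (SOME w. w = y \<or> w = (\<lambda>i. - y i))" using x unfolding primitives_def by blast
    then have "x = y \<or> x = (\<lambda>i. - y i)" using primitives_choice[of y] by simp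
    then have "(\<lambda>w. w = x \<or> w = (\<lambda>i. - x i)) = (\<lambda>w. w = y \<or> w = (\<lambda>i. - y i))" by auto
    then show ?thesis using y by simp
  qed
  have "(\<lambda>w. w = v \<or> w = (\<lambda>i. - v i)) = (\<lambda>w. w = (\<lambda>i. - v i) \<or> w = (\<lambda>i. - (- v i)))" by auto
  then show ?thesis using rep[OF assms(1)] rep[OF assms(2)] by simp
qed

lemma primitive_nonzero: "v \<in> primitives \<Longrightarrow> v \<noteq> (\<lambda>_. 0)"
  using primitives_Gcd[of v] by (auto simp: image_constant_conv)

text \<open>The multiple is the greatest common divisor of the entries, with the sign fixed by the representative.\<close>
lemma primitive_decomposition:
  "bij_betw (\<lambda>(c, p) i. c * p i) ((UNIV - {0}) \<times> primitives) (UNIV - {\<lambda>_ :: 'd. 0 :: int})"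
  unfolding bij_betw_def
proof (intro conjI inj_onI equalityI subsetI)
  fix x y :: "int \<times> ('d \<Rightarrow> int)"
  assume x: "x \<in> (UNIV - {0}) \<times> primitives" and y: "y \<in> (UNIV - {0}) \<times> primitives"
    and xy: "(\<lambda>(c, p) i. c * p i) x = (\<lambda>(c, p) i. c * p i) y"
  obtain c p where cp: "x = (c, p)" by (cases x)
  obtain c' p' where cp': "y = (c', p')" by (cases y)
  have eq: "c * p i = c' * p' i" for i using xy unfolding cp cp' by (auto dest: fun_cong)
  have "\<bar>c\<bar> = Gcd (range (\<lambda>i. c * p i))" "\<bar>c'\<bar> = Gcd (range (\<lambda>i. c' * p' i))"
    using x y unfolding cp cp' by (auto simp: Gcd_range_mult primitives_Gcd)
  then have c: "\<bar>c\<bar> = \<bar>c'\<bar>" by (simp add: eq)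
  have c0: "c \<noteq> 0" "c' \<noteq> 0" using x y by (auto simp: cp cp')
  consider "c = c'" | "c = - c'" using c by linarith
  then show "x = y"
  proof cases
    case 1
    then have "p = p'" using eq c0 by auto
    then show ?thesis using 1 cp cp' by simp
  next
    case 2
    have "p i = - p' i" for i
    proof -
      have "c' * (p i + p' i) = 0" using eq[of i] 2 by (simp add: algebra_simps)
      then show ?thesis using c0 by simp
    qed
    then have p: "p = (\<lambda>i. - p' i)" by blast
    then have "p' = (\<lambda>i. - p' i)" using x y by (intro primitives_unique) (auto simp: cp cp')
    then have "p' = (\<lambda>_. 0)" by (auto simp: fun_eq_iff)
    then show ?thesis using primitive_nonzero[of p'] y by (auto simp: cp')
  qed
next
  fix v :: "'d \<Rightarrow> int"
  assume "v \<in> (\<lambda>(c, p) i. c * p i) ` ((UNIV - {0}) \<times> primitives)"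
  then obtain c p where cp: "c \<noteq> 0" "p \<in> primitives" "v = (\<lambda>i. c * p i)" by auto
  obtain i where "p i \<noteq> 0" using primitive_nonzero[OF cp(2)] by (auto simp: fun_eq_iff)
  then have "v i \<noteq> 0" using cp by simp
  then show "v \<in> UNIV - {\<lambda>_. 0}" by auto
next
  fix v :: "'d \<Rightarrow> int" assume "v \<in> UNIV - {\<lambda>_. 0}"
  then obtain i0 where i0: "v i0 \<noteq> 0" by (auto simp: fun_eq_iff)
  define g where "g = Gcd (range v)"
  have g0: "g \<noteq> 0" using i0 unfolding g_def by (auto simp: Gcd_0_iff)
  have gpos: "g > 0" using g0 unfolding g_def by (simp add: less_le)
  have dvd: "g dvd v i" for i unfolding g_def by (intro Gcd_dvd) auto
  define u where "u i = v i div g" for i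
  have v: "v = (\<lambda>i. g * u i)" using dvd by (auto simp: u_def)
  have "Gcd (range (\<lambda>i. g * u i)) = g" by (simp only: v[symmetric] g_def[symmetric])
  then have "g = g * Gcd (range u)" using Gcd_range_mult[of g u] gpos by simp
  then have "Gcd (range u) = 1" using g0 by simp
  then consider "u \<in> primitives" | "(\<lambda>i. - u i) \<in> primitives" using primitives_cover by blast
  then show "v \<in> (\<lambda>(c, p) i. c * p i) ` ((UNIV - {0}) \<times> primitives)"
  proof cases
    case 1
    then show ?thesis using v g0 by (intro image_eqI[of _ _ "(g, u)"]) auto
  next
    case 2
    then show ?thesis using v g0 by (intro image_eqI[of _ _ "(- g, \<lambda>i. - u i)"]) auto
  qed
qed

lemma int_vec_nonzero: "p \<in> primitives \<Longrightarrow> int_vec p \<noteq> 0"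
  using primitive_nonzero by (auto simp: int_vec_def vec_eq_iff fun_eq_iff)

text \<open>Two parallel integer vectors have a common nonzero integer multiple, which determines its representative.\<close>
lemma primitives_not_collinear:
  assumes p: "p \<in> primitives" and q: "q \<in> primitives" and "p \<noteq> q" "a \<noteq> 0" "b \<noteq> 0"
  shows "\<not> collinear {0, a *\<^sub>R int_vec p, b *\<^sub>R int_vec q}"
proof
  assume "collinear {0, a *\<^sub>R int_vec p, b *\<^sub>R int_vec q}"
  then obtain c where "b *\<^sub>R int_vec q = c *\<^sub>R a *\<^sub>R int_vec p"
    using assms int_vec_nonzero[OF p] int_vec_nonzero[OF q] unfolding collinear_lemma by auto
  then have "b * of_int (q i) = c * a * of_int (p i)" for i
    by (simp add: int_vec_def vec_eq_iff)
  then have qp: "of_int (q i) = c * a / b * of_int (p i)" for i using \<open>b \<noteq> 0\<close> by (simp add: field_simps)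
  obtain j where j: "p j \<noteq> 0" using primitive_nonzero[OF p] by (auto simp: fun_eq_iff)
  have "real_of_int (p j * q i) = real_of_int (q j * p i)" for i
    unfolding of_int_mult qp[of i] qp[of j] by simp
  then have eq: "p j * q i = q j * p i" for i by (metis of_int_eq_iff)
  have qj: "q j \<noteq> 0"
  proof
    assume "q j = 0"
    then have "q = (\<lambda>_. 0)" using eq j by (auto simp: fun_eq_iff)
    then show False using primitive_nonzero[OF q] by simp
  qed
  have "(p j, q) = (q j, p)"
    by (rule inj_onD[OF bij_betw_imp_inj_on[OF primitive_decomposition]])
      (use j qj eq p q in auto)
  then show False using \<open>p \<noteq> q\<close> by simp
qed

section \<open>Lattice zonotopes as configurations\<close>

text \<open>The configurations parametrise the lattice zonotopes up to translation: \<open>\<omega> p\<close> is the lattice length of the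
  generator in direction \<open>p\<close>.\<close>
type_synonym 'd config = "('d \<Rightarrow> int) \<Rightarrow> nat"

definition support :: "('a \<Rightarrow> nat) \<Rightarrow> 'a set" where
  "support \<omega> = {p. \<omega> p \<noteq> 0}"

definition configs :: "'d config set" where
  "configs = {\<omega>. finite (support \<omega>) \<and> support \<omega> \<subseteq> primitives}"

text \<open>The side length of the enclosing box in the direction of coordinate \<open>i\<close>.\<close>
definition load :: "'d config \<Rightarrow> 'd \<Rightarrow> nat" where
  "load \<omega> i = (\<Sum>p\<in>support \<omega>. \<omega> p * nat \<bar>p i\<bar>)"

definition cube_configs :: "nat \<Rightarrow> 'd config set" where
  "cube_configs n = {\<omega>\<in>configs. \<forall>i. load \<omega> i = n}"

abbreviation generators :: "'d::finite config \<Rightarrow> ('d \<Rightarrow> int) \<Rightarrow> real ^ 'd" where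
  "generators \<omega> \<equiv> \<lambda>p. real (\<omega> p) *\<^sub>R int_vec p"

definition zonotope_of :: "'d::finite config \<Rightarrow> (real ^ 'd) set" where
  "zonotope_of \<omega> = zonotope (support \<omega>) (generators \<omega>)"

lemma load_superset:
  assumes "finite S" "support \<omega> \<subseteq> S"
  shows "load \<omega> i = (\<Sum>p\<in>S. \<omega> p * nat \<bar>p i\<bar>)"
  unfolding load_def using assms by (intro sum.mono_neutral_left) (auto simp: support_def)

lemma diameter_zonotope_of:
  assumes "\<omega> \<in> configs"
  shows "polytope_diameter (zonotope_of \<omega>) = card (support \<omega>)"
proof -
  interpret independent_generators "support \<omega>" "generators \<omega>"
  proof
    show "finite (support \<omega>)" using assms by (simp add: configs_def)
    show "real (\<omega> p) *\<^sub>R int_vec p \<noteq> 0" if "p \<in> support \<omega>" for p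
      using that assms int_vec_nonzero[of p] by (auto simp: configs_def support_def)
    show "\<not> collinear {0, real (\<omega> p) *\<^sub>R int_vec p, real (\<omega> q) *\<^sub>R int_vec q}"
      if "p \<in> support \<omega>" "q \<in> support \<omega>" "p \<noteq> q" for p q
      using that assms by (intro primitives_not_collinear) (auto simp: configs_def support_def)
  qed
  show ?thesis unfolding zonotope_of_def by (rule diameter_eq_card)
qed

lemma sum_superset_support:
  fixes f :: "'a \<Rightarrow> real"
  assumes "finite S" "support \<omega> \<subseteq> S"
  shows "(\<Sum>p\<in>support \<omega>. real (\<omega> p) * f p) = (\<Sum>p\<in>S. real (\<omega> p) * f p)"
  using assms by (intro sum.mono_neutral_left) (auto simp: support_def)

text \<open>The two configurations give the same width function.\<close>
lemma zonotope_of_inj: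
  assumes \<omega>: "\<omega> \<in> configs" and \<omega>': "\<omega>' \<in> configs" and "zonotope_of \<omega>' = (+) t ` zonotope_of \<omega>"
  shows "\<omega>' = \<omega>"
proof -
  define S where "S = support \<omega> \<union> support \<omega>'"
  have S: "finite S" "support \<omega> \<subseteq> S" "support \<omega>' \<subseteq> S" "S \<subseteq> primitives"
    using \<omega> \<omega>' by (auto simp: S_def configs_def)
  have fin: "finite (support \<omega>)" "finite (support \<omega>')" using \<omega> \<omega>' by (auto simp: configs_def)
  have *: "(\<Sum>p\<in>S. (real (\<omega>' p) - real (\<omega> p)) * \<bar>u \<bullet> int_vec p\<bar>) = 0" for u :: "real ^ 'a"
  proof -
    have "(\<Sum>p\<in>support \<omega>'. real (\<omega>' p) * \<bar>u \<bullet> int_vec p\<bar>) = (\<Sum>p\<in>support \<omega>. real (\<omega> p) * \<bar>u \<bullet> int_vec p\<bar>)"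
      using zonotope_width_eq[OF fin assms(3)[unfolded zonotope_of_def], of u] by (simp add: abs_mult)
    then show ?thesis
      using sum_superset_support[OF S(1,2), of "\<lambda>p. \<bar>u \<bullet> int_vec p\<bar>"]
        sum_superset_support[OF S(1,3), of "\<lambda>p. \<bar>u \<bullet> int_vec p\<bar>"]
      by (simp add: left_diff_distrib sum_subtractf)
  qed
  have nc: "\<not> collinear {0, int_vec p, int_vec q}" if "p \<in> S" "q \<in> S" "p \<noteq> q" for p q :: "'a \<Rightarrow> int"
    using primitives_not_collinear[of p q 1 1] that S(4) by auto
  have "real (\<omega>' p) - real (\<omega> p) = 0" if "p \<in> S" for p
    by (rule abs_inner_independent[OF S(1) _ nc * that]) (use S(4) int_vec_nonzero in auto)
  moreover have "\<omega>' p = \<omega> p" if "p \<notin> S" for p using that by (auto simp: S_def support_def)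
  ultimately have "\<omega>' p = \<omega> p" for p by (cases "p \<in> S") auto
  then show ?thesis by blast
qed

lemma inscribed_zonotope_of_iff:
  assumes "\<omega> \<in> configs"
  shows "inscribed_in_cube n ((+) s ` zonotope_of \<omega>) \<longleftrightarrow> (\<forall>i. load \<omega> i = n)"
proof -
  have "(\<Sum>p\<in>support \<omega>. \<bar>(real (\<omega> p) *\<^sub>R int_vec p) $ i\<bar>) = real (load \<omega> i)" for i
    unfolding load_def by (simp add: int_vec_def abs_mult)
  then show ?thesis
    using assms inscribed_translated_zonotope_iff[of "support \<omega>" n s "generators \<omega>"]
    by (simp add: zonotope_of_def configs_def)
qed

lemma lattice_zonotope_of:
  assumes "\<omega> \<in> configs"
  shows "lattice_zonotope (zonotope_of \<omega>)"
proof -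
  define k where "k = card (support \<omega>)"
  have "finite (support \<omega>)" using assms by (simp add: configs_def)
  then obtain h where h: "bij_betw h {..<k} (support \<omega>)"
    unfolding k_def by (metis ex_bij_betw_nat_finite atLeast0LessThan)
  define v where "v i = real (\<omega> (h i)) *\<^sub>R int_vec (h i)" for i
  have "zonotope_of \<omega> = zonotope {..<k} v"
  proof (intro equalityI subsetI)
    fix z assume "z \<in> zonotope_of \<omega>"
    then obtain \<alpha> where \<alpha>: "\<forall>p\<in>support \<omega>. \<alpha> p \<in> {0..1}"
        "z = (\<Sum>p\<in>support \<omega>. \<alpha> p *\<^sub>R real (\<omega> p) *\<^sub>R int_vec p)"
      unfolding zonotope_of_def by (rule zonotopeE)
    have "z = (\<Sum>i<k. (\<alpha> \<circ> h) i *\<^sub>R v i)"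
      unfolding \<alpha>(2) v_def using sum.reindex_bij_betw[OF h, of "\<lambda>p. \<alpha> p *\<^sub>R real (\<omega> p) *\<^sub>R int_vec p"]
      by (simp add: comp_def)
    moreover have "\<forall>i\<in>{..<k}. (\<alpha> \<circ> h) i \<in> {0..1}" using \<alpha>(1) bij_betwE[OF h] by auto
    ultimately show "z \<in> zonotope {..<k} v" using zonotopeI by blast
  next
    fix z assume "z \<in> zonotope {..<k} v"
    then obtain \<alpha> where \<alpha>: "\<forall>i\<in>{..<k}. \<alpha> i \<in> {0..1}" "z = (\<Sum>i<k. \<alpha> i *\<^sub>R v i)"
      by (rule zonotopeE)
    define h' where "h' = the_inv_into {..<k} h"
    have h': "h' (h i) = i" if "i < k" for i
      using h that unfolding h'_def bij_betw_def by (simp add: the_inv_into_f_f)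
    have "z = (\<Sum>p\<in>support \<omega>. \<alpha> (h' p) *\<^sub>R real (\<omega> p) *\<^sub>R int_vec p)"
      unfolding \<alpha>(2) v_def using h' by (simp flip: sum.reindex_bij_betw[OF h])
    moreover have "\<forall>p\<in>support \<omega>. \<alpha> (h' p) \<in> {0..1}"
    proof
      fix p assume "p \<in> support \<omega>"
      then obtain i where "i < k" "p = h i" using h unfolding bij_betw_def by auto
      then show "\<alpha> (h' p) \<in> {0..1}" using \<alpha>(1) h' by auto
    qed
    ultimately show "z \<in> zonotope_of \<omega>" unfolding zonotope_of_def
      using zonotopeI[of "support \<omega>" "\<lambda>p. \<alpha> (h' p)" "generators \<omega>"] by simp
  qed
  moreover have "\<forall>i<k. \<forall>j. v i $ j \<in> \<int>" by (simp add: v_def int_vec_def)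
  moreover have "zonotope {..<k} v = (+) 0 ` {\<Sum>i<k. \<alpha> i *\<^sub>R v i | \<alpha> :: nat \<Rightarrow> real. \<forall>i<k. \<alpha> i \<in> {0..1}}"
    unfolding zonotope_def by auto
  ultimately have "(\<forall>i<k. \<forall>j. v i $ j \<in> \<int>) \<and> zonotope_of \<omega>
      = (+) 0 ` {\<Sum>i<k. \<alpha> i *\<^sub>R v i | \<alpha> :: nat \<Rightarrow> real. \<forall>i<k. \<alpha> i \<in> {0..1}}" by simp
  then show ?thesis unfolding lattice_zonotope_def by blast
qed

text \<open>Generators of multiplicity zero do not change the zonotope, which allows two configurations to be compared over
  a common index set.\<close>
lemma zonotope_of_superset:
  assumes "finite S" "support \<omega> \<subseteq> S"
  shows "zonotope_of \<omega> = zonotope S (generators \<omega>)"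
proof -
  have *: "(\<Sum>p\<in>support \<omega>. \<alpha> p *\<^sub>R real (\<omega> p) *\<^sub>R int_vec p) = (\<Sum>p\<in>S. \<alpha> p *\<^sub>R real (\<omega> p) *\<^sub>R int_vec p)" for \<alpha>
    using assms by (intro sum.mono_neutral_left) (auto simp: support_def)
  show ?thesis
  proof (intro equalityI subsetI)
    fix z assume "z \<in> zonotope_of \<omega>"
    then obtain \<alpha> where \<alpha>: "\<forall>p\<in>support \<omega>. \<alpha> p \<in> {0..1}"
        "z = (\<Sum>p\<in>support \<omega>. \<alpha> p *\<^sub>R real (\<omega> p) *\<^sub>R int_vec p)"
      unfolding zonotope_of_def by (rule zonotopeE)
    define \<beta> where "\<beta> p = (if p \<in> support \<omega> then \<alpha> p else 0)" for p
    have "z = (\<Sum>p\<in>S. \<beta> p *\<^sub>R real (\<omega> p) *\<^sub>R int_vec p)"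
      unfolding \<alpha>(2) *[symmetric] \<beta>_def by simp
    then show "z \<in> zonotope S (generators \<omega>)"
      using \<alpha>(1) zonotopeI[of S \<beta> "generators \<omega>"] by (simp add: \<beta>_def)
  next
    fix z assume "z \<in> zonotope S (generators \<omega>)"
    then obtain \<alpha> where \<alpha>: "\<forall>p\<in>S. \<alpha> p \<in> {0..1}" "z = (\<Sum>p\<in>S. \<alpha> p *\<^sub>R real (\<omega> p) *\<^sub>R int_vec p)"
      by (rule zonotopeE)
    then show "z \<in> zonotope_of \<omega>"
      unfolding zonotope_of_def *[symmetric] using assms(2)
        zonotopeI[of "support \<omega>" \<alpha> "generators \<omega>"] by auto
  qed
qed

lemma interval_sum_scaled:
  assumes "a \<ge> 0" "b \<ge> 0"
  shows "{\<alpha> * (a + b) | \<alpha> :: real. \<alpha> \<in> {0..1}} = {\<alpha> * a + \<beta> * b | \<alpha> \<beta>. \<alpha> \<in> {0..1} \<and> \<beta> \<in> {0..1}}"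
proof (intro equalityI subsetI)
  fix x assume "x \<in> {\<alpha> * (a + b) | \<alpha> :: real. \<alpha> \<in> {0..1}}"
  then obtain \<alpha> where "\<alpha> \<in> {0..1}" "x = \<alpha> * a + \<alpha> * b" by (auto simp: distrib_left)
  then show "x \<in> {\<alpha> * a + \<beta> * b | \<alpha> \<beta>. \<alpha> \<in> {0..1} \<and> \<beta> \<in> {0..1}}" by blast
next
  fix x assume "x \<in> {\<alpha> * a + \<beta> * b | \<alpha> \<beta>. \<alpha> \<in> {0..1} \<and> \<beta> \<in> {0..1}}"
  then obtain \<alpha> \<beta> where ab: "0 \<le> \<alpha>" "\<alpha> \<le> 1" "0 \<le> \<beta>" "\<beta> \<le> 1" "x = \<alpha> * a + \<beta> * b" by auto
  have "0 \<le> x" "x \<le> a + b"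
    using ab assms mult_left_le_one_le[of a \<alpha>] mult_left_le_one_le[of b \<beta>] by auto
  show "x \<in> {\<alpha> * (a + b) | \<alpha> :: real. \<alpha> \<in> {0..1}}"
  proof (cases "a + b = 0")
    case True
    then show ?thesis using \<open>0 \<le> x\<close> \<open>x \<le> a + b\<close> by (auto intro!: exI[of _ 0])
  next
    case False
    then show ?thesis using \<open>0 \<le> x\<close> \<open>x \<le> a + b\<close> assms
      by (intro CollectI exI[of _ "x / (a + b)"]) auto
  qed
qed

lemma zonotope_of_add:
  assumes \<omega>: "\<omega> \<in> configs" and q: "q \<in> primitives"
  shows "fun_upd \<omega> q (\<omega> q + m) \<in> configs"
    "zonotope_of (fun_upd \<omega> q (\<omega> q + m)) = {x + \<beta> *\<^sub>R real m *\<^sub>R int_vec q | x \<beta>. x \<in> zonotope_of \<omega> \<and> \<beta> \<in> {0..1}}"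
proof -
  let ?\<omega>' = "fun_upd \<omega> q (\<omega> q + m)"
  have sub: "support ?\<omega>' \<subseteq> insert q (support \<omega>)" by (auto simp: support_def)
  have fin: "finite (support \<omega>)" using \<omega> by (simp add: configs_def)
  then have "finite (support ?\<omega>')" using sub finite_subset by blast
  then show "?\<omega>' \<in> configs" using sub \<omega> q by (auto simp: configs_def)
  define S where "S = support \<omega> - {q}"
  have S: "finite S" "q \<notin> S" using fin by (auto simp: S_def)
  have "support ?\<omega>' \<subseteq> insert q S" "support \<omega> \<subseteq> insert q S" using sub by (auto simp: S_def)
  then have eqs: "zonotope_of ?\<omega>' = zonotope (insert q S) (generators ?\<omega>')"
     "zonotope_of \<omega> = zonotope (insert q S) (generators \<omega>)"
    using S by (intro zonotope_of_superset; simp)+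
  have base: "zonotope S (generators ?\<omega>') = zonotope S (generators \<omega>)" (is "_ = ?Z")
  proof -
    have "(\<Sum>p\<in>S. \<alpha> p *\<^sub>R real (?\<omega>' p) *\<^sub>R int_vec p) = (\<Sum>p\<in>S. \<alpha> p *\<^sub>R real (\<omega> p) *\<^sub>R int_vec p)" for \<alpha>
      using S by (intro sum.cong) auto
    then show ?thesis unfolding zonotope_def by simp
  qed
  have "zonotope_of ?\<omega>' = {x + y *\<^sub>R int_vec q | x y. x \<in> ?Z \<and>
      y \<in> {\<alpha> * (real (\<omega> q) + real m) | \<alpha> :: real. \<alpha> \<in> {0..1}}}"
    unfolding eqs zonotope_insert[OF S] base by fastforce
  also have "\<dots> = {x + y *\<^sub>R int_vec q | x y. x \<in> ?Z \<and>
      y \<in> {\<alpha> * real (\<omega> q) + \<beta> * real m | \<alpha> \<beta> :: real. \<alpha> \<in> {0..1} \<and> \<beta> \<in> {0..1}}}"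
    by (subst interval_sum_scaled) simp_all
  also have "\<dots> = {x + \<beta> *\<^sub>R real m *\<^sub>R int_vec q | x \<beta>. x \<in> zonotope_of \<omega> \<and> \<beta> \<in> {0..1}}"
  proof (intro equalityI subsetI)
    fix z assume "z \<in> {x + y *\<^sub>R int_vec q | x y. x \<in> ?Z \<and>
      y \<in> {\<alpha> * real (\<omega> q) + \<beta> * real m | \<alpha> \<beta> :: real. \<alpha> \<in> {0..1} \<and> \<beta> \<in> {0..1}}}"
    then obtain x \<alpha> \<beta> where x: "x \<in> ?Z" "\<alpha> \<in> {0..1}" "\<beta> \<in> {0..1}"
      "z = x + (\<alpha> * real (\<omega> q) + \<beta> * real m) *\<^sub>R int_vec q" by blast
    then have "x + \<alpha> *\<^sub>R real (\<omega> q) *\<^sub>R int_vec q \<in> zonotope_of \<omega>"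
      unfolding eqs zonotope_insert[OF S] by blast
    moreover have "z = (x + \<alpha> *\<^sub>R real (\<omega> q) *\<^sub>R int_vec q) + \<beta> *\<^sub>R real m *\<^sub>R int_vec q"
      using x(4) by (simp add: scaleR_add_left add.assoc)
    ultimately show "z \<in> {x + \<beta> *\<^sub>R real m *\<^sub>R int_vec q | x \<beta>. x \<in> zonotope_of \<omega> \<and> \<beta> \<in> {0..1}}"
      using x(3) by blast
  next
    fix z assume "z \<in> {x + \<beta> *\<^sub>R real m *\<^sub>R int_vec q | x \<beta>. x \<in> zonotope_of \<omega> \<and> \<beta> \<in> {0..1}}"
    then obtain x \<beta> where x: "x \<in> zonotope_of \<omega>" "\<beta> \<in> {0..1}" "z = x + \<beta> *\<^sub>R real m *\<^sub>R int_vec q" by blast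
    obtain y \<alpha> where y: "y \<in> ?Z" "\<alpha> \<in> {0..1}" "x = y + \<alpha> *\<^sub>R real (\<omega> q) *\<^sub>R int_vec q"
      using x(1) unfolding eqs zonotope_insert[OF S] by blast
    have "z = y + (\<alpha> * real (\<omega> q) + \<beta> * real m) *\<^sub>R int_vec q"
      using x y by (simp add: scaleR_add_left add.assoc)
    then show "z \<in> {x + y *\<^sub>R int_vec q | x y. x \<in> ?Z \<and>
      y \<in> {\<alpha> * real (\<omega> q) + \<beta> * real m | \<alpha> \<beta> :: real. \<alpha> \<in> {0..1} \<and> \<beta> \<in> {0..1}}}"
      using x(2) y by blast
  qed
  finally show "zonotope_of ?\<omega>' = {x + \<beta> *\<^sub>R real m *\<^sub>R int_vec q | x \<beta>. x \<in> zonotope_of \<omega> \<and> \<beta> \<in> {0..1}}" .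
qed

text \<open>Generators are added one by one. A generator \<open>c p\<close> with \<open>c > 0\<close> lengthens the segment in direction \<open>p\<close>; if \<open>c < 0\<close>,
  then \<open>[0, c p]\<close> is the translate of \<open>[0, - c p]\<close> by \<open>c p\<close>.\<close>
lemma integer_zonotope_normal_form:
  fixes v :: "nat \<Rightarrow> real ^ 'd"
  assumes "\<forall>i<k. \<forall>j. v i $ j \<in> \<int>"
  shows "\<exists>\<omega> t. \<omega> \<in> configs \<and> zonotope {..<k} v = (+) t ` zonotope_of \<omega>"
  using assms
proof (induction k)
  case 0
  have "zonotope_of (\<lambda>_. 0) = {0 :: real ^ 'd}" by (simp add: zonotope_of_def support_def)
  then show ?case by (intro exI[of _ "\<lambda>_. 0"] exI[of _ 0]) (simp add: configs_def support_def)
next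
  case (Suc k)
  then obtain \<omega> t where \<omega>: "\<omega> \<in> configs" "zonotope {..<k} v = (+) t ` zonotope_of \<omega>" by auto
  have Z: "zonotope {..<Suc k} v = {t + x + \<alpha> *\<^sub>R v k | x \<alpha>. x \<in> zonotope_of \<omega> \<and> \<alpha> \<in> {0..1}}"
    using zonotope_insert[of "{..<k}" k v] unfolding lessThan_Suc \<omega>(2) by auto
  define w where "w j = \<lfloor>v k $ j\<rfloor>" for j
  have w: "v k = int_vec w"
    using Suc.prems unfolding int_vec_def w_def by (auto simp: vec_eq_iff floor_of_int elim!: Ints_cases)
  show ?case
  proof (cases "w = (\<lambda>_. 0)")
    case True
    then have "v k = 0" unfolding w by (simp add: int_vec_def vec_eq_iff)
    then have "zonotope {..<Suc k} v = (+) t ` zonotope_of \<omega>" unfolding Z by (auto simp: image_iff intro!: exI[of _ "0::real"])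
    then show ?thesis using \<omega>(1) by blast
  next
    case False
    then have "w \<in> (\<lambda>(c, p) i. c * p i) ` ((UNIV - {0}) \<times> primitives)"
      using bij_betw_imp_surj_on[OF primitive_decomposition] by blast
    then obtain c q where cq: "c \<noteq> 0" "q \<in> primitives" "w = (\<lambda>i. c * q i)" by auto
    have vk: "v k = of_int c *\<^sub>R int_vec q" unfolding w cq(3) by (simp add: int_vec_def vec_eq_iff)
    define m where "m = nat \<bar>c\<bar>"
    note add = zonotope_of_add[OF \<omega>(1) cq(2), of m]
    show ?thesis
    proof (cases "c > 0")
      case True
      then have "v k = real m *\<^sub>R int_vec q" by (simp add: vk m_def)
      then have "zonotope {..<Suc k} v = {t + (x + \<alpha> *\<^sub>R real m *\<^sub>R int_vec q) | x \<alpha>. x \<in> zonotope_of \<omega> \<and> \<alpha> \<in> {0..1}}"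
        unfolding Z by (simp only: add.assoc)
      also have "\<dots> = (+) t ` zonotope_of (fun_upd \<omega> q (\<omega> q + m))"
        unfolding add(2) by blast
      finally have "zonotope {..<Suc k} v = (+) t ` zonotope_of (fun_upd \<omega> q (\<omega> q + m))" .
      then show ?thesis using add(1) by blast
    next
      case False
      then have vk': "v k = - (real m *\<^sub>R int_vec q)" using cq(1) by (simp add: vk m_def)
      have "zonotope {..<Suc k} v = (+) (t + v k) ` zonotope_of (fun_upd \<omega> q (\<omega> q + m))"
      proof (intro equalityI subsetI)
        fix z assume "z \<in> zonotope {..<Suc k} v"
        then obtain x \<alpha> where x: "x \<in> zonotope_of \<omega>" "\<alpha> \<in> {0..1}" "z = t + x + \<alpha> *\<^sub>R v k" unfolding Z by blast
        have "z = t + v k + (x + (1 - \<alpha>) *\<^sub>R real m *\<^sub>R int_vec q)"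
          unfolding x(3) vk' by (simp add: algebra_simps)
        moreover have "1 - \<alpha> \<in> {0..1}" using x(2) by auto
        ultimately show "z \<in> (+) (t + v k) ` zonotope_of (fun_upd \<omega> q (\<omega> q + m))"
          unfolding add(2) using x(1) by blast
      next
        fix z assume "z \<in> (+) (t + v k) ` zonotope_of (fun_upd \<omega> q (\<omega> q + m))"
        then obtain x \<alpha> where x: "x \<in> zonotope_of \<omega>" "\<alpha> \<in> {0..1}"
          "z = t + v k + (x + \<alpha> *\<^sub>R real m *\<^sub>R int_vec q)" unfolding add(2) by blast
        have "z = t + x + (1 - \<alpha>) *\<^sub>R v k"
          unfolding x(3) vk' by (simp add: algebra_simps)
        moreover have "1 - \<alpha> \<in> {0..1}" using x(2) by auto
        ultimately show "z \<in> zonotope {..<Suc k} v" unfolding Z using x(1) by blast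
      qed
      then show ?thesis using add(1) by blast
    qed
  qed
qed

lemma lattice_zonotope_iff:
  "lattice_zonotope P \<longleftrightarrow> (\<exists>\<omega> t. \<omega> \<in> configs \<and> P = (+) t ` zonotope_of \<omega>)"
proof
  assume "lattice_zonotope P"
  then obtain k v s where v: "\<forall>i<k. \<forall>j. v i $ j \<in> \<int>"
    "P = (+) s ` {\<Sum>i<k. \<alpha> i *\<^sub>R v i | \<alpha> :: nat \<Rightarrow> real. \<forall>i<k. \<alpha> i \<in> {0..1}}"
    unfolding lattice_zonotope_def by blast
  obtain \<omega> t where \<omega>: "\<omega> \<in> configs" "zonotope {..<k} v = (+) t ` zonotope_of \<omega>"
    using integer_zonotope_normal_form[OF v(1)] by blast
  have "P = (+) s ` zonotope {..<k} v" unfolding v(2) zonotope_def by auto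
  also have "\<dots> = (+) (s + t) ` zonotope_of \<omega>" unfolding \<omega>(2) by (simp add: image_image add.assoc)
  finally show "\<exists>\<omega> t. \<omega> \<in> configs \<and> P = (+) t ` zonotope_of \<omega>" using \<omega>(1) by blast
next
  assume "\<exists>\<omega> t. \<omega> \<in> configs \<and> P = (+) t ` zonotope_of \<omega>"
  then obtain \<omega> t where \<omega>: "\<omega> \<in> configs" "P = (+) t ` zonotope_of \<omega>" by blast
  obtain k v s where v: "\<forall>i<k. \<forall>j. v i $ j \<in> \<int>"
    "zonotope_of \<omega> = (+) s ` {\<Sum>i<k. \<alpha> i *\<^sub>R v i | \<alpha> :: nat \<Rightarrow> real. \<forall>i<k. \<alpha> i \<in> {0..1}}"
    using lattice_zonotope_of[OF \<omega>(1)] unfolding lattice_zonotope_def by blast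
  have "P = (+) (t + s) ` {\<Sum>i<k. \<alpha> i *\<^sub>R v i | \<alpha> :: nat \<Rightarrow> real. \<forall>i<k. \<alpha> i \<in> {0..1}}"
    unfolding \<omega>(2) v(2) by (simp add: image_image add.assoc)
  then show "lattice_zonotope P" unfolding lattice_zonotope_def using v(1) by blast
qed

lemma inscribed_zonotopes_bij:
  "bij_betw (\<lambda>\<omega>. translation_equiv `` {zonotope_of \<omega>}) (cube_configs n)
     (inscribed_zonotopes n :: (real ^ 'd::finite) set set set)"
  unfolding bij_betw_def
proof
  note eqv = equiv_translation_equiv
  show "inj_on (\<lambda>\<omega>. translation_equiv `` {zonotope_of \<omega>}) (cube_configs n :: 'd config set)"
  proof (rule inj_onI)
    fix \<omega> \<omega>' :: "'d config"
    assume o: "\<omega> \<in> cube_configs n" "\<omega>' \<in> cube_configs n"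
      and e: "translation_equiv `` {zonotope_of \<omega>} = translation_equiv `` {zonotope_of \<omega>'}"
    have "(zonotope_of \<omega>, zonotope_of \<omega>') \<in> translation_equiv"
      by (rule eq_equiv_class[OF e eqv UNIV_I])
    then obtain t where "zonotope_of \<omega>' = (+) t ` zonotope_of \<omega>"
      unfolding translation_equiv_def by blast
    then show "\<omega> = \<omega>'" using o zonotope_of_inj[of \<omega> \<omega>' t] by (simp add: cube_configs_def)
  qed
  have cls: "translation_equiv `` {(+) t ` P} = translation_equiv `` {P}" for t and P :: "(real ^ 'd) set"
    by (rule equiv_class_eq[OF eqv, symmetric]) (auto simp: translation_equiv_def)
  show "(\<lambda>\<omega>. translation_equiv `` {zonotope_of \<omega>}) ` cube_configs n = (inscribed_zonotopes n :: (real ^ 'd) set set set)"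
  proof (intro equalityI subsetI)
    fix C :: "(real ^ 'd) set set"
    assume "C \<in> (\<lambda>\<omega>. translation_equiv `` {zonotope_of \<omega>}) ` cube_configs n"
    then obtain \<omega> where \<omega>: "\<omega> \<in> cube_configs n" "C = translation_equiv `` {zonotope_of \<omega>}" by blast
    then have "inscribed_in_cube n ((+) 0 ` zonotope_of \<omega>)"
      using inscribed_zonotope_of_iff[of \<omega> n 0] by (simp add: cube_configs_def)
    then show "C \<in> inscribed_zonotopes n"
      using \<omega> lattice_zonotope_of unfolding inscribed_zonotopes_def cube_configs_def
      by (auto simp: quotient_def)
  next
    fix C :: "(real ^ 'd) set set"
    assume "C \<in> inscribed_zonotopes n"
    then obtain P where P: "lattice_zonotope P" "inscribed_in_cube n P" "C = translation_equiv `` {P}"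
      unfolding inscribed_zonotopes_def quotient_def by blast
    obtain \<omega> t where \<omega>: "\<omega> \<in> configs" "P = (+) t ` zonotope_of \<omega>"
      using P(1) unfolding lattice_zonotope_iff by blast
    have "\<omega> \<in> cube_configs n" using P(2) \<omega> inscribed_zonotope_of_iff[of \<omega> n t] by (simp add: cube_configs_def)
    then show "C \<in> (\<lambda>\<omega>. translation_equiv `` {zonotope_of \<omega>}) ` cube_configs n"
      unfolding P(3) \<omega>(2) cls by blast
  qed
qed

lemma mean_diameter_eq:
  assumes "finite (cube_configs n :: 'd::finite config set)" "(cube_configs n :: 'd config set) \<noteq> {}"
  shows "mean_diameter TYPE('d) n
    = (\<Sum>\<omega>\<in>(cube_configs n :: 'd config set). real (card (support \<omega>))) / real (card (cube_configs n :: 'd config set))"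
proof -
  let ?I = "inscribed_zonotopes n :: (real ^ 'd) set set set"
  let ?\<Omega> = "cube_configs n :: 'd config set"
  note bij = inscribed_zonotopes_bij[where 'd = 'd, of n]
  have I: "finite ?I" "?I \<noteq> {}" "card ?I = card ?\<Omega>"
    using bij_betw_finite[OF bij] bij_betw_same_card[OF bij] assms bij unfolding bij_betw_def by auto
  have cd: "class_diameter (translation_equiv `` {zonotope_of \<omega>}) = card (support \<omega>)" if "\<omega> \<in> ?\<Omega>" for \<omega>
  proof -
    have "zonotope_of \<omega> \<in> translation_equiv `` {zonotope_of \<omega>}"
      using equiv_class_self[OF equiv_translation_equiv] by blast
    then show ?thesis
      using class_diameter_eq[OF bij_betwE[OF bij, rule_format, OF that]] diameter_zonotope_of[of \<omega>] that
      by (simp add: cube_configs_def)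
  qed
  have "mean_diameter TYPE('d) n = (\<Sum>C\<in>?I. real (class_diameter C)) / real (card ?I)"
    unfolding mean_diameter_def using I by (simp add: integral_pmf_of_set)
  also have "(\<Sum>C\<in>?I. real (class_diameter C)) = (\<Sum>\<omega>\<in>?\<Omega>. real (card (support \<omega>)))"
    using cd by (simp flip: sum.reindex_bij_betw[OF bij])
  finally show ?thesis by (simp add: I)
qed

section \<open>Sums over dilations\<close>

lemma summable_dilated_sum:
  fixes h :: "real \<Rightarrow> real" and c :: "nat \<Rightarrow> real"
  assumes B: "\<And>x. x > 0 \<Longrightarrow> \<bar>h x\<bar> \<le> B" and c: "summable c" "\<And>j. c j \<ge> 0" and "b > 0"
  shows "summable (\<lambda>j. c j * h (b * real (Suc j)))"
proof (rule summable_comparison_test')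
  show "summable (\<lambda>j. c j * B)" using c(1) by (rule summable_mult2)
  show "norm (c j * h (b * real (Suc j))) \<le> c j * B" for j
    using B[of "b * real (Suc j)"] \<open>b > 0\<close> c(2) by (auto simp: abs_mult intro!: mult_left_mono)
qed

text \<open>Each summand has the same limit up to its coefficient; the bound on \<open>h\<close> allows the limit to be taken termwise.\<close>
lemma tendsto_dilated_sum:
  fixes h :: "real \<Rightarrow> real" and c :: "nat \<Rightarrow> real"
  assumes h: "(h \<longlongrightarrow> l) (at_right 0)" and B: "\<And>x. x > 0 \<Longrightarrow> \<bar>h x\<bar> \<le> B"
    and c: "summable c" "\<And>j. c j \<ge> 0"
  shows "((\<lambda>b. \<Sum>j. c j * h (b * real (Suc j))) \<longlongrightarrow> l * (\<Sum>j. c j)) (at_right 0)"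
proof -
  have lim: "((\<lambda>b. c j * h (b * real (Suc j))) \<longlongrightarrow> c j * l) (at_right 0)" for j
  proof (intro tendsto_mult tendsto_const filterlim_compose[OF h])
    have "((\<lambda>b. b * real (Suc j)) \<longlongrightarrow> 0 * real (Suc j)) (at_right 0)"
      by (intro tendsto_intros)
    moreover have "\<forall>\<^sub>F b in at_right 0. b * real (Suc j) \<in> {0<..} \<and> b * real (Suc j) \<noteq> 0"
      using eventually_at_right_less[of "0::real"] by eventually_elim auto
    ultimately show "filterlim (\<lambda>b. b * real (Suc j)) (at_right 0) (at_right 0)"
      unfolding filterlim_at by simp
  qed
  have "\<forall>\<^sub>F (k, n) in at_top \<times>\<^sub>F at_right 0. norm (c k * h (n * real (Suc k))) \<le> c k * B"
    unfolding eventually_prod_filter case_prod_conv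
  proof (intro exI conjI allI impI)
    show "\<forall>\<^sub>F x :: nat in at_top. True" by simp
    show "\<forall>\<^sub>F x in at_right (0::real). x > 0" by (rule eventually_at_right_less)
    show "norm (c k * h (x * real (Suc k))) \<le> c k * B" if "x > 0" for k x
      using B[of "x * real (Suc k)"] that c(2) by (auto simp: abs_mult intro!: mult_left_mono)
  qed
  from tannerys_theorem[OF lim this] c(1)
  have "((\<lambda>b. \<Sum>j. c j * h (b * real (Suc j))) \<longlongrightarrow> (\<Sum>j. c j * l)) (at_right 0)"
    by (auto intro: summable_mult2)
  then show "((\<lambda>b. \<Sum>j. c j * h (b * real (Suc j))) \<longlongrightarrow> l * (\<Sum>j. c j)) (at_right 0)"
    using suminf_mult2[OF c(1), of l] by (simp add: mult.commute)
qed

text \<open>A Tauberian statement. Write \<open>e\<close> for the deviation of \<open>h\<close> from the claimed limit. As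
  \<open>c 0 = 1\<close>, the relation expresses \<open>e b\<close> through an average of \<open>e\<close> at larger arguments with total weight \<open>r < 1\<close>, up to
  an error that vanishes. So any eventual bound on \<open>\<bar>e\<bar>\<close> improves by a fixed factor \<open>\<rho> < 1\<close>, and iterating
  from the given bound proves the claim.\<close>
lemma tendsto_of_dilated_sum:
  fixes h :: "real \<Rightarrow> real" and c :: "nat \<Rightarrow> real"
  assumes B: "\<And>x. x > 0 \<Longrightarrow> \<bar>h x\<bar> \<le> B"
    and c: "summable c" "\<And>j. c j \<ge> 0" "c 0 = 1" "(\<Sum>j. c j) < 2"
    and H: "((\<lambda>b. \<Sum>j. c j * h (b * real (Suc j))) \<longlongrightarrow> L) (at_right 0)"
  shows "(h \<longlongrightarrow> L / (\<Sum>j. c j)) (at_right 0)"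
proof -
  define z where "z = (\<Sum>j. c j)"
  define r where "r = z - 1"
  define c' where "c' j = (if j = 0 then 0 else c j)" for j :: nat
  have c': "summable c'" "\<And>j. c' j \<ge> 0"
    using c by (auto simp: c'_def intro: summable_comparison_test'[OF c(1)])
  have csplit: "c j = c' j + (if j = 0 then 1 else 0)" for j by (simp add: c'_def c(3))
  have c'_sum: "(\<Sum>j. c' j) = r"
  proof -
    have "(\<lambda>j. c' j + (if j = 0 then 1 else 0)) sums (suminf c' + 1)"
      using sums_add[OF summable_sums[OF c'(1)] sums_single[of 0 "\<lambda>_. 1::real"]] by simp
    then show ?thesis by (simp add: r_def z_def csplit[symmetric] sums_iff)
  qed
  have r: "0 \<le> r" "r < 1" using c'_sum suminf_nonneg[OF c'] c(4) by (auto simp: r_def z_def)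
  have z: "z > 0" using r by (simp add: r_def)
  define e where "e x = h x - L / z" for x
  define B' where "B' = B + \<bar>L / z\<bar> + 1"
  have "B \<ge> 0" using B[of 1] by simp
  then have B'pos: "B' > 0" unfolding B'_def by (meson abs_ge_zero add_nonneg_nonneg add_nonneg_pos zero_less_one)
  have eB: "\<bar>e x\<bar> \<le> B'" if "x > 0" for x using B[OF that] unfolding e_def B'_def by linarith
  have sum_split: "(\<Sum>j. c j * g (b * real (Suc j))) = g b + (\<Sum>j. c' j * g (b * real (Suc j)))"
    if g: "\<And>x. x > 0 \<Longrightarrow> \<bar>g x\<bar> \<le> K" "b > 0" for g :: "real \<Rightarrow> real" and K b
  proof -
    have "summable (\<lambda>j. c' j * g (b * real (Suc j)))" by (rule summable_dilated_sum[OF g(1) c' g(2)])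
    from sums_add[OF sums_single[of 0 "\<lambda>j. g (b * real (Suc j))"] summable_sums[OF this]]
    have "(\<lambda>j. c j * g (b * real (Suc j))) sums (g b + (\<Sum>j. c' j * g (b * real (Suc j))))"
      by (simp add: csplit distrib_right if_distrib[of "\<lambda>x. x * _"] add.commute cong: if_cong)
    then show ?thesis by (simp add: sums_iff)
  qed
  have E: "((\<lambda>b. e b + (\<Sum>j. c' j * e (b * real (Suc j)))) \<longlongrightarrow> 0) (at_right 0)"
  proof -
    have "(\<Sum>j. c j * e (b * real (Suc j))) = (\<Sum>j. c j * h (b * real (Suc j))) - L" if b: "b > 0" for b
    proof -
      have "summable (\<lambda>j. c j * h (b * real (Suc j)))" by (rule summable_dilated_sum[OF B c(1,2) b])
      moreover have "summable (\<lambda>j. c j * (L / z))" using c(1) by (rule summable_mult2)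
      ultimately have "(\<Sum>j. c j * h (b * real (Suc j)) - c j * (L / z))
          = (\<Sum>j. c j * h (b * real (Suc j))) - (\<Sum>j. c j * (L / z))" by (rule suminf_diff[symmetric])
      then show ?thesis using suminf_mult2[OF c(1), of "L / z"] z
        by (simp add: e_def right_diff_distrib flip: z_def)
    qed
    then have "\<forall>\<^sub>F b in at_right 0. (\<Sum>j. c j * h (b * real (Suc j))) - L = e b + (\<Sum>j. c' j * e (b * real (Suc j)))"
      using sum_split[of e B', OF eB] by (intro eventually_mono[OF eventually_at_right_less[of "0::real"]]) simp
    moreover have "((\<lambda>b. (\<Sum>j. c j * h (b * real (Suc j))) - L) \<longlongrightarrow> L - L) (at_right 0)"
      by (intro tendsto_diff H tendsto_const)
    ultimately show ?thesis by (simp add: tendsto_cong)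
  qed
  define \<rho> where "\<rho> = (1 + r) / 2"
  have \<rho>: "0 < \<rho>" "\<rho> < 1" using r by (auto simp: \<rho>_def)
  have step: "\<forall>\<^sub>F b in at_right 0. \<bar>e b\<bar> \<le> \<rho> * A" if A: "A > 0" "\<forall>\<^sub>F b in at_right 0. \<bar>e b\<bar> \<le> A" for A
  proof -
    \<comment> \<open>The excess over \<open>A\<close> vanishes near \<open>0\<close> but not for the large arguments in the tail of the sum.\<close>
    define m where "m x = max 0 (\<bar>e x\<bar> - A)" for x
    have mB: "\<bar>m x\<bar> \<le> B'" if "x > 0" for x using eB[OF that] A(1) B'pos by (auto simp: m_def)
    have "\<forall>\<^sub>F b in at_right 0. 0 = m b" using A(2) by eventually_elim (simp add: m_def)
    then have "(m \<longlongrightarrow> 0) (at_right 0)" by (rule Lim_transform_eventually[OF tendsto_const])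
    from tendsto_dilated_sum[OF this mB c']
    have M: "((\<lambda>b. \<Sum>j. c' j * m (b * real (Suc j))) \<longlongrightarrow> 0) (at_right 0)" by simp
    have Ms: "summable (\<lambda>j. c' j * m (b * real (Suc j)))" if "b > 0" for b
      by (rule summable_dilated_sum[OF mB c' that])
    have "((\<lambda>b. \<bar>e b + (\<Sum>j. c' j * e (b * real (Suc j)))\<bar> + (\<Sum>j. c' j * m (b * real (Suc j)))) \<longlongrightarrow> 0) (at_right 0)"
      using tendsto_add[OF tendsto_rabs[OF E] M] by simp
    moreover have "(1 - r) / 2 * A > 0" using A(1) r by simp
    ultimately have "\<forall>\<^sub>F b in at_right 0. \<bar>e b + (\<Sum>j. c' j * e (b * real (Suc j)))\<bar>
        + (\<Sum>j. c' j * m (b * real (Suc j))) < (1 - r) / 2 * A"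
      by (rule order_tendstoD)
    then show ?thesis using eventually_at_right_less[of 0]
    proof eventually_elim
      case (elim b)
      have s: "summable (\<lambda>j. c' j * A)" using c'(1) by (rule summable_mult2)
      have le: "norm (c' j * e (b * real (Suc j))) \<le> c' j * m (b * real (Suc j)) + c' j * A" for j
      proof -
        have "\<bar>e (b * real (Suc j))\<bar> \<le> m (b * real (Suc j)) + A" by (simp add: m_def)
        then show ?thesis using c'(2)[of j] mult_left_mono
          by (fastforce simp: abs_mult simp flip: distrib_left)
      qed
      have "\<bar>\<Sum>j. c' j * e (b * real (Suc j))\<bar> \<le> (\<Sum>j. c' j * m (b * real (Suc j)) + c' j * A)"
        using norm_suminf_le[OF le summable_add[OF Ms[OF elim(2)] s]] by simp
      also have "\<dots> = (\<Sum>j. c' j * m (b * real (Suc j))) + r * A"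
        using suminf_add[OF Ms[OF elim(2)] s] suminf_mult2[OF c'(1), of A] c'_sum by simp
      finally have "\<bar>e b\<bar> \<le> \<bar>e b + (\<Sum>j. c' j * e (b * real (Suc j)))\<bar> + (\<Sum>j. c' j * m (b * real (Suc j))) + r * A"
        by linarith
      also have "\<dots> \<le> (1 - r) / 2 * A + r * A" using elim(1) by simp
      also have "\<dots> = \<rho> * A" by (simp add: \<rho>_def field_simps)
      finally show ?case .
    qed
  qed
  have iter: "\<forall>\<^sub>F b in at_right 0. \<bar>e b\<bar> \<le> \<rho> ^ k * B'" for k
  proof (induction k)
    case 0
    then show ?case using eB by (intro eventually_mono[OF eventually_at_right_less]) auto
  next
    case (Suc k)
    then show ?case using step[of "\<rho> ^ k * B'"] \<rho> B'pos by (simp add: mult.assoc)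
  qed
  have "(e \<longlongrightarrow> 0) (at_right 0)"
    unfolding tendsto_iff dist_real_def
  proof (intro allI impI)
    fix \<epsilon> :: real assume "\<epsilon> > 0"
    moreover have "(\<lambda>k. \<rho> ^ k * B') \<longlonglongrightarrow> 0"
      using tendsto_mult_right[OF LIMSEQ_realpow_zero[of \<rho>], of B'] \<rho> by simp
    ultimately have "\<forall>\<^sub>F k in sequentially. \<rho> ^ k * B' < \<epsilon>" by (intro order_tendstoD(2))
    then obtain k where "\<rho> ^ k * B' < \<epsilon>" using eventually_happens' sequentially_bot by blast
    then show "\<forall>\<^sub>F x in at_right 0. \<bar>e x - 0\<bar> < \<epsilon>" by (intro eventually_mono[OF iter[of k]]) simp
  qed
  then have "((\<lambda>x. e x + L / z) \<longlongrightarrow> 0 + L / z) (at_right 0)" by (intro tendsto_add tendsto_const)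
  then show ?thesis by (simp add: e_def z_def)
qed

lemma zeta_nat: "zeta (real d) = (\<Sum>j. 1 / real (Suc j) ^ d)"
  unfolding zeta_def by (subst powr_realpow) auto

lemma summable_zeta: "d \<ge> 2 \<Longrightarrow> summable (\<lambda>j. 1 / real (Suc j) ^ d)"
proof -
  assume "d \<ge> 2"
  then have "summable (\<lambda>j. inverse (real j ^ d))" by (rule inverse_power_summable)
  then have "summable (\<lambda>j. inverse (real (Suc j) ^ d))" by (subst summable_Suc_iff)
  then show ?thesis by (simp only: divide_inverse mult_1)
qed

text \<open>Past the first two terms, a telescoping comparison with \<open>1 / (j (j + 1))\<close>.\<close>
lemma zeta_less_2:
  assumes "d \<ge> 2"
  shows "(\<Sum>j. 1 / real (Suc j) ^ d) < 2"
proof -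
  have le': "(\<Sum>j<n. 1 / real (Suc j) ^ d) \<le> 7 / 4" if n2: "n \<ge> 2" for n
  proof -
    obtain m where m: "n = Suc (Suc m)" using n2 that[of "n - 2"] by linarith
    have le2: "(\<Sum>j<Suc (Suc k). 1 / real (Suc j) ^ 2) \<le> 7 / 4 - 1 / real (Suc (Suc k))" for k
    proof (induction k)
      case 0 then show ?case by (simp add: numeral_2_eq_2)
    next
      case (Suc k)
      have "1 / real (Suc (Suc (Suc k))) ^ 2 \<le> 1 / (real (Suc (Suc k)) * real (Suc (Suc (Suc k))))"
        by (intro divide_left_mono) (auto simp: power2_eq_square)
      also have "\<dots> = 1 / real (Suc (Suc k)) - 1 / real (Suc (Suc (Suc k)))" by (simp add: field_simps)
      finally show ?case using Suc by simp
    qed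
    have "(\<Sum>j<n. 1 / real (Suc j) ^ d) \<le> (\<Sum>j<n. 1 / real (Suc j) ^ 2)"
      using assms by (intro sum_mono divide_left_mono power_increasing) auto
    also have "\<dots> \<le> 7 / 4 - 1 / real (Suc (Suc m))" using le2[of m] m by simp
    also have "\<dots> \<le> 7 / 4" by simp
    finally show ?thesis .
  qed
  have "(\<Sum>j. 1 / real (Suc j) ^ d) \<le> 7 / 4"
    by (rule LIMSEQ_le_const2[OF summable_LIMSEQ[OF summable_zeta[OF assms]]]) (use le' in blast)
  then show ?thesis by simp
qed

section \<open>Sums over primitive vectors\<close>

text \<open>The general scales \<open>a\<close> serve the tail estimates, which tilt a single coordinate.\<close>
definition weight :: "('d::finite \<Rightarrow> real) \<Rightarrow> ('d \<Rightarrow> int) \<Rightarrow> real" where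
  "weight a v = (\<Sum>i\<in>UNIV. a i * \<bar>of_int (v i)\<bar>)"

definition prim_sum :: "('d::finite \<Rightarrow> real) \<Rightarrow> real \<Rightarrow> real" where
  "prim_sum a b = (\<Sum>\<^sub>\<infinity>p\<in>primitives. exp (- b * weight a p))"

text \<open>The logarithm of the product of \<open>1 / (1 - exp (- b * weight a p))\<close>, the generating function of all configurations.\<close>
definition log_Z :: "('d::finite \<Rightarrow> real) \<Rightarrow> real \<Rightarrow> real" where
  "log_Z a b = (\<Sum>\<^sub>\<infinity>p\<in>primitives. - ln (1 - exp (- b * weight a p)))"

lemma has_sum_exp_abs_int:
  fixes x :: real
  assumes "x > 0"
  shows "((\<lambda>k::int. exp (- x * \<bar>of_int k\<bar>)) has_sum ((1 + exp (- x)) / (1 - exp (- x)))) UNIV"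
proof -
  define q where "q = exp (- x)"
  have q: "0 < q" "q < 1" using assms by (auto simp: q_def)
  have pow: "exp (- x * real n) = q ^ n" for n by (simp add: q_def flip: exp_of_nat_mult)
  have geo: "((\<lambda>n::nat. q ^ n) has_sum (1 / (1 - q))) UNIV"
    using q by (intro sums_nonneg_imp_has_sum geometric_sums) auto
  have geo': "((\<lambda>n::nat. q * q ^ n) has_sum (q * (1 / (1 - q)))) UNIV"
    by (rule has_sum_cmult_right[OF geo])
  let ?f = "\<lambda>k::int. exp (- x * \<bar>of_int k\<bar>)"
  have "(?f has_sum (1 / (1 - q))) (range int)"
    by (subst has_sum_reindex) (auto simp: o_def pow[simplified] intro: geo)
  moreover have "(?f has_sum (q * (1 / (1 - q)))) (range (\<lambda>n. - int (Suc n)))"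
  proof (subst has_sum_reindex)
    have "?f (- int (Suc n)) = q * q ^ n" for n
      using pow[of "Suc n"] by (simp add: algebra_simps)
    then show "(?f \<circ> (\<lambda>n. - int (Suc n)) has_sum (q * (1 / (1 - q)))) UNIV"
      using geo' by (simp add: o_def)
  qed (auto simp: inj_def)
  moreover have "range int \<inter> range (\<lambda>n. - int (Suc n)) = {}" by auto
  ultimately have "(?f has_sum (1 / (1 - q) + q * (1 / (1 - q)))) (range int \<union> range (\<lambda>n. - int (Suc n)))"
    by (rule has_sum_Un_disjoint)
  moreover have "range int \<union> range (\<lambda>n. - int (Suc n)) = UNIV"
  proof -
    have "k \<in> range int \<union> range (\<lambda>n. - int (Suc n))" for k :: int
      by (cases k rule: int_cases) auto
    then show ?thesis by blast
  qed
  ultimately show ?thesis by (simp add: q_def add_divide_distrib)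
qed

context
  fixes a :: "'d::finite \<Rightarrow> real" and b :: real
  assumes a: "\<And>i. a i > 0" and b: "b > 0"
begin

lemma has_sum_exp_weight:
  "((\<lambda>v. exp (- b * weight a v)) has_sum (\<Prod>i\<in>UNIV. (1 + exp (- b * a i)) / (1 - exp (- b * a i)))) UNIV"
proof -
  have e: "exp (- b * weight a v) = (\<Prod>i\<in>UNIV. exp (- (b * a i) * \<bar>of_int (v i)\<bar>))" for v
    unfolding weight_def by (simp add: sum_distrib_left mult.assoc sum_negf flip: exp_sum)
  have hs: "((\<lambda>k::int. exp (- (b * a i) * \<bar>of_int k\<bar>)) has_sum ((1 + exp (- (b * a i))) / (1 - exp (- (b * a i))))) UNIV" for i
    using a b by (intro has_sum_exp_abs_int) simp
  have U: "PiE UNIV (\<lambda>_. UNIV) = (UNIV :: ('d \<Rightarrow> int) set)" by (auto simp: PiE_def extensional_def)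
  have "infsum (\<lambda>v. \<Prod>i\<in>UNIV. exp (- (b * a i) * \<bar>of_int (v i)\<bar>)) (PiE UNIV (\<lambda>_. UNIV :: int set))
      = (\<Prod>i\<in>UNIV. infsum (\<lambda>k::int. exp (- (b * a i) * \<bar>of_int k\<bar>)) UNIV)"
    using hs by (intro infsum_prod_PiE_abs) (auto simp: summable_on_def)
  then have inf: "infsum (\<lambda>v. exp (- b * weight a v)) UNIV = (\<Prod>i\<in>UNIV. (1 + exp (- (b * a i))) / (1 - exp (- (b * a i))))"
    unfolding U e using infsumI[OF hs] by simp
  have "(\<Prod>i\<in>UNIV. (1 + exp (- (b * a i))) / (1 - exp (- (b * a i)))) > 0"
    using a b by (intro prod_pos divide_pos_pos) (auto simp: add_pos_pos)
  then have "(\<lambda>v. exp (- b * weight a v)) summable_on UNIV"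
    using inf infsum_not_exists by fastforce
  then show ?thesis using inf by (simp add: has_sum_iff)
qed

lemma summable_prim_sum: "(\<lambda>p. exp (- b * weight a p)) summable_on primitives"
  by (rule summable_on_subset[OF has_sum_imp_summable[OF has_sum_exp_weight]]) simp

lemma weight_mult: "weight a (\<lambda>i. c * v i) = \<bar>of_int c\<bar> * weight a v"
  unfolding weight_def by (simp add: abs_mult sum_distrib_left algebra_simps)

lemma weight_lower:
  assumes "v \<noteq> (\<lambda>_. 0)"
  shows "weight a v \<ge> Min (range a)"
proof -
  obtain i where i: "v i \<noteq> 0" using assms by (auto simp: fun_eq_iff)
  have "Min (range a) \<le> a i" by simp
  also have "a i \<le> a i * \<bar>of_int (v i)\<bar>"
  proof -
    have "\<bar>v i\<bar> \<ge> 1" using i by linarith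
    then have "\<bar>real_of_int (v i)\<bar> \<ge> 1" by linarith
    then show ?thesis using a[of i] by simp
  qed
  also have "\<dots> \<le> weight a v" unfolding weight_def
    using a by (intro member_le_sum) (auto simp: less_imp_le)
  finally show ?thesis .
qed

lemma weight_pos: "v \<noteq> (\<lambda>_. 0) \<Longrightarrow> weight a v > 0"
proof -
  assume "v \<noteq> (\<lambda>_. 0)"
  moreover have "Min (range a) > 0" using a by (subst Min_gr_iff) auto
  ultimately show ?thesis using weight_lower[of v] by linarith
qed

end

text \<open>The sum of \<open>exp (- b * weight a v)\<close> over all integer vectors \<open>v\<close> is an elementary product; removing \<open>v = 0\<close> and grouping the
  vectors by their primitive representative and the positive or negative multiple gives twice the sum on the left.\<close>
lemma multiples_sum:
  fixes a :: "'d::finite \<Rightarrow> real"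
  assumes a: "\<And>i. a i > 0" and b: "b > 0"
  shows "(\<lambda>(j, p). exp (- (b * real (Suc j)) * weight a p)) summable_on UNIV \<times> primitives"
    "(\<lambda>j. prim_sum a (b * real (Suc j))) sums
       (((\<Prod>i\<in>UNIV. (1 + exp (- b * a i)) / (1 - exp (- b * a i))) - 1) / 2)"
proof -
  let ?f = "\<lambda>v. exp (- b * weight a v)"
  let ?\<Pi> = "\<Prod>i\<in>UNIV. (1 + exp (- b * a i)) / (1 - exp (- b * a i))"
  have w0: "weight a (\<lambda>_. 0) = 0" by (simp add: weight_def)
  have "(?f has_sum 1) {\<lambda>_. 0}" using has_sum_finite[of "{\<lambda>_. 0}" "?f"] w0 by simp
  from has_sum_Diff[OF has_sum_exp_weight[of a b, OF a b] this]
  have "(?f has_sum (?\<Pi> - 1)) (UNIV - {\<lambda>_. 0})" by simp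
  then have "((\<lambda>x. ?f ((\<lambda>(c, p) i. c * p i) x)) has_sum (?\<Pi> - 1)) ((UNIV - {0}) \<times> primitives)"
    using has_sum_reindex_bij_betw[OF primitive_decomposition, of ?f] by simp
  then have S: "((\<lambda>(c, p). exp (- (b * \<bar>of_int c\<bar>) * weight a p)) has_sum (?\<Pi> - 1)) ((UNIV - {0 :: int}) \<times> primitives)"
    by (simp add: case_prod_unfold weight_mult[of a b, OF a b] mult.assoc)
  have pos: "(\<lambda>n. int (Suc n)) ` UNIV \<subseteq> UNIV - {0}" by auto
  have injP: "inj_on (\<lambda>(j, p). (int (Suc j), p)) (UNIV \<times> primitives)" by (auto simp: inj_on_def)
  have "(\<lambda>(j, p). (int (Suc j), p)) ` (UNIV \<times> primitives) \<subseteq> (UNIV - {0}) \<times> primitives" by auto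
  then have "(\<lambda>(c, p). exp (- (b * \<bar>of_int c\<bar>) * weight a p)) summable_on (\<lambda>(j, p). (int (Suc j), p)) ` (UNIV \<times> primitives)"
    by (rule summable_on_subset[OF has_sum_imp_summable[OF S]])
  then show summ: "(\<lambda>(j, p). exp (- (b * real (Suc j)) * weight a p)) summable_on UNIV \<times> primitives"
    unfolding summable_on_reindex[OF injP] by (simp add: o_def case_prod_unfold)
  have "((\<lambda>p. exp (- (b * \<bar>of_int c\<bar>) * weight a p)) has_sum prim_sum a (b * \<bar>of_int c\<bar>)) primitives"
    if "c \<in> UNIV - {0}" for c :: int
    unfolding prim_sum_def using that b
    by (intro has_sum_infsum summable_prim_sum[of a, OF a]) auto
  then have T: "((\<lambda>c. prim_sum a (b * \<bar>of_int c\<bar>)) has_sum (?\<Pi> - 1)) (UNIV - {0 :: int})"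
    by (intro has_sum_SigmaD[OF S]) auto
  define s where "s = infsum (\<lambda>n. prim_sum a (b * real (Suc n))) UNIV"
  have i1: "inj (\<lambda>n. int (Suc n))" "inj (\<lambda>n. - int (Suc n))" by (auto simp: inj_def)
  have "(\<lambda>c. prim_sum a (b * \<bar>of_int c\<bar>)) summable_on (\<lambda>n. int (Suc n)) ` UNIV"
    by (rule summable_on_subset[OF has_sum_imp_summable[OF T] pos])
  then have "(\<lambda>n. prim_sum a (b * real (Suc n))) summable_on UNIV"
    unfolding summable_on_reindex[OF i1(1)] by (simp add: o_def)
  then have hs: "((\<lambda>n. prim_sum a (b * real (Suc n))) has_sum s) UNIV" unfolding s_def by (rule has_sum_infsum)
  have "((\<lambda>c. prim_sum a (b * \<bar>of_int c\<bar>)) has_sum s) (range (\<lambda>n. int (Suc n)))"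
    "((\<lambda>c. prim_sum a (b * \<bar>of_int c\<bar>)) has_sum s) (range (\<lambda>n. - int (Suc n)))"
    unfolding has_sum_reindex[OF i1(1)] has_sum_reindex[OF i1(2)] using hs by (simp_all add: o_def add.commute)
  then have "((\<lambda>c. prim_sum a (b * \<bar>of_int c\<bar>)) has_sum (s + s)) (range (\<lambda>n. int (Suc n)) \<union> range (\<lambda>n. - int (Suc n)))"
    by (rule has_sum_Un_disjoint) auto
  moreover have "range (\<lambda>n. int (Suc n)) \<union> range (\<lambda>n. - int (Suc n)) = UNIV - {0}"
  proof -
    have "k \<in> range (\<lambda>n. int (Suc n)) \<union> range (\<lambda>n. - int (Suc n))" if k: "k \<noteq> 0" for k :: int
    proof (cases k rule: int_cases)
      case (nonneg n)
      then obtain m where "n = Suc m" using k by (cases n) auto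
      then show ?thesis using nonneg by auto
    qed auto
    then show ?thesis by auto
  qed
  ultimately have "((\<lambda>c. prim_sum a (b * \<bar>of_int c\<bar>)) has_sum (s + s)) (UNIV - {0})" by simp
  then have "s + s = ?\<Pi> - 1" using T by (rule has_sum_unique)
  then have "s = (?\<Pi> - 1) / 2" by simp
  then show "(\<lambda>j. prim_sum a (b * real (Suc j))) sums ((?\<Pi> - 1) / 2)"
    using has_sum_imp_sums[OF hs] by (simp only:)
qed

text \<open>Expand the logarithm and exchange the order of summation.\<close>
lemma log_Z_sums:
  fixes a :: "'d::finite \<Rightarrow> real"
  assumes a: "\<And>i. a i > 0" and b: "b > 0"
  shows "(\<lambda>j. prim_sum a (b * real (Suc j)) / real (Suc j)) sums log_Z a b"
    "(\<lambda>p. - ln (1 - exp (- b * weight a p))) summable_on primitives"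
proof -
  let ?g = "\<lambda>j p. exp (- (b * real (Suc j)) * weight a p) / real (Suc j)"
  note K = multiples_sum(1)[of a b, OF a b]
  have G: "(\<lambda>(j, p). ?g j p) summable_on UNIV \<times> primitives"
    by (rule summable_on_comparison_test[OF K]) (auto simp: divide_le_eq)
  have G': "(\<lambda>(p, j). ?g j p) summable_on primitives \<times> UNIV"
    using G summable_on_swap[of "\<lambda>(j, p). ?g j p" UNIV primitives] by (simp add: case_prod_unfold)
  have inner: "((\<lambda>j. ?g j p) has_sum (- ln (1 - exp (- b * weight a p)))) UNIV" if p: "p \<in> primitives" for p
  proof (rule sums_nonneg_imp_has_sum)
    define x where "x = exp (- b * weight a p)"
    have x: "0 < x" "x < 1" using weight_pos[of a b, OF a b primitive_nonzero[OF p]] b by (auto simp: x_def)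
    have "(\<lambda>n. - ((- (- x)) ^ n) / real n) sums ln (1 + (- x))"
      using x by (intro ln_series') auto
    from sums_minus[OF this] have "(\<lambda>n. x ^ n / real n) sums - ln (1 - x)" by simp
    then have "(\<lambda>n. x ^ Suc n / real (Suc n)) sums - ln (1 - x)"
      using sums_Suc_iff[of "\<lambda>n. x ^ n / real n" "- ln (1 - x)"] by simp
    moreover have "x ^ Suc n = exp (- (b * real (Suc n)) * weight a p)" for n
      unfolding x_def exp_of_nat_mult[symmetric] by (simp add: algebra_simps)
    ultimately show "(\<lambda>j. ?g j p) sums - ln (1 - exp (- b * weight a p))" by (simp add: x_def)
  qed auto
  then have eq: "infsum (\<lambda>j. ?g j p) UNIV = - ln (1 - exp (- b * weight a p))" if "p \<in> primitives" for p
    using that infsumI by blast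
  have "(\<lambda>p. infsum (\<lambda>j. ?g j p) UNIV) summable_on primitives"
    using summable_on_SigmaD[OF G'] inner by (auto simp: summable_on_def)
  then show "(\<lambda>p. - ln (1 - exp (- b * weight a p))) summable_on primitives"
    using eq by (simp cong: summable_on_cong)
  have hsG: "((\<lambda>(j, p). ?g j p) has_sum log_Z a b) (UNIV \<times> primitives)"
  proof -
    have "infsum (\<lambda>j. infsum (\<lambda>p. ?g j p) primitives) UNIV = infsum (\<lambda>p. infsum (\<lambda>j. ?g j p) UNIV) primitives"
      by (rule infsum_swap_banach[OF G])
    also have "\<dots> = log_Z a b" unfolding log_Z_def using eq by (rule infsum_cong)
    finally show ?thesis using infsum_Sigma'_banach[OF G] G by (simp add: has_sum_iff)
  qed
  have "((\<lambda>p. ?g j p) has_sum prim_sum a (b * real (Suc j)) / real (Suc j)) primitives" for j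
  proof -
    have "((\<lambda>p. exp (- (b * real (Suc j)) * weight a p)) has_sum prim_sum a (b * real (Suc j))) primitives"
      unfolding prim_sum_def using b by (intro has_sum_infsum summable_prim_sum[of a, OF a]) auto
    from has_sum_cmult_left[OF this, of "1 / real (Suc j)"] show ?thesis by simp
  qed
  then have "((\<lambda>j. prim_sum a (b * real (Suc j)) / real (Suc j)) has_sum log_Z a b) UNIV"
    by (intro has_sum_SigmaD[OF hsG]) auto
  then show "(\<lambda>j. prim_sum a (b * real (Suc j)) / real (Suc j)) sums log_Z a b"
    by (rule has_sum_imp_sums)
qed

lemma coth_factor_limit:
  fixes c :: real
  assumes "c > 0"
  shows "((\<lambda>b. b * ((1 + exp (- b * c)) / (1 - exp (- b * c)))) \<longlongrightarrow> 2 / c) (at_right 0)"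
proof -
  have "((\<lambda>b. b * ((1 + exp (- b * c)) / (1 - exp (- b * c)))) \<longlongrightarrow> 2 * inverse c) (at_right 0)"
    using assms by real_asymp
  then show ?thesis by (simp add: divide_inverse)
qed

lemma coth_factor_le:
  fixes b c :: real
  assumes "0 < b" "b \<le> 1" "c > 0"
  shows "b * ((1 + exp (- b * c)) / (1 - exp (- b * c))) \<le> 2 * (1 + c) / c"
proof -
  define y where "y = b * c"
  have y: "y > 0" using assms by (simp add: y_def)
  have "1 + y \<le> exp y" by (rule exp_ge_add_one_self)
  then have "exp (- y) \<le> 1 / (1 + y)" using y by (simp add: exp_minus field_simps)
  then have e: "y / (1 + y) \<le> 1 - exp (- y)" using y by (simp add: field_simps)
  have "b * ((1 + exp (- y)) / (1 - exp (- y))) \<le> b * (2 / (y / (1 + y)))"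
    using e y assms by (intro mult_left_mono frac_le) auto
  also have "\<dots> = 2 * (1 + b * c) / c" using assms by (simp add: y_def field_simps)
  also have "\<dots> \<le> 2 * (1 + c) / c" using assms by (intro divide_right_mono) auto
  finally show ?thesis by (simp add: y_def)
qed

lemma prim_sum_nonneg: "prim_sum a b \<ge> 0"
  unfolding prim_sum_def by (intro infsum_nonneg) simp

text \<open>For \<open>b \<le> 1\<close> the first summand of \<open>multiples_sum\<close> is bounded by the whole product; for \<open>b \<ge> 1\<close> exponential decay at
  the rate of the smallest weight beats the power.\<close>
lemma prim_sum_bounded:
  fixes a :: "'d::finite \<Rightarrow> real"
  assumes a: "\<And>i. a i > 0"
  shows "\<exists>B. \<forall>b>0. \<bar>b ^ CARD('d) * prim_sum a b\<bar> \<le> B"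
proof -
  define d where "d = CARD('d)"
  have d: "d > 0" by (simp add: d_def)
  define m where "m = Min (range a)"
  have m: "m > 0" unfolding m_def using a by (subst Min_gr_iff) auto
  define B1 where "B1 = (\<Prod>i\<in>(UNIV::'d set). 2 * (1 + a i) / a i)"
  define B2 where "B2 = (real d / m) ^ d * exp m * prim_sum a 1"
  have 1: "b ^ d * prim_sum a b \<le> B1" if b: "0 < b" "b \<le> 1" for b
  proof -
    let ?\<Pi> = "\<Prod>i\<in>UNIV. (1 + exp (- b * a i)) / (1 - exp (- b * a i))"
    have f: "(1 + exp (- b * a i)) / (1 - exp (- b * a i)) \<ge> 0" for i
      using a[of i] b by (intro divide_nonneg_nonneg) auto
    note S = multiples_sum(2)[of a b, OF a b(1)]
    have "prim_sum a b \<le> (?\<Pi> - 1) / 2"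
      using sum_le_suminf[OF sums_summable[OF S], of "{0}"] sums_unique[OF S] prim_sum_nonneg by auto
    also have "\<dots> \<le> ?\<Pi>" using prod_nonneg[of UNIV "\<lambda>i. (1 + exp (- b * a i)) / (1 - exp (- b * a i))"] f by auto
    finally have "b ^ d * prim_sum a b \<le> b ^ d * ?\<Pi>" using b by (intro mult_left_mono) auto
    also have "\<dots> = (\<Prod>i\<in>UNIV. b * ((1 + exp (- b * a i)) / (1 - exp (- b * a i))))"
      unfolding prod.distrib by (simp add: d_def)
    also have "\<dots> \<le> B1" unfolding B1_def
      using coth_factor_le[OF b a] mult_nonneg_nonneg[OF less_imp_le[OF b(1)] f] by (intro prod_mono) blast
    finally show ?thesis .
  qed
  have 2: "b ^ d * prim_sum a b \<le> B2" if b: "b \<ge> 1" for b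
  proof -
    have "exp (- b * weight a p) \<le> exp (- (b - 1) * m) * exp (- 1 * weight a p)" if "p \<in> primitives" for p
    proof -
      have "(b - 1) * m \<le> (b - 1) * weight a p"
        using weight_lower[of a b, OF a _ primitive_nonzero[OF that]] b unfolding m_def by (intro mult_left_mono) auto
      then show ?thesis by (simp add: algebra_simps flip: exp_add)
    qed
    then have "prim_sum a b \<le> (\<Sum>\<^sub>\<infinity>p\<in>primitives. exp (- (b - 1) * m) * exp (- 1 * weight a p))"
      unfolding prim_sum_def using b
      by (intro infsum_mono summable_on_cmult_right summable_prim_sum[of a, OF a]) auto
    also have "\<dots> = exp (- (b - 1) * m) * prim_sum a 1"
      unfolding prim_sum_def by (rule infsum_cmult_right')
    finally have le: "prim_sum a b \<le> exp (- (b - 1) * m) * prim_sum a 1" .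
    have "(b * m / real d) ^ d \<le> (1 + b * m / real d) ^ d"
      using b m by (intro power_mono) auto
    also have "\<dots> \<le> exp (b * m)"
    proof (rule exp_ge_one_plus_x_over_n_power_n)
      have "0 \<le> b * m" using b m by simp
      then show "- real d \<le> b * m" by linarith
    qed (rule d)
    finally have "(real d / m) ^ d * (b * m / real d) ^ d \<le> (real d / m) ^ d * exp (b * m)"
      using m by (intro mult_left_mono) auto
    moreover have "(real d / m) ^ d * (b * m / real d) ^ d = b ^ d"
      using m d by (simp flip: power_mult_distrib)
    ultimately have "b ^ d * prim_sum a b \<le> (real d / m) ^ d * exp (b * m) * (exp (- (b - 1) * m) * prim_sum a 1)"
      using le m by (intro mult_mono) (auto simp: prim_sum_nonneg)
    also have "exp (b * m) * exp (- (b - 1) * m) = exp m"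
      by (simp flip: exp_add) (simp add: algebra_simps)
    then have "(real d / m) ^ d * exp (b * m) * (exp (- (b - 1) * m) * prim_sum a 1) = B2"
      by (simp add: B2_def)
    finally show ?thesis .
  qed
  have "\<forall>b>0. \<bar>b ^ d * prim_sum a b\<bar> \<le> max B1 B2"
  proof (intro allI impI)
    fix b :: real assume "b > 0"
    then show "\<bar>b ^ d * prim_sum a b\<bar> \<le> max B1 B2"
      using 1[of b] 2[of b] prim_sum_nonneg[of a b] by (cases "b \<le> 1") (auto simp: le_max_iff_disj)
  qed
  then show ?thesis unfolding d_def by blast
qed

lemma prim_sum_asymptotic:
  fixes a :: "'d::finite \<Rightarrow> real"
  assumes a: "\<And>i. a i > 0" and d2: "CARD('d) \<ge> 2"
  shows "((\<lambda>b. b ^ CARD('d) * prim_sum a b) \<longlongrightarrow>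
    2 ^ (CARD('d) - 1) / zeta (real CARD('d)) / (\<Prod>i\<in>UNIV. a i)) (at_right 0)"
proof -
  define d where "d = CARD('d)"
  define h where "h b = b ^ d * prim_sum a b" for b
  obtain B where B: "\<And>b. b > 0 \<Longrightarrow> \<bar>h b\<bar> \<le> B"
    using prim_sum_bounded[of a, OF a] unfolding h_def d_def by blast
  define c where "c j = 1 / real (Suc j) ^ d" for j
  let ?\<Pi> = "\<lambda>b. \<Prod>i\<in>UNIV. (1 + exp (- b * a i)) / (1 - exp (- b * a i))"
  have eq: "(\<Sum>j. c j * h (b * real (Suc j))) = b ^ d * ((?\<Pi> b - 1) / 2)" if "b > 0" for b
  proof -
    have "c j * h (b * real (Suc j)) = b ^ d * prim_sum a (b * real (Suc j))" for j
      by (simp add: c_def h_def power_mult_distrib del: of_nat_Suc)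
    then show ?thesis
      using sums_mult[OF multiples_sum(2)[of a b, OF a that], of "b ^ d"] by (simp only: sums_iff)
  qed
  have T: "((\<lambda>b. (\<Prod>i\<in>UNIV. b * ((1 + exp (- b * a i)) / (1 - exp (- b * a i)))) / 2 - b ^ d / 2) \<longlongrightarrow>
     (\<Prod>i\<in>UNIV. 2 / a i) / 2 - 0 ^ d / 2) (at_right 0)"
    by (intro tendsto_intros coth_factor_limit a) simp_all
  have V: "(\<Prod>i\<in>UNIV. 2 / a i) / 2 - 0 ^ d / 2 = 2 ^ (d - 1) / (\<Prod>i\<in>UNIV. a i)"
    using d2 power_minus_mult[of d "2::real"] by (simp add: prod_dividef d_def field_simps)
  have EV: "\<forall>\<^sub>F b in at_right 0. (\<Prod>i\<in>UNIV. b * ((1 + exp (- b * a i)) / (1 - exp (- b * a i)))) / 2 - b ^ d / 2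
      = (\<Sum>j. c j * h (b * real (Suc j)))"
    using eventually_at_right_less[of 0]
  proof eventually_elim
    case (elim b)
    have "(\<Prod>i\<in>UNIV. b * ((1 + exp (- b * a i)) / (1 - exp (- b * a i)))) = b ^ d * ?\<Pi> b"
      unfolding prod.distrib by (simp add: d_def)
    then show ?case unfolding eq[OF elim] by (simp add: field_simps)
  qed
  have H: "((\<lambda>b. \<Sum>j. c j * h (b * real (Suc j))) \<longlongrightarrow> 2 ^ (d - 1) / (\<Prod>i\<in>UNIV. a i)) (at_right 0)"
    using Lim_transform_eventually[OF T EV] unfolding V .
  have "(h \<longlongrightarrow> 2 ^ (d - 1) / (\<Prod>i\<in>UNIV. a i) / (\<Sum>j. c j)) (at_right 0)"
  proof (rule tendsto_of_dilated_sum[OF B _ _ _ _ H])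
    show "summable c" "suminf c < 2"
      unfolding c_def using d2 by (auto intro!: summable_zeta zeta_less_2 simp del: of_nat_Suc simp: d_def)
  qed (auto simp: c_def)
  then show ?thesis unfolding h_def c_def d_def[symmetric] zeta_nat by (simp only: divide_divide_eq_left mult.commute)
qed

lemma log_Z_asymptotic:
  fixes a :: "'d::finite \<Rightarrow> real"
  assumes a: "\<And>i. a i > 0" and d2: "CARD('d) \<ge> 2"
  shows "((\<lambda>b. b ^ CARD('d) * log_Z a b) \<longlongrightarrow> kappa (CARD('d)) / (\<Prod>i\<in>UNIV. a i)) (at_right 0)"
proof -
  define d where "d = CARD('d)"
  define h where "h b = b ^ d * prim_sum a b" for b
  obtain B where B: "\<And>b. b > 0 \<Longrightarrow> \<bar>h b\<bar> \<le> B"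
    using prim_sum_bounded[of a, OF a] unfolding h_def d_def by blast
  define c where "c j = 1 / real (Suc j) ^ (d + 1)" for j
  have lim: "(h \<longlongrightarrow> 2 ^ (d - 1) / zeta (real d) / (\<Prod>i\<in>UNIV. a i)) (at_right 0)"
    unfolding h_def d_def by (rule prim_sum_asymptotic[OF assms])
  have c: "summable c" unfolding c_def using d2 by (intro summable_zeta) (auto simp: d_def)
  have T: "((\<lambda>b. \<Sum>j. c j * h (b * real (Suc j))) \<longlongrightarrow> 2 ^ (d - 1) / zeta (real d) / (\<Prod>i\<in>UNIV. a i) * suminf c) (at_right 0)"
    by (rule tendsto_dilated_sum[OF lim B c]) (simp_all add: c_def)
  have V: "suminf c = zeta (real d + 1)"
    unfolding c_def using zeta_nat[of "d + 1"] by (simp add: add.commute)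
  have EV: "\<forall>\<^sub>F b in at_right 0. (\<Sum>j. c j * h (b * real (Suc j))) = b ^ d * log_Z a b"
    using eventually_at_right_less[of 0]
  proof eventually_elim
    case (elim b)
    have "c j * h (b * real (Suc j)) = b ^ d * (prim_sum a (b * real (Suc j)) / real (Suc j))" for j
      by (simp add: c_def h_def power_mult_distrib del: of_nat_Suc)
    then show ?case
      using sums_mult[OF log_Z_sums(1)[of a b, OF a elim], of "b ^ d"] by (simp only: sums_iff)
  qed
  have "((\<lambda>b. b ^ d * log_Z a b) \<longlongrightarrow> 2 ^ (d - 1) / zeta (real d) / (\<Prod>i\<in>UNIV. a i) * zeta (real d + 1)) (at_right 0)"
    using Lim_transform_eventually[OF T EV] unfolding V .
  then show ?thesis by (simp add: kappa_def d_def mult.commute)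
qed

section \<open>Configurations in the cube\<close>

lemma weight_load:
  assumes "finite S" "support \<omega> \<subseteq> S"
  shows "(\<Sum>p\<in>S. real (\<omega> p) * weight a p) = (\<Sum>i\<in>UNIV. a i * real (load \<omega> i))"
proof -
  have "(\<Sum>p\<in>S. real (\<omega> p) * weight a p) = (\<Sum>p\<in>S. \<Sum>i\<in>UNIV. a i * (real (\<omega> p) * \<bar>of_int (p i)\<bar>))"
    unfolding weight_def by (simp add: sum_distrib_left algebra_simps)
  also have "\<dots> = (\<Sum>i\<in>UNIV. \<Sum>p\<in>S. a i * (real (\<omega> p) * \<bar>of_int (p i)\<bar>))" by (rule sum.swap)
  also have "\<dots> = (\<Sum>i\<in>UNIV. a i * real (load \<omega> i))"
    unfolding load_superset[OF assms] by (simp add: sum_distrib_left)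
  finally show ?thesis .
qed

lemma cube_bounds:
  assumes "\<omega> \<in> cube_configs n" "p \<in> support \<omega>"
  shows "\<omega> p \<le> n" "\<bar>p i\<bar> \<le> int n"
proof -
  have fin: "finite (support \<omega>)" and p: "p \<in> primitives" using assms by (auto simp: cube_configs_def configs_def)
  have le: "\<omega> p * nat \<bar>p j\<bar> \<le> n" for j
  proof -
    have "\<omega> p * nat \<bar>p j\<bar> \<le> load \<omega> j" unfolding load_def using fin assms(2) by (intro member_le_sum) auto
    then show ?thesis using assms(1) by (simp add: cube_configs_def)
  qed
  obtain j where "p j \<noteq> 0" using primitive_nonzero[OF p] by (auto simp: fun_eq_iff)
  then have "1 \<le> nat \<bar>p j\<bar>" by simp
  then have "\<omega> p * 1 \<le> \<omega> p * nat \<bar>p j\<bar>" by (rule mult_le_mono2)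
  then show "\<omega> p \<le> n" using le[of j] by linarith
  have "1 \<le> \<omega> p" using assms(2) by (simp add: support_def)
  then have "1 * nat \<bar>p i\<bar> \<le> \<omega> p * nat \<bar>p i\<bar>" by (rule mult_le_mono1)
  then show "\<bar>p i\<bar> \<le> int n" using le[of i] by linarith
qed

definition small_primitives :: "nat \<Rightarrow> ('d::finite \<Rightarrow> int) set" where
  "small_primitives n = {p\<in>primitives. \<forall>i. \<bar>p i\<bar> \<le> int n}"

lemma finite_small_primitives: "finite (small_primitives n :: ('d::finite \<Rightarrow> int) set)"
proof (rule finite_subset)
  show "small_primitives n \<subseteq> PiE (UNIV :: 'd set) (\<lambda>_. {- int n..int n})"
    unfolding small_primitives_def by (auto simp: PiE_def extensional_def abs_le_iff) (smt (verit))
qed (auto intro!: finite_PiE)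

lemma cube_subset_box:
  assumes "small_primitives n \<subseteq> V"
  shows "cube_configs n \<subseteq> PiE_dflt V 0 (\<lambda>_. {..n})"
proof
  fix \<omega> :: "'a config" assume w: "\<omega> \<in> cube_configs n"
  have "\<omega> p \<le> n" for p using cube_bounds(1)[OF w, of p] by (cases "p \<in> support \<omega>") (auto simp: support_def)
  moreover have "\<omega> p = 0" if "p \<notin> V" for p
  proof (rule ccontr)
    assume "\<omega> p \<noteq> 0"
    then have "p \<in> support \<omega>" by (simp add: support_def)
    then have "p \<in> small_primitives n"
      using cube_bounds(2)[OF w] w unfolding small_primitives_def cube_configs_def configs_def by blast
    then show False using that assms by blast
  qed
  ultimately show "\<omega> \<in> PiE_dflt V 0 (\<lambda>_. {..n})" by (auto simp: PiE_dflt_def)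
qed

lemma finite_cube: "finite (cube_configs n :: 'd::finite config set)"
  by (rule finite_subset[OF cube_subset_box[OF order_refl]]) (auto intro: finite_small_primitives)

text \<open>The representative of the \<open>i\<close>-th unit vector.\<close>
definition axis_primitive :: "'d \<Rightarrow> 'd \<Rightarrow> int" where
  "axis_primitive i = (let e = (\<lambda>j. if j = i then 1 else 0) in if e \<in> primitives then e else (\<lambda>j. - e j))"

lemma axis_primitive_in: "axis_primitive i \<in> primitives"
proof -
  let ?e = "\<lambda>j. if j = i then 1 else 0 :: int"
  have "Gcd (range ?e) dvd ?e i" by (rule Gcd_dvd) (rule rangeI)
  then have "Gcd (range ?e) = 1" by simp
  from primitives_cover[OF this] show ?thesis unfolding axis_primitive_def Let_def by auto
qed

lemma axis_primitive_abs: "nat \<bar>axis_primitive i j\<bar> = (if j = i then 1 else 0)"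
  by (auto simp: axis_primitive_def Let_def)

text \<open>Raises each load to \<open>n\<close> by means of the unit vector in that direction.\<close>
definition fill :: "nat \<Rightarrow> 'd::finite config \<Rightarrow> ('d \<Rightarrow> int) \<Rightarrow> nat" where
  "fill n \<omega> = (\<lambda>p. \<omega> p + (\<Sum>i\<in>UNIV. if p = axis_primitive i then n - load \<omega> i else 0))"

lemma fill_in_cube:
  fixes \<omega> :: "'d::finite config"
  assumes \<omega>: "\<omega> \<in> configs" and le: "\<And>i. load \<omega> i \<le> n"
  shows "fill n \<omega> \<in> cube_configs n"
proof -
  define S where "S = support \<omega> \<union> range axis_primitive"
  have S: "finite S" "support \<omega> \<subseteq> S" "S \<subseteq> primitives"
    using \<omega> axis_primitive_in by (auto simp: S_def configs_def)
  have sub: "support (fill n \<omega>) \<subseteq> S"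
  proof
    fix p assume "p \<in> support (fill n \<omega>)"
    then have "\<omega> p \<noteq> 0 \<or> (\<exists>i. p = axis_primitive i)" by (auto simp: support_def fill_def split: if_splits)
    then show "p \<in> S" by (auto simp: S_def support_def)
  qed
  have "load (fill n \<omega>) j = n" for j
  proof -
    have "load (fill n \<omega>) j = (\<Sum>p\<in>S. \<omega> p * nat \<bar>p j\<bar>)
        + (\<Sum>p\<in>S. \<Sum>i\<in>UNIV. if p = axis_primitive i then (n - load \<omega> i) * nat \<bar>p j\<bar> else 0)"
    proof -
      have "fill n \<omega> p * x = \<omega> p * x + (\<Sum>i\<in>UNIV. if p = axis_primitive i then (n - load \<omega> i) * x else 0)" for p x
        unfolding fill_def distrib_right sum_distrib_right by (intro arg_cong2[of _ _ _ _ "(+)"] sum.cong) auto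
      then show ?thesis unfolding load_superset[OF S(1) sub] by (simp add: sum.distrib)
    qed
    also have "(\<Sum>p\<in>S. \<Sum>i\<in>UNIV. if p = axis_primitive i then (n - load \<omega> i) * nat \<bar>p j\<bar> else 0)
       = (\<Sum>i\<in>UNIV. \<Sum>p\<in>S. if p = axis_primitive i then (n - load \<omega> i) * nat \<bar>p j\<bar> else 0)"
      by (rule sum.swap)
    also have "\<dots> = (\<Sum>i\<in>UNIV. (n - load \<omega> i) * nat \<bar>axis_primitive i j\<bar>)"
      using S(1) by (intro sum.cong refl) (simp add: sum.delta S_def)
    also have "\<dots> = n - load \<omega> j"
      by (simp add: axis_primitive_abs if_distrib[of "\<lambda>x. _ * x"] sum.delta cong: if_cong)
    also have "(\<Sum>p\<in>S. \<omega> p * nat \<bar>p j\<bar>) = load \<omega> j" using load_superset[OF S(1,2)] by simp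
    finally show ?thesis using le[of j] by simp
  qed
  then show ?thesis using sub S finite_subset unfolding cube_configs_def configs_def by blast
qed

lemma cube_nonempty: "(cube_configs n :: 'd::finite config set) \<noteq> {}"
proof -
  have "fill n (\<lambda>_. 0) \<in> (cube_configs n :: 'd config set)"
    by (rule fill_in_cube) (auto simp: configs_def support_def load_def)
  then show ?thesis by blast
qed

text \<open>The loads and the filled configuration together determine the original one.\<close>
lemma card_le_cube:
  fixes T :: "'d::finite config set"
  assumes T: "\<And>\<omega>. \<omega> \<in> T \<Longrightarrow> \<omega> \<in> configs" "\<And>\<omega> i. \<omega> \<in> T \<Longrightarrow> load \<omega> i \<le> n"
  shows "card T \<le> card (cube_configs n :: 'd config set) * (n + 1) ^ CARD('d)"
proof -
  let ?\<Omega> = "cube_configs n :: 'd config set"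
  let ?L = "PiE (UNIV :: 'd set) (\<lambda>_. {..n})"
  have "inj_on (\<lambda>\<omega>. (fill n \<omega>, load \<omega>)) T"
  proof (rule inj_onI)
    fix \<omega> \<omega>' assume e: "(fill n \<omega>, load \<omega>) = (fill n \<omega>', load \<omega>')"
    have "\<omega> p = \<omega>' p" for p
    proof -
      have f: "fill n \<omega> p = fill n \<omega>' p" and l: "load \<omega> = load \<omega>'" using e by simp_all
      show ?thesis using f unfolding fill_def l by (rule add_right_imp_eq)
    qed
    then show "\<omega> = \<omega>'" by blast
  qed
  moreover have "(\<lambda>\<omega>. (fill n \<omega>, load \<omega>)) ` T \<subseteq> ?\<Omega> \<times> ?L"
  proof -
    have "fill n \<omega> \<in> ?\<Omega>" if "\<omega> \<in> T" for \<omega> using T that by (intro fill_in_cube)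
    then show ?thesis using T(2) by (auto simp: PiE_def extensional_def)
  qed
  moreover have "finite (?\<Omega> \<times> ?L)" by (intro finite_cartesian_product finite_cube finite_PiE) auto
  ultimately have "card T \<le> card (?\<Omega> \<times> ?L)" by (rule card_inj_on_le)
  also have "\<dots> = card ?\<Omega> * (n + 1) ^ CARD('d)" by (simp add: card_cartesian_product card_PiE)
  finally show ?thesis .
qed

section \<open>Partition functions and exponential moments\<close>

lemma sum_PiE_dflt_prod:
  fixes f :: "'a \<Rightarrow> nat \<Rightarrow> real"
  assumes "finite V"
  shows "(\<Sum>\<omega>\<in>PiE_dflt V 0 (\<lambda>_. {..N}). \<Prod>p\<in>V. f p (\<omega> p)) = (\<Prod>p\<in>V. \<Sum>k\<le>N. f p k)"
proof -
  let ?e = "\<lambda>h x. if x \<in> V then h x else (0 :: nat)"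
  have inj: "inj_on ?e (PiE V (\<lambda>_. {..N}))"
    by (rule inj_onI, rule PiE_ext) (auto simp: fun_eq_iff, metis)
  have "(\<Sum>\<omega>\<in>PiE_dflt V 0 (\<lambda>_. {..N}). \<Prod>p\<in>V. f p (\<omega> p))
      = (\<Sum>\<omega>\<in>PiE V (\<lambda>_. {..N}). \<Prod>p\<in>V. f p (?e \<omega> p))"
    unfolding dflt_image_PiE[symmetric] by (subst sum.reindex[OF inj]) simp
  also have "\<dots> = (\<Sum>\<omega>\<in>PiE V (\<lambda>_. {..N}). \<Prod>p\<in>V. f p (\<omega> p))"
    by (intro sum.cong prod.cong) auto
  also have "\<dots> = (\<Prod>p\<in>V. \<Sum>k\<le>N. f p k)" using assms by (subst prod_sum_PiE) auto
  finally show ?thesis .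
qed

lemma box_configs:
  assumes "finite V" "V \<subseteq> primitives" "\<omega> \<in> PiE_dflt V 0 (\<lambda>_. {..N})"
  shows "\<omega> \<in> configs" "support \<omega> \<subseteq> V"
proof -
  have "\<omega> p = 0" if "p \<notin> V" for p using assms(3) that by (simp add: PiE_dflt_def)
  then show sub: "support \<omega> \<subseteq> V" by (force simp: support_def)
  then show "\<omega> \<in> configs" using assms(1,2) finite_subset unfolding configs_def by blast
qed

text \<open>The infinite sum is \<open>(1 + (y - 1) x) / (1 - x)\<close>; the numerator is at most \<open>exp ((y - 1) x)\<close> for \<open>y\<close> on either
  side of \<open>1\<close>.\<close>
lemma marked_geometric_sum_le:
  fixes x y :: real
  assumes "0 < x" "x < 1" "y \<ge> 0"
  shows "(\<Sum>k\<le>N. (if k = 0 then 1 else y) * x ^ k) \<le> exp ((y - 1) * x - ln (1 - x))"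
proof -
  have "(\<Sum>k\<le>N. (if k = 0 then 1 else y) * x ^ k) = 1 + (\<Sum>k<N. y * (x * x ^ k))"
    by (simp add: sum.atMost_shift)
  also have "(\<Sum>k<N. y * (x * x ^ k)) = y * x * (\<Sum>k<N. x ^ k)" by (simp add: sum_distrib_left mult.assoc)
  also have "\<dots> \<le> y * x * (1 / (1 - x))"
    using assms by (intro mult_left_mono) (auto simp: geometric_sum sum_gp_strict divide_right_mono)
  finally have "(\<Sum>k\<le>N. (if k = 0 then 1 else y) * x ^ k) \<le> 1 + y * x * (1 / (1 - x))" by simp
  also have "\<dots> = (1 + (y - 1) * x) / (1 - x)" using assms by (simp add: field_simps)
  also have "\<dots> \<le> exp ((y - 1) * x) / (1 - x)"
    using assms by (intro divide_right_mono exp_ge_add_one_self) auto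
  also have "\<dots> = exp ((y - 1) * x - ln (1 - x))" using assms by (simp add: exp_diff)
  finally show ?thesis .
qed

context
  fixes a :: "'d::finite \<Rightarrow> real" and b :: real
  assumes a: "\<And>i. a i > 0" and b: "b > 0"
begin

abbreviation q where "q p \<equiv> exp (- b * weight a p)"

abbreviation boltzmann where "boltzmann \<omega> \<equiv> exp (- b * (\<Sum>i\<in>UNIV. a i * real (load \<omega> i)))"

lemma exp_weight_less_1: "p \<in> primitives \<Longrightarrow> q p < 1"
  using weight_pos[of a b, OF a b primitive_nonzero] b by simp

lemma log_term_nonneg: "p \<in> primitives \<Longrightarrow> 0 \<le> - ln (1 - q p)"
  using exp_weight_less_1[of p] by simp

lemma box_prod_form:
  assumes V: "finite V" and sup: "support \<omega> \<subseteq> V"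
  shows "y ^ card (support \<omega>) * boltzmann \<omega>
    = (\<Prod>p\<in>V. (if \<omega> p = 0 then 1 else y) * q p ^ \<omega> p)"
proof -
  have "boltzmann \<omega> = (\<Prod>p\<in>V. q p ^ \<omega> p)"
    unfolding weight_load[OF assms, symmetric] sum_distrib_left exp_sum[OF V]
    by (intro prod.cong) (simp_all add: algebra_simps flip: exp_of_nat_mult)
  moreover have "(\<Prod>p\<in>V. if \<omega> p = 0 then 1 else y) = y ^ card (support \<omega>)"
  proof -
    have "V \<inter> - {p. \<omega> p = 0} = support \<omega>" using sup by (auto simp: support_def)
    then show ?thesis using V by (simp add: prod.If_cases)
  qed
  ultimately show ?thesis by (simp add: prod.distrib)
qed

lemma box_sum_le:
  assumes V: "finite V" "V \<subseteq> primitives" and y: "y \<ge> 0"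
  shows "(\<Sum>\<omega>\<in>PiE_dflt V 0 (\<lambda>_. {..N}). y ^ card (support \<omega>) * boltzmann \<omega>)
     \<le> exp ((y - 1) * (\<Sum>p\<in>V. q p) + (\<Sum>p\<in>V. - ln (1 - q p)))"
proof -
  have "(\<Sum>\<omega>\<in>PiE_dflt V 0 (\<lambda>_. {..N}). y ^ card (support \<omega>) * boltzmann \<omega>)
    = (\<Sum>\<omega>\<in>PiE_dflt V 0 (\<lambda>_. {..N}). \<Prod>p\<in>V. (\<lambda>p k. (if k = 0 then 1 else y) * q p ^ k) p (\<omega> p))"
    using box_prod_form[OF V(1) box_configs(2)[OF V]] by (intro sum.cong) auto
  also have "\<dots> = (\<Prod>p\<in>V. \<Sum>k\<le>N. (if k = 0 then 1 else y) * q p ^ k)"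
    by (rule sum_PiE_dflt_prod[OF V(1)])
  also have "\<dots> \<le> (\<Prod>p\<in>V. exp ((y - 1) * q p - ln (1 - q p)))"
    using V(2) exp_weight_less_1 y
    by (intro prod_mono conjI marked_geometric_sum_le sum_nonneg) auto
  also have "\<dots> = exp (\<Sum>p\<in>V. (y - 1) * q p - ln (1 - q p))"
    using V(1) by (simp add: exp_sum)
  also have "(\<Sum>p\<in>V. (y - 1) * q p - ln (1 - q p))
     = (y - 1) * (\<Sum>p\<in>V. q p) + (\<Sum>p\<in>V. - ln (1 - q p))"
    by (simp add: sum_subtractf sum_distrib_left sum_negf)
  finally show ?thesis .
qed

lemma box_sum_le_partition:
  assumes V: "finite V" "V \<subseteq> primitives"
  shows "(\<Sum>\<omega>\<in>PiE_dflt V 0 (\<lambda>_. {..N}). boltzmann \<omega>) \<le> exp (log_Z a b)"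
proof -
  have "(\<Sum>p\<in>V. - ln (1 - q p)) \<le> log_Z a b"
    unfolding log_Z_def
    using V log_term_nonneg by (intro finite_sum_le_infsum log_Z_sums(2)[of a b, OF a b]) auto
  then have "exp (\<Sum>p\<in>V. - ln (1 - q p)) \<le> exp (log_Z a b)" by simp
  moreover have "(\<Sum>\<omega>\<in>PiE_dflt V 0 (\<lambda>_. {..N}). boltzmann \<omega>)
      \<le> exp (\<Sum>p\<in>V. - ln (1 - q p))"
    using box_sum_le[OF V, of 1 N] by simp
  ultimately show ?thesis by (rule order_trans[rotated])
qed

text \<open>Truncation keeps all sums over configurations finite. The factor \<open>exp (- 1)\<close> given away here is negligible on the
  logarithmic scale.\<close>
lemma box_sum_ge_partition:
  "\<exists>V N. finite V \<and> V \<subseteq> primitives \<and>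
    exp (log_Z a b - 1) \<le> (\<Sum>\<omega>\<in>PiE_dflt V 0 (\<lambda>_. {..N}). boltzmann \<omega>)"
proof -
  let ?l = "\<lambda>p. - ln (1 - q p)"
  have "(sum ?l \<longlongrightarrow> log_Z a b) (finite_subsets_at_top primitives)"
    unfolding log_Z_def by (rule infsum_tendsto[OF log_Z_sums(2)[of a b, OF a b]])
  then have "\<forall>\<^sub>F V in finite_subsets_at_top primitives. sum ?l V > log_Z a b - 1"
    by (rule order_tendstoD) simp
  then obtain V where V: "finite V" "V \<subseteq> primitives" "sum ?l V > log_Z a b - 1"
    unfolding eventually_finite_subsets_at_top by blast
  have "((\<lambda>N. \<Prod>p\<in>V. \<Sum>k\<le>N. q p ^ k) \<longlonglongrightarrow> (\<Prod>p\<in>V. 1 / (1 - q p)))"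
  proof (intro tendsto_prod)
    fix p assume "p \<in> V"
    then have "norm (q p) < 1" using exp_weight_less_1 V(2) by auto
    from geometric_sums[OF this]
    show "(\<lambda>N. \<Sum>k\<le>N. q p ^ k) \<longlonglongrightarrow> 1 / (1 - q p)"
      unfolding sums_def_le .
  qed
  moreover have "exp (log_Z a b - 1) < (\<Prod>p\<in>V. 1 / (1 - q p))"
  proof -
    have "exp (sum ?l V) = (\<Prod>p\<in>V. exp (?l p))" by (rule exp_sum[OF V(1)])
    also have "\<dots> = (\<Prod>p\<in>V. 1 / (1 - q p))"
    proof (intro prod.cong refl)
      have "exp (- ln (1 - x)) = 1 / (1 - x)" if "x < 1" for x :: real
        using that by (simp add: exp_minus inverse_eq_divide)
      then show "exp (?l p) = 1 / (1 - q p)" if "p \<in> V" for p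
        using exp_weight_less_1[of p] V(2) that by blast
    qed
    finally show ?thesis using V(3) by (metis exp_less_cancel_iff)
  qed
  ultimately have "\<forall>\<^sub>F N in sequentially. exp (log_Z a b - 1) < (\<Prod>p\<in>V. \<Sum>k\<le>N. q p ^ k)"
    by (rule order_tendstoD)
  then obtain N where N: "exp (log_Z a b - 1) < (\<Prod>p\<in>V. \<Sum>k\<le>N. q p ^ k)"
    using eventually_happens' sequentially_bot by blast
  also have "(\<Prod>p\<in>V. \<Sum>k\<le>N. q p ^ k)
      = (\<Sum>\<omega>\<in>PiE_dflt V 0 (\<lambda>_. {..N}). \<Prod>p\<in>V. (\<lambda>p k. q p ^ k) p (\<omega> p))"
    by (rule sum_PiE_dflt_prod[OF V(1), symmetric])
  also have "\<dots> = (\<Sum>\<omega>\<in>PiE_dflt V 0 (\<lambda>_. {..N}). boltzmann \<omega>)"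
    using box_prod_form[OF V(1) box_configs(2)[OF V(1,2)], of _ _ 1] by (intro sum.cong) auto
  finally show ?thesis using V by (intro exI[of _ V] exI[of _ N]) auto
qed

end

text \<open>The weight is constant on \<open>cube_configs n\<close>. The estimate holds with every finite set of directions that contains the
  supports of its members, hence in the limit with all of them.\<close>
lemma exp_moment_le:
  fixes b \<theta> :: real
  assumes b: "b > 0"
  shows "(\<Sum>\<omega>\<in>(cube_configs n :: 'd::finite config set). exp (\<theta> * real (card (support \<omega>))))
    \<le> exp (b * real CARD('d) * real n + log_Z (\<lambda>_::'d. 1) b + (exp \<theta> - 1) * prim_sum (\<lambda>_::'d. 1) b)"
proof -
  let ?\<Omega> = "cube_configs n :: 'd config set"
  let ?a = "\<lambda>_::'d. 1 :: real"
  let ?x = "\<lambda>p. exp (- b * weight ?a p)"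
  let ?P = "primitives :: ('d \<Rightarrow> int) set"
  have a: "\<And>i. ?a i > 0" by simp
  let ?g = "\<lambda>V. exp (b * real CARD('d) * real n) * exp ((exp \<theta> - 1) * sum ?x V + (\<Sum>p\<in>V. - ln (1 - ?x p)))"
  have "(?g \<longlongrightarrow> exp (b * real CARD('d) * real n) * exp ((exp \<theta> - 1) * prim_sum ?a b + log_Z ?a b))
      (finite_subsets_at_top ?P)"
    unfolding prim_sum_def log_Z_def
    by (intro tendsto_intros infsum_tendsto summable_prim_sum[of "?a", OF a b]
          log_Z_sums(2)[of "?a" b, OF a b])
  moreover have "\<forall>\<^sub>F V in finite_subsets_at_top ?P. (\<Sum>\<omega>\<in>?\<Omega>. exp (\<theta> * real (card (support \<omega>)))) \<le> ?g V"
  proof (rule eventually_finite_subsets_at_top[THEN iffD2], intro exI conjI allI impI)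
    show "finite (small_primitives n :: ('d \<Rightarrow> int) set)" by (rule finite_small_primitives)
    show "small_primitives n \<subseteq> ?P" by (auto simp: small_primitives_def)
    fix V assume V: "finite V \<and> small_primitives n \<subseteq> V \<and> V \<subseteq> ?P"
    have w: "exp (\<theta> * real (card (support \<omega>)))
        = exp (b * real CARD('d) * real n) * (exp \<theta> ^ card (support \<omega>) * exp (- b * (\<Sum>i\<in>UNIV. ?a i * real (load \<omega> i))))"
      if "\<omega> \<in> ?\<Omega>" for \<omega>
    proof -
      have "(\<Sum>i\<in>UNIV. ?a i * real (load \<omega> i)) = real CARD('d) * real n" using that by (simp add: cube_configs_def)
      then show ?thesis by (simp add: exp_of_nat_mult[symmetric] mult.commute flip: exp_add) 
    qed
    have "(\<Sum>\<omega>\<in>?\<Omega>. exp (\<theta> * real (card (support \<omega>)))) = exp (b * real CARD('d) * real n)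
        * (\<Sum>\<omega>\<in>?\<Omega>. exp \<theta> ^ card (support \<omega>) * exp (- b * (\<Sum>i\<in>UNIV. ?a i * real (load \<omega> i))))"
      by (subst sum_distrib_left, rule sum.cong[OF refl w])
    also have "\<dots> \<le> exp (b * real CARD('d) * real n)
        * (\<Sum>\<omega>\<in>PiE_dflt V 0 (\<lambda>_. {..n}). exp \<theta> ^ card (support \<omega>) * exp (- b * (\<Sum>i\<in>UNIV. ?a i * real (load \<omega> i))))"
      using V cube_subset_box[of n V] by (intro mult_left_mono sum_mono2) auto
    also have "\<dots> \<le> ?g V"
      using box_sum_le[of "?a" b V "exp \<theta>" n, OF a b] V by (intro mult_left_mono) auto
    finally show "(\<Sum>\<omega>\<in>?\<Omega>. exp (\<theta> * real (card (support \<omega>)))) \<le> ?g V" .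
  qed
  ultimately have "(\<Sum>\<omega>\<in>?\<Omega>. exp (\<theta> * real (card (support \<omega>))))
     \<le> exp (b * real CARD('d) * real n) * exp ((exp \<theta> - 1) * prim_sum ?a b + log_Z ?a b)"
    by (rule tendsto_lowerbound) simp
  then show ?thesis by (simp add: algebra_simps flip: exp_add)
qed

text \<open>Jensen's inequality, in the form of the tangent of the exponential function at the mean.\<close>
lemma mean_exp_bound:
  fixes b \<theta> :: real
  assumes b: "b > 0"
  shows "\<theta> * mean_diameter TYPE('d::finite) n \<le> b * real CARD('d) * real n + log_Z (\<lambda>_::'d. 1) b
    + (exp \<theta> - 1) * prim_sum (\<lambda>_::'d. 1) b - ln (real (card (cube_configs n :: 'd config set)))"
proof -
  let ?\<Omega> = "cube_configs n :: 'd config set"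
  let ?R = "b * real CARD('d) * real n + log_Z (\<lambda>_::'d. 1) b + (exp \<theta> - 1) * prim_sum (\<lambda>_::'d. 1) b"
  define N where "N = real (card ?\<Omega>)"
  define m where "m = mean_diameter TYPE('d) n"
  have "finite ?\<Omega>" "?\<Omega> \<noteq> {}" by (rule finite_cube, rule cube_nonempty)
  then have N: "N > 0" unfolding N_def by (simp add: card_gt_0_iff)
  have Nm: "(\<Sum>\<omega>\<in>?\<Omega>. real (card (support \<omega>))) = N * m"
    unfolding m_def N_def mean_diameter_eq[OF finite_cube cube_nonempty] using N[unfolded N_def] by simp
  have "N * exp (\<theta> * m) = (\<Sum>\<omega>\<in>?\<Omega>. exp (\<theta> * m) * (1 + \<theta> * (real (card (support \<omega>)) - m)))"
  proof -
    have "(\<Sum>\<omega>\<in>?\<Omega>. 1 + \<theta> * (real (card (support \<omega>)) - m)) = N + \<theta> * (N * m - N * m)"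
      unfolding Nm[symmetric] by (simp add: sum.distrib sum_subtractf N_def flip: sum_distrib_left)
         (simp add: Nm[unfolded N_def] N_def)
    then show ?thesis by (simp flip: sum_distrib_left)
  qed
  also have "\<dots> \<le> (\<Sum>\<omega>\<in>?\<Omega>. exp (\<theta> * real (card (support \<omega>))))"
  proof (rule sum_mono)
    fix \<omega>
    have "exp (\<theta> * m) * (1 + \<theta> * (real (card (support \<omega>)) - m)) \<le> exp (\<theta> * m) * exp (\<theta> * (real (card (support \<omega>)) - m))"
      by (intro mult_left_mono exp_ge_add_one_self) auto
    also have "\<dots> = exp (\<theta> * real (card (support \<omega>)))" by (simp add: algebra_simps flip: exp_add)
    finally show "exp (\<theta> * m) * (1 + \<theta> * (real (card (support \<omega>)) - m)) \<le> exp (\<theta> * real (card (support \<omega>)))" .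
  qed
  also have "\<dots> \<le> exp ?R" by (rule exp_moment_le[OF b])
  finally have "ln (N * exp (\<theta> * m)) \<le> ln (exp ?R)" using N by (subst ln_le_cancel_iff) auto
  then show ?thesis using N by (simp add: ln_mult m_def N_def)
qed

text \<open>If the tail bounds add up to at most half of the weight that a finite truncation is known to capture, the other half
  sits on configurations with all loads between \<open>M\<close> and \<open>n\<close>. Each of these has weight at most \<open>exp (- b d M)\<close>, and filling bounds their number. The scale
  \<open>1 - t\<close> in one coordinate controls the event that its load exceeds \<open>n\<close>, the scale \<open>1 + s\<close> that it is below \<open>M\<close>.\<close>
lemma count_lower_bound:
  fixes b s t M :: real
  assumes b: "b > 0" and s: "s > 0" and t: "0 < t" "t < 1"
    and tails: "(\<Sum>i\<in>(UNIV :: 'd::finite set). exp (log_Z (\<lambda>j. if j = i then 1 - t else 1) b - t * b * real n)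
        + exp (log_Z (\<lambda>j. if j = i then 1 + s else 1) b + s * b * M))
      \<le> exp (log_Z (\<lambda>_::'d. 1) b - 1) / 2"
  shows "exp (log_Z (\<lambda>_::'d. 1) b - 1) / 2 * exp (b * real CARD('d) * M)
    \<le> real (card (cube_configs n :: 'd config set)) * (real n + 1) ^ CARD('d)"
proof -
  let ?one = "\<lambda>_::'d. 1 :: real"
  let ?E = "\<lambda>a \<omega>. exp (- b * (\<Sum>j\<in>(UNIV::'d set). a j * real (load \<omega> j)))"
  let ?up = "\<lambda>i j :: 'd. if j = i then 1 - t else 1"
  let ?lo = "\<lambda>i j :: 'd. if j = i then 1 + s else 1"
  let ?tail = "\<lambda>\<omega> i. ?E (?up i) \<omega> * exp (- t * b * real n) + ?E (?lo i) \<omega> * exp (s * b * M)"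
  obtain V N where V: "finite V" "V \<subseteq> primitives"
    and ge: "exp (log_Z ?one b - 1) \<le> (\<Sum>\<omega>\<in>PiE_dflt V 0 (\<lambda>_. {..N}). ?E ?one \<omega>)"
    using box_sum_ge_partition[of "?one" b, OF _ b] by auto
  define T where "T = PiE_dflt V 0 (\<lambda>_. {..N})"
  have finT: "finite T" unfolding T_def using V(1) by auto
  define G where "G = {\<omega>\<in>T. \<forall>i. load \<omega> i \<le> n \<and> M \<le> real (load \<omega> i)}"
  have dec: "(\<Sum>j\<in>(UNIV::'d set). (if j = i then 1 + r else 1) * real (load \<omega> j))
      = (\<Sum>j\<in>UNIV. ?one j * real (load \<omega> j)) + r * real (load \<omega> i)" for i r \<omega>
  proof -
    have "(if j = i then 1 + r else 1) * real (load \<omega> j) = ?one j * real (load \<omega> j) + (if j = i then r * real (load \<omega> i) else 0)" for j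
      by (simp add: algebra_simps)
    then show ?thesis by (simp add: sum.distrib)
  qed
  have tilt: "exp (- b * A) \<le> exp (- b * (A + r * X)) * exp c" if "b * (r * X) \<le> c" for A r X c
    using that by (simp add: algebra_simps flip: exp_add)
  have pt: "?E ?one \<omega> \<le> (if \<omega> \<in> G then ?E ?one \<omega> else 0)
      + (\<Sum>i\<in>UNIV. ?tail \<omega> i)" if wT: "\<omega> \<in> T" for \<omega>
  proof (cases "\<omega> \<in> G")
    case True
    have "0 \<le> (\<Sum>i\<in>UNIV. ?tail \<omega> i)"
      by (intro sum_nonneg add_nonneg_nonneg) auto
    then show ?thesis using True by simp
  next
    case False
    then obtain i where i: "load \<omega> i > n \<or> real (load \<omega> i) < M" using wT by (auto simp: G_def not_le)
    have "?E ?one \<omega> \<le> ?tail \<omega> i"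
    proof -
      have "?E ?one \<omega> \<le> ?E (?up i) \<omega> * exp (- t * b * real n)" if "load \<omega> i > n"
      proof -
        have "t * b * real n \<le> t * b * real (load \<omega> i)" using that t b by (intro mult_left_mono) auto
        then have "b * (- t * real (load \<omega> i)) \<le> - t * b * real n" by (simp add: algebra_simps)
        moreover have "(\<Sum>j\<in>UNIV. ?up i j * real (load \<omega> j)) = (\<Sum>j\<in>UNIV. ?one j * real (load \<omega> j)) + - t * real (load \<omega> i)"
          using dec[of i "- t" \<omega>] by (simp only: add_uminus_conv_diff)
        ultimately show ?thesis by (simp only: tilt)
      qed
      moreover have "?E ?one \<omega> \<le> ?E (?lo i) \<omega> * exp (s * b * M)" if "real (load \<omega> i) < M"
      proof -
        have "s * b * real (load \<omega> i) \<le> s * b * M" using that s b by (intro mult_left_mono) auto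
        then have "b * (s * real (load \<omega> i)) \<le> s * b * M" by (simp add: algebra_simps)
        then show ?thesis unfolding dec by (rule tilt)
      qed
      ultimately show ?thesis using i by (auto intro: add_increasing add_increasing2)
    qed
    also have "\<dots> \<le> (\<Sum>i\<in>UNIV. ?tail \<omega> i)"
      by (rule member_le_sum) (auto intro!: add_nonneg_nonneg)
    finally show ?thesis using False by simp
  qed
  have "exp (log_Z ?one b - 1) \<le> (\<Sum>\<omega>\<in>T. ?E ?one \<omega>)" using ge by (simp add: T_def)
  also have "\<dots> \<le> (\<Sum>\<omega>\<in>T. (if \<omega> \<in> G then ?E ?one \<omega> else 0)
      + (\<Sum>i\<in>UNIV. ?tail \<omega> i))"
    by (rule sum_mono[OF pt])
  also have "\<dots> = (\<Sum>\<omega>\<in>T. if \<omega> \<in> G then ?E ?one \<omega> else 0)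
      + (\<Sum>i\<in>UNIV. (\<Sum>\<omega>\<in>T. ?E (?up i) \<omega>) * exp (- t * b * real n) + (\<Sum>\<omega>\<in>T. ?E (?lo i) \<omega>) * exp (s * b * M))"
    unfolding sum.distrib by (subst sum.swap, subst (2) sum.swap) (simp add: sum_distrib_right)
  also have "(\<Sum>\<omega>\<in>T. if \<omega> \<in> G then ?E ?one \<omega> else 0) \<le> real (card G) * exp (- b * real CARD('d) * M)"
  proof -
    have "(\<Sum>\<omega>\<in>T. if \<omega> \<in> G then ?E ?one \<omega> else 0) = (\<Sum>\<omega>\<in>G. ?E ?one \<omega>)"
      using finT by (subst sum.inter_restrict[symmetric]) (auto simp: G_def intro!: sum.cong)
    also have "\<dots> \<le> (\<Sum>\<omega>\<in>G. exp (- b * real CARD('d) * M))"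
    proof (rule sum_mono)
      fix \<omega> assume "\<omega> \<in> G"
      then have "(\<Sum>j\<in>(UNIV::'d set). M) \<le> (\<Sum>j\<in>(UNIV::'d set). ?one j * real (load \<omega> j))"
        by (intro sum_mono) (auto simp: G_def)
      then show "?E ?one \<omega> \<le> exp (- b * real CARD('d) * M)" using b by (simp add: mult.assoc)
    qed
    finally show ?thesis by simp
  qed
  also have "(\<Sum>i\<in>UNIV. (\<Sum>\<omega>\<in>T. ?E (?up i) \<omega>) * exp (- t * b * real n) + (\<Sum>\<omega>\<in>T. ?E (?lo i) \<omega>) * exp (s * b * M))
     \<le> (\<Sum>i\<in>UNIV. exp (log_Z (?up i) b - t * b * real n) + exp (log_Z (?lo i) b + s * b * M))"
  proof (rule sum_mono)
    fix i
    have "(\<Sum>\<omega>\<in>T. ?E (?up i) \<omega>) \<le> exp (log_Z (?up i) b)"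
      unfolding T_def using t by (intro box_sum_le_partition V b) auto
    then have 1: "(\<Sum>\<omega>\<in>T. ?E (?up i) \<omega>) * exp (- t * b * real n) \<le> exp (log_Z (?up i) b) * exp (- t * b * real n)"
      by (rule mult_right_mono) simp
    have "(\<Sum>\<omega>\<in>T. ?E (?lo i) \<omega>) \<le> exp (log_Z (?lo i) b)"
      unfolding T_def using s by (intro box_sum_le_partition V b) auto
    then have 2: "(\<Sum>\<omega>\<in>T. ?E (?lo i) \<omega>) * exp (s * b * M) \<le> exp (log_Z (?lo i) b) * exp (s * b * M)"
      by (rule mult_right_mono) simp
    show "(\<Sum>\<omega>\<in>T. ?E (?up i) \<omega>) * exp (- t * b * real n) + (\<Sum>\<omega>\<in>T. ?E (?lo i) \<omega>) * exp (s * b * M)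
      \<le> exp (log_Z (?up i) b - t * b * real n) + exp (log_Z (?lo i) b + s * b * M)"
      using add_mono[OF 1 2] by (simp flip: exp_add)
  qed
  also note tails
  finally have "exp (log_Z ?one b - 1) / 2 \<le> real (card G) * exp (- b * real CARD('d) * M)" by simp
  then have "exp (log_Z ?one b - 1) / 2 * exp (b * real CARD('d) * M)
      \<le> real (card G) * exp (- b * real CARD('d) * M) * exp (b * real CARD('d) * M)"
    by (rule mult_right_mono) simp
  also have "\<dots> = real (card G)" by (simp add: mult.assoc flip: exp_add)
  also have "\<dots> \<le> real (card (cube_configs n :: 'd config set) * (n + 1) ^ CARD('d))"
    using box_configs(1)[OF V] by (intro of_nat_mono card_le_cube) (auto simp: G_def T_def)
  also have "\<dots> = real (card (cube_configs n :: 'd config set)) * (real n + 1) ^ CARD('d)"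
    by (simp add: add.commute)
  finally show ?thesis .
qed

section \<open>The saddle point and the asymptotics of the mean\<close>

lemma zeta_pos: "d \<ge> 2 \<Longrightarrow> zeta (real d) > 0"
  unfolding zeta_nat by (intro suminf_pos summable_zeta) auto

lemma kappa_pos: "d \<ge> 2 \<Longrightarrow> kappa d > 0"
  using zeta_pos[of d] zeta_pos[of "d + 1"] by (simp add: kappa_def add.commute)

text \<open>The minimiser of \<open>b d n + \<kappa> / b ^ d\<close>.\<close>
definition saddle :: "nat \<Rightarrow> nat \<Rightarrow> real" where
  "saddle d n = (kappa d / real n) powr (1 / (real d + 1))"

context
  fixes d :: nat
  assumes d: "d \<ge> 2"
begin

lemma saddle_pos: "n > 0 \<Longrightarrow> saddle d n > 0"
  using kappa_pos[OF d] by (simp add: saddle_def)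

lemma saddle_power: 
  assumes "n > 0"
  shows "saddle d n ^ (d + 1) * real n = kappa d"
proof -
  have "saddle d n ^ (d + 1) = (kappa d / real n) powr (real (d + 1) * (1 / (real d + 1)))"
    using saddle_pos[OF assms] unfolding saddle_def
    by (subst powr_realpow[symmetric]) (auto simp: powr_powr mult.commute)
  also have "\<dots> = kappa d / real n" using kappa_pos[OF d] assms by (simp add: add.commute)
  finally show ?thesis using assms by simp
qed

lemma saddle_power_d:
  assumes "n > 0"
  shows "saddle d n ^ d = kappa d powr (real d / (real d + 1)) * real n powr (- (real d / (real d + 1)))"
proof -
  have "saddle d n ^ d = (kappa d / real n) powr (real d * (1 / (real d + 1)))"
    using saddle_pos[OF assms] unfolding saddle_def
    by (subst powr_realpow[symmetric]) (auto simp: powr_powr mult.commute)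
  also have "\<dots> = (kappa d / real n) powr (real d / (real d + 1))" by simp
  also have "\<dots> = kappa d powr (real d / (real d + 1)) / real n powr (real d / (real d + 1))"
    by (rule powr_divide)
  finally show ?thesis by (simp only: powr_minus_divide) simp
qed

lemma saddle_tendsto: "filterlim (saddle d) (at_right 0) at_top"
proof -
  have "((\<lambda>n. (kappa d / real n) powr (1 / (real d + 1))) \<longlongrightarrow> 0) at_top"
  proof (rule tendsto_zero_powrI[OF _ tendsto_const])
    show "((\<lambda>n. kappa d / real n) \<longlongrightarrow> 0) at_top" by (rule lim_const_over_n)
  qed (use kappa_pos[OF d] in \<open>auto intro!: always_eventually divide_nonneg_nonneg\<close>)
  moreover have "\<forall>\<^sub>F n in at_top. saddle d n \<in> {0<..} \<and> saddle d n \<noteq> 0"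
    using eventually_gt_at_top[of 0]
  proof eventually_elim
    case (elim n)
    then have "saddle d n > 0" by (rule saddle_pos)
    then show ?case by simp
  qed
  ultimately show ?thesis unfolding filterlim_at saddle_def[abs_def] by simp
qed

lemma log_negligible: "((\<lambda>n. saddle d n ^ d * ln (real n + 1)) \<longlongrightarrow> 0) at_top"
proof -
  define r where "r = real d / (real d + 1)"
  have r: "r > 0" using d by (simp add: r_def)
  have "((\<lambda>n :: nat. real n powr (- r) * ln (real n + 1)) \<longlongrightarrow> 0) at_top"
    using r by real_asymp
  then have "((\<lambda>n :: nat. kappa d powr r * (real n powr (- r) * ln (real n + 1))) \<longlongrightarrow> kappa d powr r * 0) at_top"
    by (intro tendsto_mult tendsto_const)
  moreover have "\<forall>\<^sub>F n in at_top. kappa d powr r * (real n powr (- r) * ln (real n + 1)) = saddle d n ^ d * ln (real n + 1)"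
    using eventually_gt_at_top[of 0] by eventually_elim (simp add: saddle_power_d r_def)
  ultimately show ?thesis by (simp add: tendsto_cong)
qed

end

text \<open>Take \<open>b\<close> larger than the saddle point by the factor \<open>1 + \<eta>\<close>. The typical load is then \<open>n / (1 + \<eta>)\<^sup>d\<^sup>+\<^sup>1\<close>, which lies
  strictly between \<open>M n = n / (1 + \<eta>)\<^sup>d\<^sup>+\<^sup>2\<close> and \<open>n\<close>, so the exponents of both tail bounds stay below that of the
  total weight by a fixed multiple of \<open>1 / b ^ d\<close>.\<close>
lemma card_cube_configs_lower_at:
  fixes \<eta> :: real
  assumes d2: "CARD('d::finite) \<ge> 2" and \<eta>: "\<eta> > 0"
  shows "\<forall>\<^sub>F n in at_top. saddle CARD('d) n ^ CARD('d) * ln (real (card (cube_configs n :: 'd config set)))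
    \<ge> (kappa CARD('d) * (1 + real CARD('d) / (1 + \<eta>)) - \<eta>) / (1 + \<eta>) ^ CARD('d)"
proof -
  let ?lnN = "\<lambda>n. ln (real (card (cube_configs n :: 'd config set)))"
  define d where "d = CARD('d)"
  define \<kappa> where "\<kappa> = kappa d"
  have d: "d \<ge> 2" using d2 by (simp add: d_def)
  have \<kappa>: "\<kappa> > 0" unfolding \<kappa>_def by (rule kappa_pos[OF d])
  \<comment> \<open>The tilts are chosen so that \<open>(1 - t) (1 + \<eta>) ^ (d + 1) > 1\<close> and \<open>1 + s < 1 + \<eta>\<close>.\<close>
  define t where "t = \<eta> / (1 + \<eta>)"
  define s where "s = \<eta> / 2"
  have t: "0 < t" "t < 1" "1 - t = 1 / (1 + \<eta>)" using \<eta> by (auto simp: t_def field_simps)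
  have s: "s > 0" using \<eta> by (simp add: s_def)
  define b where "b n = (1 + \<eta>) * saddle d n" for n
  define M where "M n = real n / (1 + \<eta>) ^ (d + 2)" for n :: nat
  let ?up = "\<lambda>i j :: 'd. if j = i then 1 - t else 1"
  let ?lo = "\<lambda>i j :: 'd. if j = i then 1 + s else 1"
  let ?one = "\<lambda>_ :: 'd. 1 :: real"
  have b_lim: "filterlim b (at_right 0) at_top"
  proof -
    have l: "filterlim (saddle d) (at_right 0) at_top" by (rule saddle_tendsto[OF d])
    then have "((\<lambda>n. (1 + \<eta>) * saddle d n) \<longlongrightarrow> (1 + \<eta>) * 0) at_top"
      unfolding filterlim_at by (intro tendsto_mult tendsto_const) simp
    moreover have "\<forall>\<^sub>F n in at_top. b n \<in> {0<..} \<and> b n \<noteq> 0"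
      using eventually_gt_at_top[of 0]
    proof eventually_elim
      case (elim n)
      then have "b n > 0" using saddle_pos[OF d elim] \<eta> by (simp add: b_def)
      then show ?case by simp
    qed
    ultimately show ?thesis unfolding filterlim_at b_def by simp
  qed
  have b_pos: "b n > 0" if "n > 0" for n using saddle_pos[OF d that] \<eta> by (simp add: b_def)
  have bn: "b n ^ d * (b n * real n) = \<kappa> * (1 + \<eta>) ^ (d + 1)" if "n > 0" for n
  proof -
    have "b n ^ d * (b n * real n) = (1 + \<eta>) ^ (d + 1) * (saddle d n ^ (d + 1) * real n)"
      by (simp add: b_def power_mult_distrib power_add mult_ac)
    then show ?thesis unfolding saddle_power[OF d that] by (simp add: \<kappa>_def)
  qed
  have bM: "b n ^ d * (b n * M n) = \<kappa> / (1 + \<eta>)" if "n > 0" for n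
  proof -
    have "b n ^ d * (b n * M n) = \<kappa> * (1 + \<eta>) ^ (d + 1) / (1 + \<eta>) ^ (d + 2)"
      unfolding M_def bn[OF that, symmetric] by simp
    then show ?thesis using \<eta> by simp
  qed
  have LP: "((\<lambda>n. b n ^ d * log_Z a (b n)) \<longlongrightarrow> \<kappa> / prod a UNIV) at_top"
    if "\<And>i. a i > 0" for a :: "'d \<Rightarrow> real"
    unfolding d_def \<kappa>_def by (rule filterlim_compose[OF log_Z_asymptotic[of a, OF that d2] b_lim])
  have up_prod: "prod (?up i) UNIV = 1 / (1 + \<eta>)" for i using t(3) by simp
  have lo_prod: "prod (?lo i) UNIV = 1 + s" for i by simp
  have up_lim: "((\<lambda>n. b n ^ d * (log_Z (?up i) (b n) - t * b n * real n)) \<longlongrightarrow> \<kappa> * (1 + \<eta>) - t * (\<kappa> * (1 + \<eta>) ^ (d + 1))) at_top" for i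
  proof -
    have "((\<lambda>n. b n ^ d * log_Z (?up i) (b n) - t * (\<kappa> * (1 + \<eta>) ^ (d + 1))) \<longlongrightarrow> \<kappa> / (1 / (1 + \<eta>)) - t * (\<kappa> * (1 + \<eta>) ^ (d + 1))) at_top"
    proof (intro tendsto_diff tendsto_const)
      have "?up i j > 0" for j using t(1,2) by auto
      from LP[of "?up i", OF this] show "((\<lambda>n. b n ^ d * log_Z (?up i) (b n)) \<longlongrightarrow> \<kappa> / (1 / (1 + \<eta>))) at_top"
        unfolding up_prod .
    qed
    moreover have "\<forall>\<^sub>F n in at_top. b n ^ d * log_Z (?up i) (b n) - t * (\<kappa> * (1 + \<eta>) ^ (d + 1))
        = b n ^ d * (log_Z (?up i) (b n) - t * b n * real n)"
      using eventually_gt_at_top[of 0]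
    proof eventually_elim
      case (elim n)
      show ?case unfolding bn[OF elim, symmetric] by (simp add: algebra_simps)
    qed
    ultimately show ?thesis by (simp add: tendsto_cong)
  qed
  have lo_lim: "((\<lambda>n. b n ^ d * (log_Z (?lo i) (b n) + s * b n * M n)) \<longlongrightarrow> \<kappa> / (1 + s) + s * (\<kappa> / (1 + \<eta>))) at_top" for i
  proof -
    have "((\<lambda>n. b n ^ d * log_Z (?lo i) (b n) + s * (\<kappa> / (1 + \<eta>))) \<longlongrightarrow> \<kappa> / (1 + s) + s * (\<kappa> / (1 + \<eta>))) at_top"
    proof (intro tendsto_add tendsto_const)
      have "?lo i j > 0" for j using s by auto
      from LP[of "?lo i", OF this] show "((\<lambda>n. b n ^ d * log_Z (?lo i) (b n)) \<longlongrightarrow> \<kappa> / (1 + s)) at_top"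
        unfolding lo_prod .
    qed
    moreover have "\<forall>\<^sub>F n in at_top. b n ^ d * log_Z (?lo i) (b n) + s * (\<kappa> / (1 + \<eta>))
        = b n ^ d * (log_Z (?lo i) (b n) + s * b n * M n)"
      using eventually_gt_at_top[of 0]
    proof eventually_elim
      case (elim n)
      show ?case unfolding bM[OF elim, symmetric] by (simp add: algebra_simps)
    qed
    ultimately show ?thesis by (simp add: tendsto_cong)
  qed
  have one_lim: "((\<lambda>n. b n ^ d * log_Z ?one (b n)) \<longlongrightarrow> \<kappa>) at_top"
    using LP[of "?one"] by simp
  have up_less: "\<kappa> * (1 + \<eta>) - t * (\<kappa> * (1 + \<eta>) ^ (d + 1)) < \<kappa>"
  proof -
    have "(1 + \<eta>) ^ d > 1" using \<eta> d by (intro one_less_power) auto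
    moreover have "t * (\<kappa> * (1 + \<eta>) ^ (d + 1)) = \<kappa> * \<eta> * (1 + \<eta>) ^ d"
    proof -
      have "t * (1 + \<eta>) = \<eta>" using \<eta> by (simp add: t_def)
      moreover have "t * (\<kappa> * (1 + \<eta>) ^ (d + 1)) = \<kappa> * (t * (1 + \<eta>)) * (1 + \<eta>) ^ d"
        by (simp add: mult_ac)
      ultimately show ?thesis by simp
    qed
    moreover have "\<kappa> * \<eta> * 1 < \<kappa> * \<eta> * (1 + \<eta>) ^ d" if "(1 + \<eta>) ^ d > 1"
      using that \<kappa> \<eta> by (intro mult_strict_left_mono) auto
    ultimately show ?thesis by (simp add: algebra_simps)
  qed
  have lo_less: "\<kappa> / (1 + s) + s * (\<kappa> / (1 + \<eta>)) < \<kappa>"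
  proof -
    have "s * (\<kappa> / (1 + \<eta>)) < s * (\<kappa> / (1 + s))"
      using s \<kappa> \<eta> by (intro mult_strict_left_mono divide_strict_left_mono) (auto simp: s_def)
    then have "\<kappa> / (1 + s) + s * (\<kappa> / (1 + \<eta>)) < (1 + s) * (\<kappa> / (1 + s))"
      by (simp only: distrib_right mult_1 add_less_cancel_left)
    also have "\<dots> = \<kappa>" using s by simp
    finally show ?thesis .
  qed
  \<comment> \<open>Both tail exponents, scaled by \<open>b ^ d\<close>, tend to limits at most \<open>A < \<kappa>\<close>.\<close>
  define A where "A = max (\<kappa> * (1 + \<eta>) - t * (\<kappa> * (1 + \<eta>) ^ (d + 1))) (\<kappa> / (1 + s) + s * (\<kappa> / (1 + \<eta>)))"
  define \<delta> where "\<delta> = (\<kappa> - A) / 3"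
  have \<delta>: "\<delta> > 0" using up_less lo_less unfolding \<delta>_def A_def by simp
  have bd0: "((\<lambda>n. b n ^ d) \<longlongrightarrow> 0) at_top"
  proof -
    have "(b \<longlongrightarrow> 0) at_top" using b_lim by (simp add: filterlim_at)
    then show ?thesis using d by simp
  qed
  have ev_up: "\<forall>\<^sub>F n in at_top. \<forall>i. b n ^ d * (log_Z (?up i) (b n) - t * b n * real n) < A + \<delta>"
  proof (intro eventually_all_finite order_tendstoD(2)[OF up_lim])
    show "\<kappa> * (1 + \<eta>) - t * (\<kappa> * (1 + \<eta>) ^ (d + 1)) < A + \<delta>"
      using \<delta> unfolding A_def by linarith
  qed
  have ev_lo: "\<forall>\<^sub>F n in at_top. \<forall>i. b n ^ d * (log_Z (?lo i) (b n) + s * b n * M n) < A + \<delta>"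
  proof (intro eventually_all_finite order_tendstoD(2)[OF lo_lim])
    show "\<kappa> / (1 + s) + s * (\<kappa> / (1 + \<eta>)) < A + \<delta>"
      using \<delta> unfolding A_def by linarith
  qed
  have ev_one: "\<forall>\<^sub>F n in at_top. b n ^ d * log_Z ?one (b n) > A + 2 * \<delta>"
  proof (rule order_tendstoD(1)[OF one_lim])
    have "\<kappa> = A + 3 * \<delta>" by (simp add: \<delta>_def diff_divide_distrib)
    then show "A + 2 * \<delta> < \<kappa>" using \<delta> by simp
  qed
  have ev_gap: "\<forall>\<^sub>F n in at_top. b n ^ d * (ln (4 * real d) + 1) < \<delta>"
    by (rule order_tendstoD(2)[OF tendsto_mult_right[OF bd0]]) (use \<delta> in simp)
  let ?L = "\<lambda>n. b n ^ d * log_Z ?one (b n) - b n ^ d * (1 + ln 2) + real d * (\<kappa> / (1 + \<eta>)) - real d * (b n ^ d * ln (real n + 1))"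
  have lower: "\<forall>\<^sub>F n in at_top. b n ^ d * ?lnN n
      \<ge> ?L n"
    using ev_up ev_lo ev_one ev_gap eventually_gt_at_top[of 0]
  proof eventually_elim
    case (elim n)
    let ?B = "b n ^ d"
    let ?N = "real (card (cube_configs n :: 'd config set))"
    have B: "?B > 0" using b_pos elim(5) by simp
    have cmp: "exp x \<le> exp (log_Z ?one (b n) - 1) / (4 * real d)" if "?B * x < A + \<delta>" for x
    proof -
      have "?B * x + ?B * (ln (4 * real d) + 1) < ?B * log_Z ?one (b n)"
        using that elim(3,4) by linarith
      then have "?B * (x + (ln (4 * real d) + 1)) < ?B * log_Z ?one (b n)" by (simp add: distrib_left)
      then have "x + ln (4 * real d) \<le> log_Z ?one (b n) - 1" using B by simp
      then have "exp (x + ln (4 * real d)) \<le> exp (log_Z ?one (b n) - 1)" by simp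
      then show ?thesis using d by (simp add: exp_add field_simps)
    qed
    have "(\<Sum>i\<in>(UNIV :: 'd set). exp (log_Z (?up i) (b n) - t * b n * real n)
        + exp (log_Z (?lo i) (b n) + s * b n * M n))
      \<le> (\<Sum>i\<in>(UNIV :: 'd set). exp (log_Z ?one (b n) - 1) / (4 * real d) + exp (log_Z ?one (b n) - 1) / (4 * real d))"
      using elim(1,2) by (intro sum_mono add_mono cmp) auto
    also have "\<dots> = exp (log_Z ?one (b n) - 1) / 2" using d by (simp add: d_def field_simps)
    finally have "exp (log_Z ?one (b n) - 1) / 2 * exp (b n * real d * M n) \<le> ?N * (real n + 1) ^ d"
      unfolding d_def by (rule count_lower_bound[OF b_pos[OF elim(5)] s t(1,2)])
    moreover have N: "?N > 0"
    proof -
      have "finite (cube_configs n :: 'd config set)" "(cube_configs n :: 'd config set) \<noteq> {}"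
        by (rule finite_cube, rule cube_nonempty)
      then show ?thesis by (simp add: card_gt_0_iff)
    qed
    ultimately have "ln (exp (log_Z ?one (b n) - 1) / 2 * exp (b n * real d * M n)) \<le> ln (?N * (real n + 1) ^ d)"
      by (subst ln_le_cancel_iff) auto
    moreover have "ln (exp (log_Z ?one (b n) - 1) / 2 * exp (b n * real d * M n)) = log_Z ?one (b n) - 1 - ln 2 + b n * real d * M n"
      by (simp add: ln_mult ln_div)
    moreover have "ln (?N * (real n + 1) ^ d) = ln ?N + real d * ln (real n + 1)"
      using N by (simp add: ln_mult ln_realpow)
    ultimately have "log_Z ?one (b n) - 1 - ln 2 + b n * real d * M n \<le> ln ?N + real d * ln (real n + 1)" by simp
    then have "?B * (log_Z ?one (b n) - 1 - ln 2 + b n * real d * M n) \<le> ?B * (ln ?N + real d * ln (real n + 1))"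
      using B by (intro mult_left_mono) auto
    then show ?case unfolding bM[OF elim(5), symmetric] by (simp add: algebra_simps)
  qed
  have log0: "((\<lambda>n. b n ^ d * ln (real n + 1)) \<longlongrightarrow> 0) at_top"
    using tendsto_mult_left[OF log_negligible[OF d], of "(1 + \<eta>) ^ d"] by (simp add: b_def power_mult_distrib mult.assoc)
  have "((\<lambda>n. ?L n)
      \<longlongrightarrow> \<kappa> - 0 * (1 + ln 2) + real d * (\<kappa> / (1 + \<eta>)) - real d * 0) at_top"
    by (intro tendsto_intros one_lim bd0 log0)
  moreover have "\<kappa> * (1 + real d / (1 + \<eta>)) - \<eta> < \<kappa> - 0 * (1 + ln 2) + real d * (\<kappa> / (1 + \<eta>)) - real d * 0"
    using \<eta> by (simp add: algebra_simps)
  ultimately have "\<forall>\<^sub>F n in at_top. \<kappa> * (1 + real d / (1 + \<eta>)) - \<eta> <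
     ?L n"
    by (rule order_tendstoD)
  then show ?thesis using lower
  proof eventually_elim
    case (elim n)
    then have "\<kappa> * (1 + real d / (1 + \<eta>)) - \<eta> \<le> (1 + \<eta>) ^ d * (saddle d n ^ d * ?lnN n)"
      by (simp add: b_def power_mult_distrib mult.assoc)
    then show ?case using \<eta> by (simp add: d_def[symmetric] \<kappa>_def[symmetric] divide_le_eq mult.commute)
  qed
qed

lemma card_cube_configs_lower:
  assumes d2: "CARD('d::finite) \<ge> 2" and \<epsilon>: "\<epsilon> > 0"
  shows "\<forall>\<^sub>F n in at_top. saddle CARD('d) n ^ CARD('d) * ln (real (card (cube_configs n :: 'd config set)))
    > (real CARD('d) + 1) * kappa CARD('d) - \<epsilon>"
proof -
  let ?f = "\<lambda>\<eta> :: real. (kappa CARD('d) * (1 + real CARD('d) / (1 + \<eta>)) - \<eta>) / (1 + \<eta>) ^ CARD('d)"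
  have "(?f \<longlongrightarrow> (kappa CARD('d) * (1 + real CARD('d) / (1 + 0)) - 0) / (1 + 0) ^ CARD('d)) (at_right 0)"
    by (intro tendsto_intros) auto
  then have "\<forall>\<^sub>F \<eta> in at_right 0. ?f \<eta> > (real CARD('d) + 1) * kappa CARD('d) - \<epsilon>"
    using \<epsilon> by (intro order_tendstoD(1)) (auto simp: algebra_simps)
  then have "\<forall>\<^sub>F \<eta> in at_right 0. \<eta> > 0 \<and> ?f \<eta> > (real CARD('d) + 1) * kappa CARD('d) - \<epsilon>"
    using eventually_at_right_less[of "0::real"] by eventually_elim auto
  then obtain \<eta> where \<eta>: "\<eta> > 0" "?f \<eta> > (real CARD('d) + 1) * kappa CARD('d) - \<epsilon>"
    using eventually_happens' trivial_limit_at_right_real by blast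
  show ?thesis
    using card_cube_configs_lower_at[OF d2 \<eta>(1)] by eventually_elim (use \<eta>(2) in linarith)
qed

text \<open>Divide by small \<open>\<theta>\<close> of either sign and use that \<open>exp \<theta> - 1\<close> is \<open>\<theta>\<close> up to \<open>\<theta>\<^sup>2\<close>.\<close>
lemma tendsto_of_exponential_bounds:
  fixes M :: "nat \<Rightarrow> real"
  assumes c: "c > 0" and bound: "\<And>\<theta> \<eta>. \<eta> > 0 \<Longrightarrow> \<forall>\<^sub>F n in at_top. \<theta> * M n \<le> (exp \<theta> - 1) * c + \<eta>"
  shows "(M \<longlongrightarrow> c) at_top"
  unfolding tendsto_iff dist_real_def
proof (intro allI impI)
  fix \<epsilon> :: real assume \<epsilon>: "\<epsilon> > 0"
  define \<theta> where "\<theta> = min 1 (\<epsilon> / (2 * c))"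
  have \<theta>: "0 < \<theta>" "\<theta> \<le> 1" "c * \<theta> \<le> \<epsilon> / 2"
    using \<epsilon> c by (auto simp: \<theta>_def min_def field_simps)
  have up: "exp \<theta> - 1 \<le> \<theta> + \<theta>\<^sup>2" using exp_bound[of \<theta>] \<theta> by simp
  have "exp (- \<theta>) \<le> 1 / (1 + \<theta>)"
    using exp_ge_add_one_self[of \<theta>] \<theta> by (simp add: exp_minus field_simps)
  also have "\<dots> \<le> 1 - \<theta> + \<theta>\<^sup>2" using \<theta> by (simp add: field_simps power2_eq_square)
  finally have dn: "exp (- \<theta>) - 1 \<le> - \<theta> + \<theta>\<^sup>2" by simp
  have \<eta>: "\<theta> * \<epsilon> / 4 > 0" using \<theta> \<epsilon> by simp
  show "\<forall>\<^sub>F n in at_top. \<bar>M n - c\<bar> < \<epsilon>"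
    using bound[OF \<eta>, of \<theta>] bound[OF \<eta>, of "- \<theta>"]
  proof eventually_elim
    case (elim n)
    have "\<theta> * M n \<le> (\<theta> + \<theta>\<^sup>2) * c + \<theta> * \<epsilon> / 4"
      using elim(1) mult_right_mono[OF up, of c] c by linarith
    also have "\<dots> = \<theta> * (c + c * \<theta> + \<epsilon> / 4)" by (simp add: algebra_simps power2_eq_square)
    finally have 1: "M n \<le> c + c * \<theta> + \<epsilon> / 4" using \<theta> by simp
    have "\<theta> * (- M n) = - \<theta> * M n" by simp
    also have "\<dots> \<le> (- \<theta> + \<theta>\<^sup>2) * c + \<theta> * \<epsilon> / 4"
      using elim(2) mult_right_mono[OF dn, of c] c by linarith
    also have "\<dots> = \<theta> * (- c + c * \<theta> + \<epsilon> / 4)" by (simp add: algebra_simps power2_eq_square)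
    finally have 2: "- M n \<le> - c + c * \<theta> + \<epsilon> / 4" using \<theta> by (simp only: mult_le_cancel_left_pos)
    show ?case using 1 2 \<theta>(3) \<epsilon> by linarith
  qed
qed

text \<open>At the saddle point \<open>b d n\<close> equals \<open>d \<kappa> / b ^ d\<close>, so after scaling by \<open>b ^ d\<close> the terms \<open>b d n + log Z(b)\<close> and
  the logarithm of the cardinality have the same limit \<open>(d + 1) \<kappa>\<close> and only the term with \<open>F\<close> survives.\<close>
lemma scaled_mean_tendsto:
  assumes d2: "CARD('d::finite) \<ge> 2"
  shows "((\<lambda>n. saddle CARD('d) n ^ CARD('d) * mean_diameter TYPE('d) n) \<longlongrightarrow> 2 ^ (CARD('d) - 1) / zeta (real CARD('d))) at_top"
proof (rule tendsto_of_exponential_bounds)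
  define d where "d = CARD('d)"
  have d: "d \<ge> 2" using d2 by (simp add: d_def)
  let ?c = "2 ^ (d - 1) / zeta (real d)"
  let ?one = "\<lambda>_ :: 'd. 1 :: real"
  show "2 ^ (CARD('d) - 1) / zeta (real CARD('d)) > 0" using zeta_pos[OF d2] by simp
  have LZ: "((\<lambda>n. saddle d n ^ d * log_Z ?one (saddle d n)) \<longlongrightarrow> kappa d) at_top"
    using filterlim_compose[OF log_Z_asymptotic[of "?one", OF _ d2] saddle_tendsto[OF d]] by (simp add: d_def)
  have F: "((\<lambda>n. saddle d n ^ d * prim_sum ?one (saddle d n)) \<longlongrightarrow> ?c) at_top"
    using filterlim_compose[OF prim_sum_asymptotic[of "?one", OF _ d2] saddle_tendsto[OF d]] by (simp add: d_def)
  fix \<theta> \<eta> :: real assume \<eta>: "\<eta> > 0"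
  have "((\<lambda>n. saddle d n ^ d * log_Z ?one (saddle d n) + (exp \<theta> - 1) * (saddle d n ^ d * prim_sum ?one (saddle d n)))
      \<longlongrightarrow> kappa d + (exp \<theta> - 1) * ?c) at_top"
    by (intro tendsto_intros LZ F)
  then have "\<forall>\<^sub>F n in at_top. saddle d n ^ d * log_Z ?one (saddle d n) + (exp \<theta> - 1) * (saddle d n ^ d * prim_sum ?one (saddle d n))
      < kappa d + (exp \<theta> - 1) * ?c + \<eta> / 2"
    using \<eta> by (intro order_tendstoD(2)) auto
  moreover have "\<forall>\<^sub>F n in at_top. saddle d n ^ d * ln (real (card (cube_configs n :: 'd config set)))
      > (real d + 1) * kappa d - \<eta> / 2"
    unfolding d_def using \<eta> by (intro card_cube_configs_lower[OF d2]) auto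
  ultimately have "\<forall>\<^sub>F n in at_top. \<theta> * (saddle d n ^ d * mean_diameter TYPE('d) n) \<le> (exp \<theta> - 1) * ?c + \<eta>"
    using eventually_gt_at_top[of 0]
  proof eventually_elim
    case (elim n)
    let ?b = "saddle d n"
    let ?lnN = "ln (real (card (cube_configs n :: 'd config set)))"
    have b: "?b > 0" by (rule saddle_pos[OF d elim(3)])
    have "\<theta> * mean_diameter TYPE('d) n \<le> ?b * real d * real n + log_Z ?one ?b + (exp \<theta> - 1) * prim_sum ?one ?b - ?lnN"
      unfolding d_def by (rule mean_exp_bound) (use b in \<open>simp add: d_def\<close>)
    then have "?b ^ d * (\<theta> * mean_diameter TYPE('d) n)
        \<le> ?b ^ d * (?b * real d * real n + log_Z ?one ?b + (exp \<theta> - 1) * prim_sum ?one ?b - ?lnN)"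
      using b by (intro mult_left_mono) auto
    also have "\<dots> = real d * (?b ^ (d + 1) * real n) + (?b ^ d * log_Z ?one ?b + (exp \<theta> - 1) * (?b ^ d * prim_sum ?one ?b)) - ?b ^ d * ?lnN"
      by (simp add: algebra_simps)
    also have "\<dots> \<le> (exp \<theta> - 1) * ?c + \<eta>"
      using elim(1,2) unfolding saddle_power[OF d elim(3)] by (simp add: algebra_simps)
    finally show ?case by (simp add: algebra_simps)
  qed
  then show "\<forall>\<^sub>F n in at_top. \<theta> * (saddle CARD('d) n ^ CARD('d) * mean_diameter TYPE('d) n)
      \<le> (exp \<theta> - 1) * (2 ^ (CARD('d) - 1) / zeta (real CARD('d))) + \<eta>"
    by (simp add: d_def)
qed

theorem theorem1p4:
  assumes "CARD('d::finite) \<ge> 2"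
  shows "mean_diameter TYPE('d) \<sim>[at_top]
    (\<lambda>n. root (CARD('d) + 1) (kappa (CARD('d))) / zeta (real (CARD('d)) + 1)
           * real n powr (real (CARD('d)) / (real (CARD('d)) + 1)))"
proof (rule asymp_equivI')
  define d where "d = CARD('d)"
  have d: "d \<ge> 2" using assms by (simp add: d_def)
  define c where "c = 2 ^ (d - 1) / zeta (real d)"
  let ?t = "\<lambda>n. root (d + 1) (kappa d) / zeta (real d + 1) * real n powr (real d / (real d + 1))"
  have z: "zeta (real d + 1) > 0" using zeta_pos[of "d + 1"] d by (simp add: add.commute)
  have kc: "kappa d = c * zeta (real d + 1)" by (simp add: kappa_def c_def)
  have c: "c > 0" unfolding c_def using zeta_pos[OF d] by simp
  note k = kappa_pos[OF d]
  have "saddle d n ^ d * ?t n = c" if n: "n > 0" for n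
  proof -
    have "root (d + 1) (kappa d) = kappa d powr (1 / (real d + 1))"
      using k by (simp add: root_powr_inverse add.commute)
    then have "saddle d n ^ d * ?t n = (kappa d powr (real d / (real d + 1)) * kappa d powr (1 / (real d + 1)))
        * (real n powr (- (real d / (real d + 1))) * real n powr (real d / (real d + 1))) / zeta (real d + 1)"
      unfolding saddle_power_d[OF d n] by simp
    also have "kappa d powr (real d / (real d + 1)) * kappa d powr (1 / (real d + 1)) = kappa d"
      using k by (simp add: powr_add[symmetric] add_divide_distrib[symmetric])
    also have "real n powr (- (real d / (real d + 1))) * real n powr (real d / (real d + 1)) = 1"
      using n by (simp add: powr_minus)
    finally show ?thesis using z by (simp add: kc)
  qed
  note scale = this
  have "\<forall>\<^sub>F n in at_top. saddle d n ^ d * mean_diameter TYPE('d) n / c = mean_diameter TYPE('d) n / ?t n"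
    using eventually_gt_at_top[of 0]
  proof eventually_elim
    case (elim n)
    have "saddle d n ^ d \<noteq> 0" using saddle_pos[OF d elim] by simp
    then show ?case unfolding scale[OF elim, symmetric] by (rule mult_divide_mult_cancel_left)
  qed
  moreover have "((\<lambda>n. saddle d n ^ d * mean_diameter TYPE('d) n / c) \<longlongrightarrow> c / c) at_top"
    using scaled_mean_tendsto[OF assms] c unfolding d_def c_def by (intro tendsto_divide tendsto_const) auto
  ultimately show "((\<lambda>n. mean_diameter TYPE('d) n / (root (CARD('d) + 1) (kappa (CARD('d))) / zeta (real (CARD('d)) + 1)
           * real n powr (real (CARD('d)) / (real (CARD('d)) + 1)))) \<longlongrightarrow> 1) at_top"
    using c by (simp add: tendsto_cong d_def)
qed

end
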